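(* Let $n\geq 1$ and let $T$ be a Hermite-Calderón-Zygmund operator on $\mathbb{R}^n$. Then $T$ is a bounded operator on $BMO_H(\mathbb{R}^n)$ (i.e. there is a constant $A$ such that $\|\mathbb{T}f\|_{BMO_H(\mathbb{R}^n)}\leq A\|f\|_{BMO_H(\mathbb{R}^n)}$ for all $f\in BMO_H(\mathbb{R}^n)$, where $\mathbb{T}$ is the definition of $T$ on $BMO_H(\mathbb{R}^n)$) if and only if there exists $C>0$ such that the following two conditions hold, where $T1:=\mathbb{T}1$: (i) $\displaystyle \frac{1}{|B(x,\gamma(x))|}\int_{B(x,\gamma(x))}|T1(y)|\,dy\leq C$ for every $x\in\mathbb{R}^n$; and (ii) $\displaystyle \left(1+\log\left(\frac{\gamma(x)}{s}\right)\right)\frac{1}{|B(x,s)|}\int_{B(x,s)}|T1(y)-(T1)_{B(x,s)}|\,dy \leq C$ for every $x\in\mathbb{R}^n$ and $s>0$ such that $0<s\leq\gamma(x)$.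
   Context: $B(x,r)$ is the ball in $\mathbb{R}^n$ with center $x$ and radius $r$; for a ball $B$, $|B|$ is its Lebesgue measure and $f_B=\frac{1}{|B|}\int_B f(x)\,dx$. The critical radii function is $\gamma(x)=\frac{1}{1+|x|}$ if $|x|\geq 1$ and $\gamma(x)=\frac12$ if $|x|<1$. The space $BMO_H(\mathbb{R}^n)$: a locally integrable function $f$ on $\mathbb{R}^n$ belongs to $BMO_H(\mathbb{R}^n)$ if there exists $C>0$ such that (a) $\frac{1}{|B|}\int_B|f(x)-f_B|\,dx\leq C$ for every ball $B$ in $\mathbb{R}^n$, and (b) $\frac{1}{|B|}\int_B|f(x)|\,dx\leq C$ for every ball $B=B(x_0,r_0)$ with $x_0\in\mathbb{R}^n$ and $r_0\geq\gamma(x_0)$. The norm $\|f\|_{BMO_H(\mathbb{R}^n)}$ is the infimum of the $C\geq 0$ such that (a) and (b) hold. Hermite-Calderón-Zygmund operator: let $L^2_c(\mathbb{R}^n)$ be the set of $f\in L^2(\mathbb{R}^n)$ with compact support. Let $T$ be a bounded linear operator on $L^2(\mathbb{R}^n)$ such that $Tf(x)=\int_{\mathbb{R}^n}K(x,y)f(y)\,dy$ for $f\in L^2_c(\mathbb{R}^n)$ and a.e. $x\notin\operatorname{supp}(f)$. $T$ is a Hermite-Calderón-Zygmund operator if, for some constants $C,c>0$: (1) $|K(x,y)|\leq\frac{C}{|x-y|^n}e^{-c[|x||x-y|+|x-y|^2]}$ for all $x,y\in\mathbb{R}^n$ with $x\neq y$; (2) $|K(x,y)-K(x,z)|+|K(y,x)-K(z,x)|\leq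 C\frac{|y-z|}{|x-y|^{n+1}}$ whenever $|x-y|>2|y-z|$. Definition of $T$ on $BMO_H(\mathbb{R}^n)$: with $B_R:=B(0,R)$, for $f\in BMO_H(\mathbb{R}^n)$ and $R>1$ set $$\mathbb{T}f(x)=T(f\chi_{B_R})(x)+\int_{B_R^c}K(x,y)f(y)\,dy,\quad\text{a.e. }x\in B_R.$$ This is consistent: if $S>R>1$, the definitions using $B_S$ and $B_R$ coincide a.e. in $B_R$. The function $T1$ is $\mathbb{T}$ applied to the constant function $1$ (which belongs to $BMO_H(\mathbb{R}^n)$). *)

theory Defs
  imports "HOL-Analysis.Analysis"
begin

text \<open>
  Functions on \<open>real^'n\<close> are Lebesgue measurable with values in a type \<open>'k\<close> of sort
  \<open>{real_normed_field, euclidean_space}\<close>, so that the real and the complex case are both covered.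
  Classes modulo null sets are represented by functions.
\<close>

definition critical_radius :: "real^'n \<Rightarrow> real" where
  "critical_radius x = (if norm x \<ge> 1 then 1 / (1 + norm x) else 1/2)"

definition mean_on :: "(real^'n) set \<Rightarrow> (real^'n \<Rightarrow> 'k::{banach, second_countable_topology}) \<Rightarrow> 'k" where
  "mean_on B f = (1 / measure lebesgue B) *\<^sub>R (LINT x:B|lebesgue. f x)"

definition locally_integrable ::
    "(real^'n \<Rightarrow> 'k::{banach, second_countable_topology}) \<Rightarrow> bool" where
  "locally_integrable f \<longleftrightarrow> (\<forall>S. compact S \<longrightarrow> set_integrable lebesgue S f)"

definition BMOH_bound ::
    "(real^'n \<Rightarrow> 'k::{banach, second_countable_topology}) \<Rightarrow> real \<Rightarrow> bool" where
  "BMOH_bound f C \<longleftrightarrow>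
     (\<forall>x r. r > 0 \<longrightarrow> mean_on (ball x r) (\<lambda>y. norm (f y - mean_on (ball x r) f)) \<le> C) \<and>
     (\<forall>x r. r \<ge> critical_radius x \<longrightarrow> mean_on (ball x r) (\<lambda>y. norm (f y)) \<le> C)"

definition BMOH :: "(real^'n \<Rightarrow> 'k::{banach, second_countable_topology}) set" where
  "BMOH = {f. locally_integrable f \<and> (\<exists>C>0. BMOH_bound f C)}"

definition BMOH_norm :: "(real^'n \<Rightarrow> 'k::{banach, second_countable_topology}) \<Rightarrow> real" where
  "BMOH_norm f = Inf {C. C \<ge> 0 \<and> BMOH_bound f C}"

definition L2 :: "(real^'n \<Rightarrow> 'k::{banach, second_countable_topology}) set" where
  "L2 = {f. f \<in> borel_measurable lebesgue \<and> integrable lebesgue (\<lambda>x. (norm (f x))\<^sup>2)}"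

definition L2norm :: "(real^'n \<Rightarrow> 'k::{banach, second_countable_topology}) \<Rightarrow> real" where
  "L2norm f = sqrt (LINT x|lebesgue. (norm (f x))\<^sup>2)"

text \<open>
  Linearity is required almost everywhere. Together with the norm bound it implies that the
  a.e. class of \<open>T f\<close> depends only on the a.e. class of \<open>f\<close>.
\<close>

definition bounded_linear_L2 ::
    "((real^'n \<Rightarrow> 'k::{real_normed_field, euclidean_space}) \<Rightarrow> real^'n \<Rightarrow> 'k) \<Rightarrow> bool" where
  "bounded_linear_L2 T \<longleftrightarrow>
     (\<forall>f\<in>L2. T f \<in> L2) \<and>
     (\<forall>f\<in>L2. \<forall>g\<in>L2. AE x in lebesgue. T (\<lambda>y. f y + g y) x = T f x + T g x) \<and>
     (\<forall>a. \<forall>f\<in>L2. AE x in lebesgue. T (\<lambda>y. a * f y) x = a * T f x) \<and>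
     (\<exists>M. \<forall>f\<in>L2. L2norm (T f) \<le> M * L2norm f)"

text \<open>
  The support of a measurable function in the a.e. sense: the complement of the largest open
  set on which it vanishes almost everywhere.
\<close>

definition ess_support :: "(real^'n \<Rightarrow> 'k::zero) \<Rightarrow> (real^'n) set" where
  "ess_support f = - \<Union>{U. open U \<and> (AE x\<in>U in lebesgue. f x = 0)}"

definition L2c :: "(real^'n \<Rightarrow> 'k::{banach, second_countable_topology}) set" where
  "L2c = {f \<in> L2. compact (ess_support f)}"

definition hermite_kernel ::
    "(real^'n \<Rightarrow> real^'n \<Rightarrow> 'k::real_normed_field) \<Rightarrow> bool" where
  "hermite_kernel K \<longleftrightarrow> (\<exists>C>0. \<exists>c>0.
     (\<forall>x y. x \<noteq> y \<longrightarrow>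
        norm (K x y) \<le> C / norm (x - y) ^ CARD('n)
                        * exp (- c * (norm x * norm (x - y) + (norm (x - y))\<^sup>2))) \<and>
     (\<forall>x y z. norm (x - y) > 2 * norm (y - z) \<longrightarrow>
        norm (K x y - K x z) + norm (K y x - K z x)
          \<le> C * (norm (y - z) / norm (x - y) ^ (CARD('n) + 1))))"

definition hermite_CZ ::
    "((real^'n \<Rightarrow> 'k::{real_normed_field, euclidean_space}) \<Rightarrow> real^'n \<Rightarrow> 'k) \<Rightarrow>
     (real^'n \<Rightarrow> real^'n \<Rightarrow> 'k) \<Rightarrow> bool" where
  "hermite_CZ T K \<longleftrightarrow>
     bounded_linear_L2 T \<and>
     (\<forall>f\<in>L2c. AE x in lebesgue. x \<notin> ess_support f \<longrightarrow>
        T f x = (LINT y|lebesgue. K x y * f y)) \<and>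
     hermite_kernel K"

text \<open>
  \<open>g\<close> is a version of the extension of \<open>T\<close> at \<open>f\<close> if the defining formula with cut-off radius
  \<open>R\<close> holds a.e. in the ball of radius \<open>R\<close>, for every \<open>R > 1\<close>. This determines \<open>g\<close> up to a null
  set, and for \<open>f\<close> in \<open>BMOH\<close> a version exists because the formulas for different radii agree a.e.;
  \<open>BMOH_ext T K f\<close> is any one of the versions.
\<close>

definition BMOH_ext_version ::
    "((real^'n \<Rightarrow> 'k::{real_normed_field, euclidean_space}) \<Rightarrow> real^'n \<Rightarrow> 'k) \<Rightarrow>
     (real^'n \<Rightarrow> real^'n \<Rightarrow> 'k) \<Rightarrow> (real^'n \<Rightarrow> 'k) \<Rightarrow> (real^'n \<Rightarrow> 'k) \<Rightarrow> bool" where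
  "BMOH_ext_version T K f g \<longleftrightarrow>
     (\<forall>R>1. AE x\<in>ball 0 R in lebesgue.
        g x = T (\<lambda>y. indicator (ball 0 R) y * f y) x
              + (LINT y:- ball 0 R|lebesgue. K x y * f y))"

definition BMOH_ext ::
    "((real^'n \<Rightarrow> 'k::{real_normed_field, euclidean_space}) \<Rightarrow> real^'n \<Rightarrow> 'k) \<Rightarrow>
     (real^'n \<Rightarrow> real^'n \<Rightarrow> 'k) \<Rightarrow> (real^'n \<Rightarrow> 'k) \<Rightarrow> real^'n \<Rightarrow> 'k" where
  "BMOH_ext T K f = (SOME g. BMOH_ext_version T K f g)"

definition bounded_on_BMOH ::
    "((real^'n \<Rightarrow> 'k::{banach, second_countable_topology}) \<Rightarrow> real^'n \<Rightarrow> 'k) \<Rightarrow> bool" where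
  "bounded_on_BMOH S \<longleftrightarrow>
     (\<exists>A. \<forall>f\<in>BMOH. S f \<in> BMOH \<and> BMOH_norm (S f) \<le> A * BMOH_norm f)"

end

theory Submission imports Defs begin

text \<open>
  The proof compares the oscillation of the extension of \<open>T\<close> at \<open>f\<close> with that of \<open>T1\<close>. For a ball \<open>B\<close> write \<open>f\<close>
  as the sum of \<open>(f - f\<^sub>B)\<close> restricted to the doubled ball, \<open>(f - f\<^sub>B)\<close> restricted to its complement, and the constant \<open>f\<^sub>B\<close>. The
  first piece is controlled by the boundedness of \<open>T\<close> on \<open>L\<^sup>2\<close>, because a function of bounded mean oscillation has
  bounded oscillation in mean square (John_Nirenberg_square). The image of the second piece varies little on \<open>B\<close>, by the
  smoothness of the kernel. The third piece contributes \<open>f\<^sub>B * T1\<close>. So, up to a multiple of the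
  norm of \<open>f\<close>, the oscillation over \<open>B\<close> of the image of \<open>f\<close> and \<open>\<bar>f\<^sub>B\<bar>\<close> times the oscillation of \<open>T1\<close> bound
  each other (BMOH_ext_decomposition, BMOH_ext_oscillation).

  Both directions follow from this comparison. Let \<open>\<gamma>\<close> be the critical radius of the centre of a ball \<open>B\<close> of
  radius \<open>s \<le> \<gamma>\<close>. Since the mean of \<open>f\<close> over a ball of radius at least \<open>\<gamma>\<close> is bounded and
  doubling the radius changes the mean by a bounded amount, \<open>\<bar>f\<^sub>B\<bar>\<close> is at most a multiple of
  \<open>1 + ln (\<gamma> / s)\<close> (bmo_mean_le); hence the logarithmic decay of the oscillation of \<open>T1\<close> implies that the oscillation of the image is
  bounded. Conversely, a logarithm truncated at the radii \<open>s\<close> and \<open>\<gamma>\<close> has norm bounded independently of \<open>s\<close> and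
  the centre, while its mean over \<open>B\<close> is \<open>ln (\<gamma> / s)\<close> (bmo_witness_truncated_log); inserting it shows that
  boundedness of the extension forces that decay. Boundedness also puts \<open>T1\<close> itself in the space, which gives the bound on its
  means over critical balls.

  On balls of at least critical radius the mean of the modulus of the image is to be bounded. There \<open>f\<close> itself is bounded in
  mean square, and the exponential decay of the kernel makes the contribution of the complement of
  the doubled ball bounded (BMOH_ext_mean_critical).

  The extension is defined by a formula on each ball around the origin. The formulas agree on overlaps, so a common version
  exists (version_exists), and the formula then holds on arbitrary balls (version_local). That is what
  allows splitting at the doubled ball of an arbitrary \<open>B\<close>.
\<close>

section \<open>Means over balls\<close>

lemma measure_ball_eq:
  fixes x :: "real^'n"
  assumes "r \<ge> 0"
  shows "measure lebesgue (ball x r) = unit_ball_vol (real CARD('n)) * r ^ CARD('n)"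
  using content_ball[OF assms, of x] by (simp add: measure_completion)

lemma measure_ball_pos:
  fixes x :: "real^'n"
  assumes "r > 0"
  shows "measure lebesgue (ball x r) > 0"
  using assms measure_ball_eq[of r x] by simp

lemma measure_ball_scale:
  fixes x y :: "real^'n"
  assumes "r \<ge> 0" "c \<ge> 0"
  shows "measure lebesgue (ball y (c * r)) = c ^ CARD('n) * measure lebesgue (ball x r)"
  unfolding measure_ball_eq[OF assms(1)] measure_ball_eq[OF mult_nonneg_nonneg[OF assms(2,1)]]
  by (simp add: power_mult_distrib)

lemma emeasure_ball_eq_measure:
  fixes x :: "real^'n"
  shows "emeasure lebesgue (ball x r) = ennreal (measure lebesgue (ball x r))"
  using emeasure_lborel_ball_finite[of x r]
  by (intro emeasure_eq_ennreal_measure) (auto simp: top_unique)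

lemma set_integrable_norm:
  fixes f :: "'a \<Rightarrow> 'b::{banach, second_countable_topology}"
  assumes "set_integrable M A f"
  shows "set_integrable M A (\<lambda>x. norm (f x))"
  using integrable_norm[OF assms[unfolded set_integrable_def]]
  by (simp add: set_integrable_def)

lemma set_integral_norm_le:
  fixes f :: "'a \<Rightarrow> 'b::{banach, second_countable_topology}"
  shows "norm (LINT x:A|M. f x) \<le> (LINT x:A|M. norm (f x))"
  using integral_norm_bound[of M "\<lambda>x. indicator A x *\<^sub>R f x"]
  by (simp add: set_lebesgue_integral_def)

lemma set_integrable_const_ball [simp]:
  fixes x :: "real^'n"
  shows "set_integrable lebesgue (ball x r) (\<lambda>_. c::'b::{banach, second_countable_topology})"
  unfolding set_integrable_def
  by (intro integrable_scaleR_left integrable_real_indicator) (auto simp: emeasure_lborel_ball_finite[unfolded infinity_ennreal_def])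

lemma locally_integrable_ball:
  assumes "locally_integrable f"
  shows "set_integrable lebesgue (ball x r) f"
  using assms set_integrable_subset[of lebesgue "cball x r" f "ball x r"]
  unfolding locally_integrable_def by (auto simp: ball_subset_cball)

lemma locally_integrable_continuous:
  fixes f :: "real^'n \<Rightarrow> 'k::{banach, second_countable_topology}"
  assumes "continuous_on UNIV f"
  shows "locally_integrable f"
  unfolding locally_integrable_def
proof (intro allI impI)
  fix S :: "(real^'n) set" assume "compact S"
  then have i: "integrable lborel (\<lambda>x. indicator S x *\<^sub>R f x)"
    by (rule borel_integrable_compact) (rule continuous_on_subset[OF assms], simp)
  then show "set_integrable lebesgue S f"
    using borel_measurable_integrable[OF i] by (simp add: set_integrable_def integrable_completion)
qed

lemma locally_integrable_norm_diff:
  fixes f :: "real^'n \<Rightarrow> 'k::{banach, second_countable_topology}"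
  assumes "locally_integrable f"
  shows "locally_integrable (\<lambda>y. norm (f y - c))"
  using assms locally_integrable_continuous[of "\<lambda>_. c"] unfolding locally_integrable_def
  by (auto intro!: set_integrable_norm set_integral_diff)

lemma locally_integrable_norm_diff_ball:
  fixes f :: "real^'n \<Rightarrow> 'k::{banach, second_countable_topology}"
  assumes "locally_integrable f"
  shows "set_integrable lebesgue (ball x r) (\<lambda>y. norm (f y - c))"
  by (intro locally_integrable_ball locally_integrable_norm_diff assms)

lemma mean_on_mono:
  fixes f g :: "real^'n \<Rightarrow> real"
  assumes "set_integrable lebesgue B f" "set_integrable lebesgue B g" "\<And>x. x \<in> B \<Longrightarrow> f x \<le> g x"
  shows "mean_on B f \<le> mean_on B g"
  unfolding mean_on_def using set_integral_mono[OF assms]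
  by (auto intro!: divide_right_mono)

lemma mean_on_nonneg:
  fixes f :: "real^'n \<Rightarrow> real"
  assumes "\<And>x. x \<in> B \<Longrightarrow> 0 \<le> f x"
  shows "0 \<le> mean_on B f"
  unfolding mean_on_def set_lebesgue_integral_def using assms
  by (auto intro!: mult_nonneg_nonneg integral_nonneg simp: indicator_def)

lemma mean_on_cong:
  assumes "B \<in> sets lebesgue" "\<And>x. x \<in> B \<Longrightarrow> f x = g x"
  shows "mean_on B f = mean_on B g"
proof -
  have "(LINT x:B|lebesgue. f x) = (LINT x:B|lebesgue. g x)"
    using assms by (intro set_lebesgue_integral_cong) auto
  then show ?thesis by (simp add: mean_on_def)
qed

lemma mean_on_add:
  assumes "set_integrable lebesgue B f" "set_integrable lebesgue B g"
  shows "mean_on B (\<lambda>x. f x + g x) = mean_on B f + mean_on B g"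
  unfolding mean_on_def using set_integral_add(2)[OF assms] by (simp add: scaleR_add_right)

lemma mean_on_diff:
  assumes "set_integrable lebesgue B f" "set_integrable lebesgue B g"
  shows "mean_on B (\<lambda>x. f x - g x) = mean_on B f - mean_on B g"
  unfolding mean_on_def using set_integral_diff(2)[OF assms] by (simp add: scaleR_diff_right)

lemma mean_on_mult_left:
  fixes f :: "real^'n \<Rightarrow> 'k::{real_normed_field, banach, second_countable_topology}"
  shows "mean_on B (\<lambda>x. c * f x) = c * mean_on B f"
  unfolding mean_on_def by simp

lemma mean_on_const:
  fixes x :: "real^'n"
  assumes "r > 0"
  shows "mean_on (ball x r) (\<lambda>_. c) = c"
proof -
  have "(LINT y:ball x r|lebesgue. c) = measure lebesgue (ball x r) *\<^sub>R c"
    unfolding set_lebesgue_integral_def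
    by (subst has_bochner_integral_integral_eq[OF has_bochner_integral_indicator])
       (auto simp: emeasure_lborel_ball_finite[unfolded infinity_ennreal_def])
  then show ?thesis using measure_ball_pos[OF assms, of x] by (simp add: mean_on_def)
qed

lemma norm_mean_on_le:
  "norm (mean_on B f) \<le> mean_on B (\<lambda>x. norm (f x))"
  unfolding mean_on_def using set_integral_norm_le[of lebesgue B f]
  by (auto intro!: mult_left_mono simp: divide_right_mono)

lemma norm_mean_on_diff_const_le:
  fixes x :: "real^'n"
  assumes "set_integrable lebesgue (ball x r) f" "r > 0"
  shows "norm (mean_on (ball x r) f - c) \<le> mean_on (ball x r) (\<lambda>y. norm (f y - c))"
proof -
  have "mean_on (ball x r) (\<lambda>y. f y - c) = mean_on (ball x r) f - c"
    using mean_on_diff[OF assms(1), of "\<lambda>_. c"] mean_on_const[OF assms(2), of x c] by simp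
  then show ?thesis using norm_mean_on_le[of "ball x r" "\<lambda>y. f y - c"] by simp
qed

text \<open>
  The mean minimises the mean distance up to a factor 2, so an oscillation may be estimated
  with whichever constant is convenient.
\<close>

lemma oscillation_le_twice:
  fixes x :: "real^'n"
  assumes f: "set_integrable lebesgue (ball x r) f" and r: "r > 0"
  shows "mean_on (ball x r) (\<lambda>y. norm (f y - mean_on (ball x r) f))
      \<le> 2 * mean_on (ball x r) (\<lambda>y. norm (f y - c))"
proof -
  let ?B = "ball x r"
  have i: "set_integrable lebesgue ?B (\<lambda>y. norm (f y - d))" for d
    by (intro set_integrable_norm set_integral_diff f) simp
  have "mean_on ?B (\<lambda>y. norm (f y - mean_on ?B f))
      \<le> mean_on ?B (\<lambda>y. norm (f y - c) + norm (mean_on ?B f - c))"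
  proof (rule mean_on_mono)
    show "norm (f y - mean_on ?B f) \<le> norm (f y - c) + norm (mean_on ?B f - c)" for y
      using norm_triangle_ineq4[of "f y - c" "mean_on ?B f - c"] by simp
  qed (auto intro!: i set_integral_add)
  also have "\<dots> = mean_on ?B (\<lambda>y. norm (f y - c)) + norm (mean_on ?B f - c)"
    by (subst mean_on_add) (auto simp: i mean_on_const r)
  also have "\<dots> \<le> 2 * mean_on ?B (\<lambda>y. norm (f y - c))"
    using norm_mean_on_diff_const_le[OF f r, of c] by simp
  finally show ?thesis .
qed

lemma set_integral_mono_subset:
  fixes f :: "'a \<Rightarrow> real"
  assumes "set_integrable M B f" "A \<in> sets M" "A \<subseteq> B" "\<And>x. x \<in> B \<Longrightarrow> 0 \<le> f x"
  shows "(LINT x:A|M. f x) \<le> (LINT x:B|M. f x)"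
  unfolding set_lebesgue_integral_def
  using assms set_integrable_subset[OF assms(1-3)]
  by (intro integral_mono) (auto simp: set_integrable_def indicator_def)

lemma mean_on_ball_le_scale:
  fixes x y :: "real^'n"
  assumes f: "set_integrable lebesgue (ball y (c * r)) f" "\<And>z. z \<in> ball y (c * r) \<Longrightarrow> 0 \<le> f z"
    and r: "r > 0" "c > 0" and sub: "ball x r \<subseteq> ball y (c * r)"
  shows "mean_on (ball x r) f \<le> c ^ CARD('n) * mean_on (ball y (c * r)) f"
proof -
  have "(LINT z:ball x r|lebesgue. f z) \<le> (LINT z:ball y (c * r)|lebesgue. f z)"
    using f sub by (intro set_integral_mono_subset) auto
  then show ?thesis
    using measure_ball_scale[of r c y x] measure_ball_pos[OF r(1), of x] r
    by (simp add: mean_on_def field_simps)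
qed

lemma set_integral_ball_eq_mean:
  fixes x :: "real^'n"
  assumes "r > 0"
  shows "(LINT z:ball x r|lebesgue. f z) = measure lebesgue (ball x r) *\<^sub>R mean_on (ball x r) f"
  using measure_ball_pos[OF assms, of x] by (simp add: mean_on_def)

lemma locally_integrable_measurable:
  fixes f :: "real^'n \<Rightarrow> 'k::{banach, second_countable_topology}"
  assumes "locally_integrable f"
  shows "f \<in> borel_measurable lebesgue"
proof (rule borel_measurable_LIMSEQ_metric)
  show "(\<lambda>x. indicator (ball 0 (real i)) x *\<^sub>R f x) \<in> borel_measurable lebesgue" for i
    using locally_integrable_ball[OF assms, of 0 "real i"] by (auto simp: set_integrable_def)
  show "(\<lambda>i. indicator (ball 0 (real i)) x *\<^sub>R f x) \<longlonglongrightarrow> f x" for x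
  proof (rule tendsto_eventually)
    obtain m :: nat where m: "norm x < real m" using reals_Archimedean2 by blast
    show "\<forall>\<^sub>F i in sequentially. indicator (ball 0 (real i)) x *\<^sub>R f x = f x"
      using eventually_ge_at_top[of m]
      by (rule eventually_mono) (use m in \<open>auto simp: indicator_def\<close>)
  qed
qed

lemma mean_on_double_ball_diff:
  fixes f :: "real^'n \<Rightarrow> 'k::{banach, second_countable_topology}"
  assumes f: "locally_integrable f" and r: "r > 0"
    and osc: "mean_on (ball x (2 * r)) (\<lambda>y. norm (f y - mean_on (ball x (2 * r)) f)) \<le> N"
  shows "norm (mean_on (ball x (2 * r)) f - mean_on (ball x r) f) \<le> 2 ^ CARD('n) * N"
proof -
  let ?c = "mean_on (ball x (2 * r)) f"
  have i: "set_integrable lebesgue (ball x s) (\<lambda>y. norm (f y - ?c))" for s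
    by (rule locally_integrable_norm_diff_ball[OF f])
  have "norm (mean_on (ball x r) f - ?c) \<le> mean_on (ball x r) (\<lambda>y. norm (f y - ?c))"
    by (intro norm_mean_on_diff_const_le locally_integrable_ball f r)
  also have "\<dots> \<le> 2 ^ CARD('n) * mean_on (ball x (2 * r)) (\<lambda>y. norm (f y - ?c))"
    using r by (intro mean_on_ball_le_scale i) auto
  also have "\<dots> \<le> 2 ^ CARD('n) * N" using osc by simp
  finally show ?thesis by (simp add: norm_minus_commute)
qed

text \<open>
  Each doubling of the radius moves the mean by at most a constant, so means change only
  logarithmically with the radius. This is where the logarithm in the criterion comes from.
\<close>

lemma mean_on_dyadic_ball_diff:
  fixes f :: "real^'n \<Rightarrow> 'k::{banach, second_countable_topology}"
  assumes f: "locally_integrable f" and r: "r > 0"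
    and osc: "\<And>s. s > 0 \<Longrightarrow> mean_on (ball x s) (\<lambda>y. norm (f y - mean_on (ball x s) f)) \<le> N"
  shows "norm (mean_on (ball x (2 ^ k * r)) f - mean_on (ball x r) f) \<le> real k * (2 ^ CARD('n) * N)"
proof (induction k)
  case (Suc k)
  have "norm (mean_on (ball x (2 * (2 ^ k * r))) f - mean_on (ball x (2 ^ k * r)) f) \<le> 2 ^ CARD('n) * N"
    using r by (intro mean_on_double_ball_diff f osc) auto
  then show ?case using Suc norm_triangle_ineq[of
      "mean_on (ball x (2 * (2 ^ k * r))) f - mean_on (ball x (2 ^ k * r)) f"
      "mean_on (ball x (2 ^ k * r)) f - mean_on (ball x r) f"]
    by (simp add: algebra_simps)
qed simp

lemma mean_on_dyadic_ball_osc: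
  fixes f :: "real^'n \<Rightarrow> 'k::{banach, second_countable_topology}"
  assumes f: "locally_integrable f" and r: "r > 0"
    and osc: "\<And>s. s > 0 \<Longrightarrow> mean_on (ball x s) (\<lambda>y. norm (f y - mean_on (ball x s) f)) \<le> N"
  shows "mean_on (ball x (2 ^ k * r)) (\<lambda>y. norm (f y - mean_on (ball x r) f))
     \<le> (1 + real k * 2 ^ CARD('n)) * N"
proof -
  let ?B = "ball x (2 ^ k * r)" and ?c = "mean_on (ball x r) f"
  have i: "set_integrable lebesgue (ball x s) (\<lambda>y. norm (f y - c))" for s c
    by (rule locally_integrable_norm_diff_ball[OF f])
  have r': "2 ^ k * r > 0" using r by simp
  have "mean_on ?B (\<lambda>y. norm (f y - ?c)) \<le> mean_on ?B (\<lambda>y. norm (f y - mean_on ?B f) + norm (mean_on ?B f - ?c))"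
  proof (rule mean_on_mono)
    show "norm (f y - ?c) \<le> norm (f y - mean_on ?B f) + norm (mean_on ?B f - ?c)" for y
      using norm_triangle_ineq[of "f y - mean_on ?B f" "mean_on ?B f - ?c"] by simp
  qed (auto intro!: i set_integral_add)
  also have "\<dots> = mean_on ?B (\<lambda>y. norm (f y - mean_on ?B f)) + norm (mean_on ?B f - ?c)"
    by (subst mean_on_add) (auto simp: i mean_on_const r)
  also have "\<dots> \<le> N + real k * (2 ^ CARD('n) * N)"
    by (intro add_mono osc r' mean_on_dyadic_ball_diff f r)
  finally show ?thesis by (simp add: algebra_simps)
qed

section \<open>The John--Nirenberg inequality in mean square\<close>

text \<open>
  A weak form of Lebesgue's differentiation theorem: control of the means over balls shrinking
  to a point controls the value there, up to a dimensional constant. The library differentiates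
  along the cubes with corner \<open>y\<close> and side \<open>t\<close>; each lies in the ball around \<open>y\<close> of radius \<open>2 n t\<close>,
  and comparing the two volumes produces the constant.
\<close>

lemma AE_le_if_ball_means_le:
  fixes h :: "real^'n \<Rightarrow> real"
  assumes h: "locally_integrable h" and nonneg: "\<And>x. 0 \<le> h x"
  shows "AE y in lebesgue. \<forall>a. \<forall>r>0. (\<forall>k::nat. mean_on (ball y (r / 5 ^ k)) h \<le> a) \<longrightarrow>
    h y \<le> unit_ball_vol (real CARD('n)) * (2 * real CARD('n)) ^ CARD('n) * a"
proof -
  let ?n = "CARD('n)" and ?v = "unit_ball_vol (real CARD('n))"
  have "h integrable_on cbox a b" for a b
  proof -
    have "set_integrable lebesgue (cbox a b) h"
      using h unfolding locally_integrable_def by auto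
    then show ?thesis by (rule set_lebesgue_integral_eq_integral)
  qed
  then obtain Z where Z: "negligible Z" and
    lim: "\<And>x e. x \<notin> Z \<Longrightarrow> 0 < e \<Longrightarrow> \<exists>d>0. \<forall>t. 0 < t \<and> t < d \<longrightarrow>
       norm (integral (cbox x (x + t *\<^sub>R One)) h /\<^sub>R t ^ DIM(real^'n) - h x) < e"
    using integrable_ccontinuous_explicit[of h] by blast
  have "h y \<le> ?v * (2 * real ?n) ^ ?n * a"
    if y: "y \<notin> Z" and r: "r > 0" and m: "\<And>k::nat. mean_on (ball y (r / 5 ^ k)) h \<le> a" for y a r
  proof (rule field_le_epsilon)
    fix e :: real assume e: "e > 0"
    obtain d where d: "d > 0" and dd: "\<And>t. 0 < t \<Longrightarrow> t < d \<Longrightarrow>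
       norm (integral (cbox y (y + t *\<^sub>R One)) h /\<^sub>R t ^ DIM(real^'n) - h y) < e"
      using lim[OF y e] by auto
    \<comment> \<open>pick a scale at which the cube average is already within e of the value h y\<close>
    have "(\<lambda>k. r / (2 * real ?n) * (1 / 5) ^ k) \<longlonglongrightarrow> r / (2 * real ?n) * 0"
      by (intro tendsto_intros LIMSEQ_realpow_zero) auto
    then have "\<forall>\<^sub>F k in sequentially. r / (2 * real ?n) * (1 / 5) ^ k < d"
      by (rule order_tendstoD(2)) (use d in simp)
    then obtain k where k: "r / (2 * real ?n) * (1 / 5) ^ k < d"
      by (auto simp: eventually_sequentially)
    define \<rho> where "\<rho> = r / 5 ^ k"
    define t where "t = \<rho> / (2 * real ?n)"
    have \<rho>: "\<rho> > 0" using r by (simp add: \<rho>_def)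
    have t: "t > 0" "t < d" using \<rho> k by (auto simp: t_def \<rho>_def field_simps)
    have \<rho>t: "\<rho> = (2 * real ?n) * t" by (simp add: t_def)
    have sub: "cbox y (y + t *\<^sub>R One) \<subseteq> ball y \<rho>"
    proof
      have One_nth: "(One :: real^'n) $ i = 1" for i
        unfolding cart_eq_inner_axis[of "One :: real^'n"] by (rule inner_sum_Basis) (auto simp: Basis_vec_def)
      fix z assume z': "z \<in> cbox y (y + t *\<^sub>R One)"
      then have z: "\<bar>(z - y) $ i\<bar> \<le> t" for i
        using spec[OF iffD1[OF mem_box_cart(2) z'], of i] t
        by (simp only: vector_add_component vector_scaleR_component vector_minus_component One_nth) auto
      have "norm (z - y) \<le> (\<Sum>i\<in>UNIV. \<bar>(z - y) $ i\<bar>)" by (rule norm_le_l1_cart)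
      also have "\<dots> \<le> (\<Sum>i\<in>(UNIV::'n set). t)" by (rule sum_mono) (use z in auto)
      also have "\<dots> = real ?n * t" by simp
      also have "\<dots> < \<rho>" using t by (simp add: \<rho>t)
      finally show "z \<in> ball y \<rho>" by (simp add: dist_norm norm_minus_commute)
    qed
    have "integral (cbox y (y + t *\<^sub>R One)) h = (LINT z:cbox y (y + t *\<^sub>R One)|lebesgue. h z)"
      using h unfolding locally_integrable_def
      by (intro set_lebesgue_integral_eq_integral(2)[symmetric]) auto
    also have "\<dots> \<le> (LINT z:ball y \<rho>|lebesgue. h z)"
      using sub nonneg by (intro set_integral_mono_subset locally_integrable_ball h) auto
    also have "\<dots> = measure lebesgue (ball y \<rho>) * mean_on (ball y \<rho>) h"
      using set_integral_ball_eq_mean[OF \<rho>, of y h] by simp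
    also have "\<dots> \<le> measure lebesgue (ball y \<rho>) * a"
      using m[of k] by (intro mult_left_mono) (auto simp: \<rho>_def)
    also have "\<dots> = (?v * (2 * real ?n) ^ ?n * a) * t ^ ?n"
      unfolding measure_ball_eq[OF less_imp_le[OF \<rho>]] by (simp add: power_mult_distrib \<rho>t)
    finally have "integral (cbox y (y + t *\<^sub>R One)) h / t ^ ?n \<le> ?v * (2 * real ?n) ^ ?n * a"
      using t by (simp add: field_simps)
    then show "h y \<le> ?v * (2 * real ?n) ^ ?n * a + e"
      using dd[OF t] by (simp add: abs_if divide_inverse mult.commute split: if_splits)
  qed
  then have "\<forall>a. \<forall>r>0. (\<forall>k::nat. mean_on (ball y (r / 5 ^ k)) h \<le> a) \<longrightarrow> h y \<le> ?v * (2 * real ?n) ^ ?n * a"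
    if "y \<notin> Z" for y using that by blast
  then show ?thesis
    using Z unfolding negligible_iff_null_sets by (intro AE_I'[of Z]) auto
qed

text \<open>
  The counting step of a Vitali argument: the sets \<open>Y i\<close> are dominated by disjoint sets \<open>X i\<close>, and on
  each \<open>X i\<close> the mean of \<open>h\<close> is at least \<open>a\<close>, so the total measure is paid for by the integral of \<open>h\<close>.
\<close>

lemma emeasure_countable_cover_le:
  fixes X Y :: "'i \<Rightarrow> 'a set" and a b J :: real and h :: "'a \<Rightarrow> real"
  assumes C: "countable C" and disj: "\<And>i j. i \<in> C \<Longrightarrow> j \<in> C \<Longrightarrow> i \<noteq> j \<Longrightarrow> X i \<inter> X j = {}"
    and X: "\<And>i. i \<in> C \<Longrightarrow> X i \<in> sets M" "\<And>i. i \<in> C \<Longrightarrow> X i \<subseteq> S"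
    and Y: "\<And>i. i \<in> C \<Longrightarrow> Y i \<in> sets M" "\<And>i. i \<in> C \<Longrightarrow> emeasure M (Y i) \<le> ennreal b * emeasure M (X i)"
    and S: "S \<in> sets M" and h: "set_integrable M S h" "\<And>x. x \<in> S \<Longrightarrow> 0 \<le> h x"
    and a: "a > 0" "\<And>i. i \<in> C \<Longrightarrow> emeasure M (X i) \<le> ennreal ((LINT x:X i|M. h x) / a)"
    and b: "b \<ge> 0"
  shows "emeasure M (\<Union>i\<in>C. Y i) \<le> ennreal (b * (LINT x:S|M. h x) / a)"
proof (cases "C = {}")
  case True
  then show ?thesis by simp
next
  case False
  \<comment> \<open>reindex by natural numbers, with empty sets at the unused indices, to apply countable additivity\<close>
  define D where "D = to_nat_on C ` C"
  define Xn where "Xn m = (if m \<in> D then X (from_nat_into C m) else {})" for m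
  define Yn where "Yn m = (if m \<in> D then Y (from_nat_into C m) else {})" for m
  have fC: "from_nat_into C m \<in> C" for m using False by (rule from_nat_into)
  have inj: "from_nat_into C m \<noteq> from_nat_into C k" if "m \<in> D" "k \<in> D" "m \<noteq> k" for m k
    using that C by (auto simp: D_def)
  have sX: "Xn m \<in> sets M" and sY: "Yn m \<in> sets M" for m
    using X Y fC by (auto simp: Xn_def Yn_def)
  have df: "disjoint_family Xn"
    unfolding disjoint_family_on_def Xn_def using disj fC inj by auto
  have UY: "(\<Union>i\<in>C. Y i) = (\<Union>m. Yn m)"
  proof -
    have "Y i \<subseteq> Yn (to_nat_on C i)" if "i \<in> C" for i
      using that C by (auto simp: Yn_def D_def)
    then show ?thesis using fC by (fastforce simp: Yn_def split: if_splits)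
  qed
  have Ym: "emeasure M (Yn m) \<le> ennreal b * emeasure M (Xn m)" for m
    using Y fC by (auto simp: Xn_def Yn_def)
  define H where "H x = ennreal (indicator S x * h x)" for x
  have Hm: "H \<in> borel_measurable M"
    using h(1) unfolding H_def set_integrable_def by simp
  have Xm: "emeasure M (Xn m) \<le> ennreal (1 / a) * (\<integral>\<^sup>+x\<in>Xn m. H x \<partial>M)" for m
  proof (cases "m \<in> D")
    case True
    let ?X = "X (from_nat_into C m)"
    have sub: "?X \<subseteq> S" and mX: "?X \<in> sets M" using X fC by auto
    have int: "set_integrable M ?X h" by (rule set_integrable_subset[OF h(1) mX sub])
    have "(\<integral>\<^sup>+x\<in>?X. H x \<partial>M) = (\<integral>\<^sup>+x. ennreal (indicator ?X x *\<^sub>R h x) \<partial>M)"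
      using sub by (intro nn_integral_cong) (auto simp: H_def indicator_def)
    also have "\<dots> = ennreal (LINT x:?X|M. h x)"
      unfolding set_lebesgue_integral_def using int sub h(2)
      by (intro nn_integral_eq_integral) (auto simp: set_integrable_def indicator_def)
    finally have eq: "(\<integral>\<^sup>+x\<in>?X. H x \<partial>M) = ennreal (LINT x:?X|M. h x)" .
    have "0 \<le> (LINT x:?X|M. h x)"
      unfolding set_lebesgue_integral_def using sub h(2)
      by (intro Bochner_Integration.integral_nonneg) (auto simp: indicator_def)
    then have "ennreal ((LINT x:?X|M. h x) / a) = ennreal (1 / a) * ennreal (LINT x:?X|M. h x)"
      using a(1) by (simp flip: ennreal_mult)
    then show ?thesis using a(2)[OF fC, of m] eq True by (simp add: Xn_def)
  qed (simp add: Xn_def)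
  have "emeasure M (\<Union>m. Yn m) \<le> (\<Sum>m. emeasure M (Yn m))"
    using sY by (intro emeasure_subadditive_countably) auto
  also have "\<dots> \<le> (\<Sum>m. ennreal b * (ennreal (1 / a) * (\<integral>\<^sup>+x\<in>Xn m. H x \<partial>M)))"
    by (intro suminf_le summableI order_trans[OF Ym mult_left_mono[OF Xm]]) auto
  also have "\<dots> = ennreal b * (ennreal (1 / a) * (\<Sum>m. \<integral>\<^sup>+x\<in>Xn m. H x \<partial>M))"
    by simp
  also have "(\<Sum>m. \<integral>\<^sup>+x\<in>Xn m. H x \<partial>M) = (\<integral>\<^sup>+x\<in>(\<Union>m. Xn m). H x \<partial>M)"
    using Hm sX df by (rule nn_integral_disjoint_family[symmetric])
  also have "\<dots> \<le> (\<integral>\<^sup>+x. ennreal (indicator S x *\<^sub>R h x) \<partial>M)"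
    by (intro nn_integral_mono) (auto simp: H_def indicator_def)
  also have "\<dots> = ennreal (LINT x:S|M. h x)"
    unfolding set_lebesgue_integral_def using h
    by (intro nn_integral_eq_integral) (auto simp: set_integrable_def indicator_def)
  also have "ennreal b * (ennreal (1 / a) * ennreal (LINT x:S|M. h x)) = ennreal (b * (LINT x:S|M. h x) / a)"
  proof -
    have "0 \<le> (LINT x:S|M. h x)"
      unfolding set_lebesgue_integral_def using h(2)
      by (intro Bochner_Integration.integral_nonneg) (auto simp: indicator_def)
    then show ?thesis using a(1) b by (simp flip: ennreal_mult)
  qed
  finally show ?thesis unfolding UY by (simp add: mult_left_mono)
qed

text \<open>
  The level increment after which the distribution function of the oscillation is halved, in units
  of the oscillation bound. The last factor bounds the integral of \<open>\<bar>f - f\<^sub>B\<bar>\<close> over the doubled ball, \<open>2 * 5 ^ n\<close>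
  pays for the Vitali enlargement and the halving, and the first factor is the loss in the
  differentiation theorem.
\<close>

definition JN_step :: "'n::finite itself \<Rightarrow> real" where
  "JN_step _ = (1 + unit_ball_vol (real CARD('n)) * (2 * real CARD('n)) ^ CARD('n)) *
     (2 * 5 ^ CARD('n) * (2 ^ CARD('n) * (1 + 2 ^ CARD('n))))"

text \<open>
  Induction on the level \<open>m\<close>. For a ball \<open>B\<close> put \<open>h = \<bar>f - f\<^sub>B\<bar>\<close> and consider around each point of \<open>B\<close> the balls
  of radius \<open>r / 5 ^ k\<close>. Stop at the largest of these on which the mean of \<open>h\<close> exceeds \<open>a\<close>; by
  differentiation almost every point with \<open>h\<close> large is stopped. Vitali selects disjoint stopped
  balls whose fivefold enlargements cover all stopped points. The choice of \<open>a\<close> makes the total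
  measure of the enlargements at most half that of \<open>B\<close>. An enlargement is the ball of the previous step, where the
  mean of \<open>h\<close> was still at most \<open>a\<close>, so there \<open>f\<^sub>B\<close> is within \<open>a\<close> of the mean of \<open>f\<close>, and the induction
  hypothesis on the enlargements gives the next level.
\<close>

lemma John_Nirenberg_distribution:
  fixes f :: "real^'n \<Rightarrow> 'k::{banach, second_countable_topology}"
  assumes f: "locally_integrable f" and N: "N > 0"
    and osc: "\<And>x r. r > 0 \<Longrightarrow> mean_on (ball x r) (\<lambda>y. norm (f y - mean_on (ball x r) f)) \<le> N"
    and r: "r > 0"
  shows "emeasure lebesgue {y\<in>ball x r. norm (f y - mean_on (ball x r) f) > real m * (JN_step TYPE('n) * N)}
    \<le> ennreal ((1/2) ^ m * measure lebesgue (ball x r))"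
  using r
proof (induction m arbitrary: x r)
  case 0
  have "emeasure lebesgue {y\<in>ball x r. norm (f y - mean_on (ball x r) f) > 0} \<le> emeasure lebesgue (ball x r)"
    by (intro emeasure_mono) auto
  also have "\<dots> = ennreal (measure lebesgue (ball x r))"
    by (rule emeasure_ball_eq_measure)
  finally show ?case by simp
next
  case (Suc m)
  let ?n = "CARD('n)"
  define B where "B = ball x r"
  define c where "c = mean_on B f"
  define h where "h y = norm (f y - c)" for y
  define q :: real where "q = unit_ball_vol (real ?n) * (2 * real ?n) ^ ?n"
  define c1 :: real where "c1 = 2 ^ ?n * (1 + 2 ^ ?n)"
  define a where "a = 2 * 5 ^ ?n * c1 * N"
  have q0: "q \<ge> 0" by (simp add: q_def)
  have c10: "c1 > 0" by (simp add: c1_def add_pos_nonneg)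
  have a0: "a > 0" using N c10 by (simp add: a_def)
  have c1a: "c1 * N \<le> a"
  proof -
    have "1 * (c1 * N) \<le> (2 * 5 ^ ?n) * (c1 * N)"
      using c10 N order_trans[OF one_le_power[of "5::real" ?n], of "2 * 5 ^ ?n"] by (intro mult_right_mono mult_nonneg_nonneg) auto
    then show ?thesis by (simp add: a_def)
  qed
  have stp: "JN_step TYPE('n) * N = (1 + q) * a"
    by (simp add: JN_step_def q_def a_def c1_def)
  have fm: "f \<in> borel_measurable lebesgue" by (rule locally_integrable_measurable[OF f])
  have hm: "h \<in> borel_measurable lebesgue" unfolding h_def using fm by measurable
  have hl: "locally_integrable h"
    unfolding h_def by (rule locally_integrable_norm_diff[OF f])
  have h0: "h y \<ge> 0" for y by (simp add: h_def)
  have hi: "set_integrable lebesgue (ball y s) h" for y s by (rule locally_integrable_ball[OF hl])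
  have mean2: "mean_on (ball x (2 * r)) h \<le> (1 + 2 ^ ?n) * N"
    using mean_on_dyadic_ball_osc[OF f \<open>r > 0\<close> osc, where k = 1 and x = x] by (simp add: h_def[abs_def] c_def B_def)
  have int2: "(LINT y:ball x (2 * r)|lebesgue. h y) \<le> c1 * N * measure lebesgue B"
  proof -
    have "(LINT y:ball x (2 * r)|lebesgue. h y) = measure lebesgue (ball x (2 * r)) * mean_on (ball x (2 * r)) h"
      using set_integral_ball_eq_mean[of "2 * r" x h] \<open>r > 0\<close> by simp
    also have "\<dots> \<le> measure lebesgue (ball x (2 * r)) * ((1 + 2 ^ ?n) * N)"
      by (intro mult_left_mono mean2) simp
    also have "measure lebesgue (ball x (2 * r)) = 2 ^ ?n * measure lebesgue B"
      unfolding B_def by (rule measure_ball_scale) (use \<open>r > 0\<close> in auto)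
    finally show ?thesis by (simp add: c1_def mult_ac)
  qed
  \<comment> \<open>the ball of radius r around a point of B does not stop, hence every stopped ball has a predecessor\<close>
  have start: "mean_on (ball y r) h \<le> a" if "y \<in> B" for y
  proof -
    have "mean_on (ball y r) h \<le> 2 ^ ?n * mean_on (ball x (2 * r)) h"
    proof (rule mean_on_ball_le_scale[OF hi h0])
      show "ball y r \<subseteq> ball x (2 * r)"
      proof
        fix z assume "z \<in> ball y r"
        then show "z \<in> ball x (2 * r)" using that dist_triangle[of x z y] by (simp add: B_def)
      qed
    qed (use \<open>r > 0\<close> in auto)
    also have "\<dots> \<le> 2 ^ ?n * ((1 + 2 ^ ?n) * N)" by (intro mult_left_mono mean2) simp
    also have "\<dots> \<le> a" using c1a by (simp add: c1_def mult_ac)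
    finally show ?thesis .
  qed
  define P where "P y k \<longleftrightarrow> a < mean_on (ball y (r / 5 ^ k)) h" for y and k :: nat
  define K where "K = {y\<in>B. \<exists>k. P y k}"
  define k where "k y = (LEAST j. P y j)" for y
  define \<rho> where "\<rho> y = r / 5 ^ k y" for y
  have Pk: "P y (k y)" if "y \<in> K" for y
    using that unfolding K_def k_def by (auto intro: LeastI)
  have k0: "k y > 0" if "y \<in> K" for y
    using Pk[OF that] start[of y] that by (cases "k y") (auto simp: P_def K_def)
  have \<rho>0: "0 < \<rho> y" "\<rho> y \<le> r" for y
    using \<open>r > 0\<close> by (auto simp: \<rho>_def field_simps)
  have big: "a < mean_on (ball y (\<rho> y)) h" if "y \<in> K" for y
    using Pk[OF that] by (simp add: P_def \<rho>_def)
  have small: "mean_on (ball y (5 * \<rho> y)) h \<le> a" if "y \<in> K" for y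
  proof -
    have "k y > 0" by (rule k0[OF that])
    then obtain j where j: "k y = Suc j" by (cases "k y") auto
    then have "\<not> P y j" unfolding k_def by (intro not_less_Least) (simp add: k_def[symmetric])
    then show ?thesis by (simp add: P_def \<rho>_def j)
  qed
  obtain C where C: "countable C" "C \<subseteq> K"
    and disj: "pairwise (\<lambda>i j. disjnt (ball i (\<rho> i)) (ball j (\<rho> j))) C"
    and cov: "K \<subseteq> (\<Union>i\<in>C. ball i (5 * \<rho> i))"
  proof (rule Vitali_covering_lemma_balls[where K = K and S = K and a = "\<lambda>i. i" and r = \<rho> and B = r])
    show "K \<subseteq> (\<Union>i\<in>K. ball i (\<rho> i))" using \<rho>0 by auto
  qed (use \<rho>0 in auto)
  define Y where "Y i = {y\<in>ball i (5 * \<rho> i). norm (f y - mean_on (ball i (5 * \<rho> i)) f) > real m * (JN_step TYPE('n) * N)}" for i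
  have Ys: "Y i \<in> sets lebesgue" for i
  proof -
    have "(\<lambda>y. norm (f y - mean_on (ball i (5 * \<rho> i)) f)) \<in> borel_measurable lebesgue"
      using fm by measurable
    then have "{y \<in> space lebesgue. real m * (JN_step TYPE('n) * N) < norm (f y - mean_on (ball i (5 * \<rho> i)) f)} \<in> sets lebesgue"
      by (rule borel_measurable_less[OF borel_measurable_const])
    then have "ball i (5 * \<rho> i) \<inter> {y \<in> space lebesgue. real m * (JN_step TYPE('n) * N) < norm (f y - mean_on (ball i (5 * \<rho> i)) f)} \<in> sets lebesgue"
      by (intro sets.Int) auto
    also have "ball i (5 * \<rho> i) \<inter> {y \<in> space lebesgue. real m * (JN_step TYPE('n) * N) < norm (f y - mean_on (ball i (5 * \<rho> i)) f)} = Y i"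
      by (auto simp: Y_def)
    finally show ?thesis .
  qed
  have Ym: "emeasure lebesgue (Y i) \<le> ennreal ((1/2) ^ m * 5 ^ ?n) * emeasure lebesgue (ball i (\<rho> i))" for i
  proof -
    have "emeasure lebesgue (Y i) \<le> ennreal ((1/2) ^ m * measure lebesgue (ball i (5 * \<rho> i)))"
      unfolding Y_def using \<rho>0 by (intro Suc.IH) auto
    also have "measure lebesgue (ball i (5 * \<rho> i)) = 5 ^ ?n * measure lebesgue (ball i (\<rho> i))"
      by (rule measure_ball_scale) (use \<rho>0[of i] in auto)
    also have "ennreal ((1/2) ^ m * (5 ^ ?n * measure lebesgue (ball i (\<rho> i)))) =
       ennreal ((1/2) ^ m * 5 ^ ?n) * ennreal (measure lebesgue (ball i (\<rho> i)))"
      by (subst ennreal_mult[symmetric]) (auto simp: mult.assoc)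
    also have "ennreal (measure lebesgue (ball i (\<rho> i))) = emeasure lebesgue (ball i (\<rho> i))"
      by (rule emeasure_ball_eq_measure[symmetric])
    finally show ?thesis .
  qed
  have UY: "emeasure lebesgue (\<Union>i\<in>C. Y i) \<le> ennreal (((1/2) ^ m * 5 ^ ?n) * (LINT y:ball x (2 * r)|lebesgue. h y) / a)"
  proof (rule emeasure_countable_cover_le[OF C(1), where X = "\<lambda>i. ball i (\<rho> i)"])
    show "ball i (\<rho> i) \<inter> ball j (\<rho> j) = {}" if "i \<in> C" "j \<in> C" "i \<noteq> j" for i j
      using pairwiseD[OF disj that] by (simp add: disjnt_def)
    show "ball i (\<rho> i) \<subseteq> ball x (2 * r)" if "i \<in> C" for i
    proof
      fix z assume "z \<in> ball i (\<rho> i)"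
      moreover have "i \<in> B" using that C(2) by (auto simp: K_def)
      ultimately show "z \<in> ball x (2 * r)"
        using dist_triangle[of x z i] \<rho>0[of i] by (simp add: B_def)
    qed
    show "emeasure lebesgue (ball i (\<rho> i)) \<le> ennreal ((LINT x:ball i (\<rho> i)|lebesgue. h x) / a)" if "i \<in> C" for i
    proof -
      have "i \<in> K" using that C(2) by auto
      have "measure lebesgue (ball i (\<rho> i)) * a \<le> measure lebesgue (ball i (\<rho> i)) * mean_on (ball i (\<rho> i)) h"
        using big[OF \<open>i \<in> K\<close>] by (intro mult_left_mono) auto
      also have "\<dots> = (LINT x:ball i (\<rho> i)|lebesgue. h x)"
        using set_integral_ball_eq_mean[OF \<rho>0(1), of i i h] by simp
      finally have "measure lebesgue (ball i (\<rho> i)) \<le> (LINT x:ball i (\<rho> i)|lebesgue. h x) / a"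
        using a0 by (simp add: field_simps)
      moreover have "emeasure lebesgue (ball i (\<rho> i)) = ennreal (measure lebesgue (ball i (\<rho> i)))"
    by (rule emeasure_ball_eq_measure)
      ultimately show ?thesis by (simp add: ennreal_leI)
    qed
  qed (use Ys Ym hi h0 a0 in auto)
  also have "((1/2) ^ m * 5 ^ ?n) * (LINT y:ball x (2 * r)|lebesgue. h y) / a \<le> (1/2) ^ Suc m * measure lebesgue B"
  proof -
    have "((1/2) ^ m * 5 ^ ?n) * (LINT y:ball x (2 * r)|lebesgue. h y) / a
        \<le> ((1/2) ^ m * 5 ^ ?n) * (c1 * N * measure lebesgue B) / a"
      using a0 int2 by (intro divide_right_mono mult_left_mono) auto
    also have "\<dots> = (1/2) ^ Suc m * measure lebesgue B"
      using c10 N by (simp add: a_def field_simps)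
    finally show ?thesis .
  qed
  finally have UY': "emeasure lebesgue (\<Union>i\<in>C. Y i) \<le> ennreal ((1/2) ^ Suc m * measure lebesgue B)"
    by (simp add: ennreal_leI)
  have ae: "AE y in lebesgue. (y \<in> B \<and> h y > real (Suc m) * (JN_step TYPE('n) * N)) \<longrightarrow> y \<in> (\<Union>i\<in>C. Y i)"
    using AE_le_if_ball_means_le[OF hl h0]
  proof eventually_elim
    case (elim y)
    show ?case
    proof
      assume y: "y \<in> B \<and> h y > real (Suc m) * (JN_step TYPE('n) * N)"
      have "y \<in> K"
      proof (rule ccontr)
        assume "y \<notin> K"
        then have "\<forall>k. mean_on (ball y (r / 5 ^ k)) h \<le> a" using y by (auto simp: K_def P_def not_less)
        then have "h y \<le> q * a" using elim \<open>r > 0\<close> unfolding q_def by blast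
        also have "\<dots> \<le> 1 * ((1 + q) * a)" using a0 by (simp add: algebra_simps)
        also have "\<dots> \<le> real (Suc m) * ((1 + q) * a)" using a0 q0 by (intro mult_right_mono) auto
        finally show False using y stp by simp
      qed
      then obtain i where i: "i \<in> C" "y \<in> ball i (5 * \<rho> i)" using cov by auto
      let ?c = "mean_on (ball i (5 * \<rho> i)) f"
      have "norm (?c - c) \<le> mean_on (ball i (5 * \<rho> i)) h"
        unfolding h_def using \<rho>0[of i] by (intro norm_mean_on_diff_const_le locally_integrable_ball f) auto
      also have "\<dots> \<le> a" using small i C(2) by auto
      also have "\<dots> \<le> (1 + q) * a" using a0 q0 by simp
      finally have "norm (?c - c) \<le> JN_step TYPE('n) * N" by (simp add: stp)
      moreover have "h y \<le> norm (f y - ?c) + norm (?c - c)"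
        unfolding h_def using norm_triangle_ineq[of "f y - ?c" "?c - c"] by simp
      ultimately have "norm (f y - ?c) > real m * (JN_step TYPE('n) * N)"
        using y by (simp add: algebra_simps)
      then show "y \<in> (\<Union>i\<in>C. Y i)" using i by (auto simp: Y_def)
    qed
  qed
  have "emeasure lebesgue {y\<in>B. h y > real (Suc m) * (JN_step TYPE('n) * N)} \<le> emeasure lebesgue (\<Union>i\<in>C. Y i)"
    using ae C(1) Ys by (intro emeasure_mono_AE sets.countable_UN'') auto
  also note UY'
  finally show ?case by (simp only: B_def h_def c_def)
qed

lemma summable_square_half: "summable (\<lambda>m. (real m + 1)\<^sup>2 * (1/2) ^ m)"
proof (rule summable_ratio_test[of "3/4" 4])
  fix m :: nat assume m: "m \<ge> 4"
  have "(real m + 2)\<^sup>2 * 2 \<le> 3 * (real m + 1)\<^sup>2"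
  proof -
    have "0 \<le> (real m - 4) * (real m + 2) + 3"
      using m by (intro add_nonneg_nonneg mult_nonneg_nonneg) auto
    then show ?thesis by (simp add: power2_eq_square algebra_simps)
  qed
  then have "(real m + 2)\<^sup>2 * 2 * (1/2) ^ m \<le> 3 * (real m + 1)\<^sup>2 * (1/2) ^ m"
    by (intro mult_right_mono) auto
  then show "norm ((real (Suc m) + 1)\<^sup>2 * (1/2) ^ Suc m) \<le> 3/4 * norm ((real m + 1)\<^sup>2 * (1/2) ^ m)"
    by (simp add: abs_mult add.commute)
qed simp

text \<open>
  Summing the squares of the levels against the geometric decay of the distribution function.
\<close>

definition JN_const :: "'n::finite itself \<Rightarrow> real" where
  "JN_const t = (JN_step t)\<^sup>2 * (\<Sum>m. (real m + 1)\<^sup>2 * (1/2) ^ m)"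

lemma JN_step_pos: "JN_step t > 0"
  unfolding JN_step_def by (intro mult_pos_pos add_pos_nonneg) auto

lemma JN_const_nonneg: "JN_const t \<ge> 0"
  unfolding JN_const_def by (intro mult_nonneg_nonneg suminf_nonneg summable_square_half) auto

text \<open>
  The distribution estimate summed over levels: on \<open>m b < h \<le> (m + 1) b\<close> the square is at most
  \<open>((m + 1) b)\<^sup>2\<close>, and this set has measure at most \<open>2 ^ -m * \<bar>B\<bar>\<close>. Square integrability is what permits
  applying an operator that is only given on \<open>L\<^sup>2\<close>.
\<close>

theorem John_Nirenberg_square:
  fixes f :: "real^'n \<Rightarrow> 'k::{banach, second_countable_topology}"
  assumes f: "locally_integrable f" and N: "N > 0"
    and osc: "\<And>x r. r > 0 \<Longrightarrow> mean_on (ball x r) (\<lambda>y. norm (f y - mean_on (ball x r) f)) \<le> N"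
    and r: "r > 0"
  shows "set_integrable lebesgue (ball x r) (\<lambda>y. (norm (f y - mean_on (ball x r) f))\<^sup>2)"
    and "mean_on (ball x r) (\<lambda>y. (norm (f y - mean_on (ball x r) f))\<^sup>2) \<le> JN_const TYPE('n) * N\<^sup>2"
proof -
  let ?B = "ball x r"
  define h where "h y = norm (f y - mean_on ?B f)" for y
  define b where "b = JN_step TYPE('n) * N"
  define V where "V = measure lebesgue ?B"
  have b: "b > 0" using N JN_step_pos[of "TYPE('n)"] by (simp add: b_def)
  have V: "V > 0" unfolding V_def by (rule measure_ball_pos[OF r])
  have fm: "f \<in> borel_measurable lebesgue" by (rule locally_integrable_measurable[OF f])
  have hm[measurable]: "h \<in> borel_measurable lebesgue" unfolding h_def using fm by measurable
  define E where "E m = {y\<in>?B. h y > real m * b}" for m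
  have Es: "E m \<in> sets lebesgue" for m
  proof -
    have "{y \<in> space lebesgue. real m * b < h y} \<in> sets lebesgue"
      by (rule borel_measurable_less[OF borel_measurable_const hm])
    then have "?B \<inter> {y \<in> space lebesgue. real m * b < h y} \<in> sets lebesgue"
      by (intro sets.Int) auto
    also have "?B \<inter> {y \<in> space lebesgue. real m * b < h y} = E m" by (auto simp: E_def)
    finally show ?thesis .
  qed
  have Em: "emeasure lebesgue (E m) \<le> ennreal ((1/2) ^ m * V)" for m
    unfolding E_def h_def b_def V_def by (rule John_Nirenberg_distribution[OF f N osc r])
  let ?g = "\<lambda>y. indicator ?B y *\<^sub>R (h y)\<^sup>2"
  have pt: "ennreal (?g y) \<le> (\<Sum>m. ennreal (((real m + 1) * b)\<^sup>2) * indicator (E m) y)" for y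
  proof (cases "y \<in> ?B \<and> h y > 0")
    case True
    define m where "m = nat (\<lceil>h y / b\<rceil> - 1)"
    have "h y / b > 0" using True b by simp
    then have "real m < h y / b" "h y / b \<le> real m + 1"
      unfolding m_def by linarith+
    then have m: "real m * b < h y" "h y \<le> (real m + 1) * b"
      using b by (auto simp: field_simps)
    have "ennreal (?g y) \<le> ennreal (((real m + 1) * b)\<^sup>2) * indicator (E m) y"
      using m True by (auto simp: E_def h_def intro!: ennreal_leI power_mono)
    also have "\<dots> \<le> (\<Sum>m. ennreal (((real m + 1) * b)\<^sup>2) * indicator (E m) y)"
      using sum_le_suminf[OF summableI, of "{m}" "\<lambda>m. ennreal (((real m + 1) * b)\<^sup>2) * indicator (E m) y"]
      by (simp del: sum_mult_indicator)
    finally show ?thesis .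
  next
    case False
    moreover have "h y \<ge> 0" by (simp add: h_def)
    ultimately show ?thesis by (auto simp: indicator_def)
  qed
  have nn: "(\<integral>\<^sup>+y. ennreal (?g y) \<partial>lebesgue) \<le> ennreal (JN_const TYPE('n) * N\<^sup>2 * V)"
  proof -
    have "(\<integral>\<^sup>+y. ennreal (?g y) \<partial>lebesgue) \<le> (\<integral>\<^sup>+y. (\<Sum>m. ennreal (((real m + 1) * b)\<^sup>2) * indicator (E m) y) \<partial>lebesgue)"
      by (intro nn_integral_mono pt)
    also have "\<dots> = (\<Sum>m. \<integral>\<^sup>+y. ennreal (((real m + 1) * b)\<^sup>2) * indicator (E m) y \<partial>lebesgue)"
      using Es by (intro nn_integral_suminf borel_measurable_times_ennreal borel_measurable_indicator) auto
    also have "\<dots> = (\<Sum>m. ennreal (((real m + 1) * b)\<^sup>2) * emeasure lebesgue (E m))"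
      using Es by (subst nn_integral_cmult_indicator) auto
    also have "\<dots> \<le> (\<Sum>m. ennreal (b\<^sup>2 * V * ((real m + 1)\<^sup>2 * (1/2) ^ m)))"
    proof (intro suminf_le summableI)
      fix m
      have "ennreal (((real m + 1) * b)\<^sup>2) * emeasure lebesgue (E m)
          \<le> ennreal (((real m + 1) * b)\<^sup>2) * ennreal ((1/2) ^ m * V)"
        by (intro mult_left_mono Em) simp
      also have "\<dots> = ennreal (((real m + 1) * b)\<^sup>2 * ((1/2) ^ m * V))"
        using V by (intro ennreal_mult[symmetric]) auto
      also have "((real m + 1) * b)\<^sup>2 * ((1/2) ^ m * V) = b\<^sup>2 * V * ((real m + 1)\<^sup>2 * (1/2) ^ m)"
        by (simp add: power_mult_distrib)
      finally show "ennreal (((real m + 1) * b)\<^sup>2) * emeasure lebesgue (E m)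
          \<le> ennreal (b\<^sup>2 * V * ((real m + 1)\<^sup>2 * (1/2) ^ m))" .
    qed
    also have "\<dots> = ennreal (\<Sum>m. b\<^sup>2 * V * ((real m + 1)\<^sup>2 * (1/2) ^ m))"
      using V summable_mult[OF summable_square_half, of "b\<^sup>2 * V"]
      by (intro suminf_ennreal2) auto
    also have "(\<Sum>m. b\<^sup>2 * V * ((real m + 1)\<^sup>2 * (1/2) ^ m)) = JN_const TYPE('n) * N\<^sup>2 * V"
      by (subst suminf_mult[OF summable_square_half])
         (simp add: JN_const_def b_def power_mult_distrib mult_ac)
    finally show ?thesis .
  qed
  have gm: "?g \<in> borel_measurable lebesgue"
    by (intro borel_measurable_scaleR borel_measurable_power hm borel_measurable_indicator) auto
  have gi: "integrable lebesgue ?g"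
  proof (rule integrableI_nonneg[OF gm])
    show "(\<integral>\<^sup>+y. ennreal (?g y) \<partial>lebesgue) < \<infinity>"
      using nn by (rule order_le_less_trans) simp
  qed auto
  then show "set_integrable lebesgue ?B (\<lambda>y. (norm (f y - mean_on ?B f))\<^sup>2)"
    by (simp add: set_integrable_def h_def)
  have "(\<integral>\<^sup>+y. ennreal (?g y) \<partial>lebesgue) = ennreal (\<integral>y. ?g y \<partial>lebesgue)"
    by (rule nn_integral_eq_integral[OF gi]) simp
  with nn have "(\<integral>y. ?g y \<partial>lebesgue) \<le> JN_const TYPE('n) * N\<^sup>2 * V"
    using V JN_const_nonneg[of "TYPE('n)"] by (simp add: ennreal_le_iff)
  then show "mean_on ?B (\<lambda>y. (norm (f y - mean_on ?B f))\<^sup>2) \<le> JN_const TYPE('n) * N\<^sup>2"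
    using V by (simp add: mean_on_def set_lebesgue_integral_def h_def V_def[symmetric] field_simps)
qed

section \<open>Integrals over the complement of a ball\<close>

text \<open>
  Decompose the complement of the ball into dyadic shells. On the \<open>k\<close>-th shell the weight
  is at most \<open>(2 ^ k * \<rho>) ^ -(n + 1)\<close>, while the integral of \<open>h\<close> is at most \<open>\<alpha> (k + 1)\<close> times the volume of the
  next ball; the extra power of the weight leaves a factor \<open>2 ^ -k\<close>.
\<close>

lemma tail_integral:
  fixes h :: "real^'n \<Rightarrow> real" and \<alpha> :: "nat \<Rightarrow> real"
  assumes h: "locally_integrable h" and nonneg: "\<And>y. 0 \<le> h y" and \<rho>: "\<rho> > 0"
    and mean: "\<And>k. mean_on (ball x (2 ^ k * \<rho>)) h \<le> \<alpha> k"
    and sm: "summable (\<lambda>k. \<alpha> (Suc k) / 2 ^ k)"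
  shows "set_integrable lebesgue (- ball x \<rho>) (\<lambda>y. h y / norm (y - x) ^ (CARD('n) + 1))"
    and "(LINT y:- ball x \<rho>|lebesgue. h y / norm (y - x) ^ (CARD('n) + 1))
      \<le> 2 ^ CARD('n) * unit_ball_vol (real CARD('n)) / \<rho> * (\<Sum>k. \<alpha> (Suc k) / 2 ^ k)"
proof -
  let ?n = "CARD('n)" and ?v = "unit_ball_vol (real CARD('n))"
  have hm: "h \<in> borel_measurable lebesgue" by (rule locally_integrable_measurable[OF h])
  define B where "B k = ball x (2 ^ k * \<rho>)" for k :: nat
  define w where "w k = 1 / (2 ^ k * \<rho>) ^ (?n + 1)" for k :: nat
  have w: "w k \<ge> 0" for k using \<rho> by (simp add: w_def)
  have \<alpha>: "\<alpha> k \<ge> 0" for k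
    using mean[of k] mean_on_nonneg[of "ball x (2 ^ k * \<rho>)" h] nonneg by (meson order_trans)
  let ?g = "\<lambda>y. indicator (- ball x \<rho>) y *\<^sub>R (h y / norm (y - x) ^ (?n + 1))"
  have g0: "?g y \<ge> 0" for y using nonneg by (simp add: indicator_def)
  have nm: "(\<lambda>y. norm (y - x) ^ (?n + 1)) \<in> borel_measurable lebesgue"
    by (intro measurable_completion) simp
  have gm: "?g \<in> borel_measurable lebesgue"
    by (intro borel_measurable_scaleR borel_measurable_divide hm nm borel_measurable_indicator) auto
  have pt: "ennreal (?g y) \<le> (\<Sum>k. ennreal (w k) * ennreal (indicator (B (Suc k)) y *\<^sub>R h y))" for y
  proof (cases "y \<in> ball x \<rho>")
    case False
    then have yx: "norm (y - x) \<ge> \<rho>" by (simp add: dist_norm norm_minus_commute)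
    obtain j :: nat where "norm (y - x) / \<rho> < 2 ^ j"
      using real_arch_pow[of 2 "norm (y - x) / \<rho>"] by auto
    then have ex: "norm (y - x) < 2 ^ j * \<rho>" using \<rho> by (simp add: field_simps)
    define k where "k = (LEAST j. norm (y - x) < 2 ^ j * \<rho>)"
    have k1: "norm (y - x) < 2 ^ k * \<rho>" unfolding k_def by (rule LeastI[of _ j]) (rule ex)
    have "k \<noteq> 0" using k1 yx by (intro notI) simp
    then obtain m where m: "k = Suc m" by (cases k) auto
    have "\<not> norm (y - x) < 2 ^ m * \<rho>" using not_less_Least[of m "\<lambda>j. norm (y - x) < 2 ^ j * \<rho>"] m
      by (simp add: k_def[symmetric])
    then have low: "2 ^ m * \<rho> \<le> norm (y - x)" by simp
    have "h y / norm (y - x) ^ (?n + 1) \<le> h y * w m"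
      unfolding w_def using low nonneg[of y] \<rho>
      by (auto intro!: frac_le power_mono mult_pos_pos zero_less_power simp del: power_Suc power_mult_distrib)
    then have "ennreal (?g y) \<le> ennreal (w m) * ennreal (indicator (B (Suc m)) y *\<^sub>R h y)"
      using False k1 m w[of m] nonneg[of y]
      by (simp add: B_def dist_norm norm_minus_commute mult.commute ennreal_leI flip: ennreal_mult)
    also have "\<dots> \<le> (\<Sum>k. ennreal (w k) * ennreal (indicator (B (Suc k)) y *\<^sub>R h y))"
      using sum_le_suminf[OF summableI, of "{m}" "\<lambda>k. ennreal (w k) * ennreal (indicator (B (Suc k)) y *\<^sub>R h y)"]
      by simp
    finally show ?thesis .
  qed simp
  have s0: "0 \<le> (\<Sum>k. \<alpha> (Suc k) / 2 ^ k)" using \<alpha> by (intro suminf_nonneg sm) auto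
  let ?R = "2 ^ ?n * ?v / \<rho> * (\<Sum>k. \<alpha> (Suc k) / 2 ^ k)"
  have R0: "?R \<ge> 0" using s0 \<rho> by (intro mult_nonneg_nonneg divide_nonneg_nonneg) auto
  have nn: "(\<integral>\<^sup>+y. ennreal (?g y) \<partial>lebesgue) \<le> ennreal ?R"
  proof -
    have Bi: "set_integrable lebesgue (B k) h" for k unfolding B_def by (rule locally_integrable_ball[OF h])
    have "(\<integral>\<^sup>+y. ennreal (?g y) \<partial>lebesgue) \<le>
       (\<integral>\<^sup>+y. (\<Sum>k. ennreal (w k) * ennreal (indicator (B (Suc k)) y *\<^sub>R h y)) \<partial>lebesgue)"
      by (intro nn_integral_mono pt)
    also have "\<dots> = (\<Sum>k. \<integral>\<^sup>+y. ennreal (w k) * ennreal (indicator (B (Suc k)) y *\<^sub>R h y) \<partial>lebesgue)"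
      using Bi by (intro nn_integral_suminf borel_measurable_times_ennreal)
        (auto simp: set_integrable_def intro!: measurable_compose[OF borel_measurable_integrable measurable_ennreal])
    also have "\<dots> = (\<Sum>k. ennreal (w k) * ennreal (LINT y:B (Suc k)|lebesgue. h y))"
    proof (rule suminf_cong)
      fix k
      have "(\<integral>\<^sup>+y. ennreal (w k) * ennreal (indicator (B (Suc k)) y *\<^sub>R h y) \<partial>lebesgue)
        = ennreal (w k) * (\<integral>\<^sup>+y. ennreal (indicator (B (Suc k)) y *\<^sub>R h y) \<partial>lebesgue)"
        using Bi by (intro nn_integral_cmult)
         (auto simp: set_integrable_def intro!: measurable_compose[OF borel_measurable_integrable measurable_ennreal])
      also have "(\<integral>\<^sup>+y. ennreal (indicator (B (Suc k)) y *\<^sub>R h y) \<partial>lebesgue) = ennreal (LINT y:B (Suc k)|lebesgue. h y)"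
        unfolding set_lebesgue_integral_def using Bi nonneg
        by (intro nn_integral_eq_integral) (auto simp: set_integrable_def)
      finally show "(\<integral>\<^sup>+y. ennreal (w k) * ennreal (indicator (B (Suc k)) y *\<^sub>R h y) \<partial>lebesgue)
        = ennreal (w k) * ennreal (LINT y:B (Suc k)|lebesgue. h y)" .
    qed
    also have "\<dots> \<le> (\<Sum>k. ennreal (2 ^ ?n * ?v / \<rho> * (\<alpha> (Suc k) / 2 ^ k)))"
    proof (intro suminf_le summableI)
      fix k
      have p: "2 ^ Suc k * \<rho> > 0" using \<rho> by simp
      have "(LINT y:B (Suc k)|lebesgue. h y) = measure lebesgue (B (Suc k)) * mean_on (B (Suc k)) h"
        using set_integral_ball_eq_mean[OF p, of x h] by (simp add: B_def)
      also have "\<dots> \<le> measure lebesgue (B (Suc k)) * \<alpha> (Suc k)"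
        unfolding B_def by (intro mult_left_mono mean) simp
      also have "measure lebesgue (B (Suc k)) = ?v * (2 ^ Suc k * \<rho>) ^ ?n"
        unfolding B_def by (rule measure_ball_eq) (use p in simp)
      finally have "w k * (LINT y:B (Suc k)|lebesgue. h y) \<le> w k * (?v * (2 ^ Suc k * \<rho>) ^ ?n * \<alpha> (Suc k))"
        using w by (intro mult_left_mono) auto
      also have "\<dots> = 2 ^ ?n * ?v / \<rho> * (\<alpha> (Suc k) / 2 ^ k)"
      proof -
        have "(2 ^ Suc k * \<rho>) ^ ?n = 2 ^ ?n * (2 ^ k * \<rho>) ^ ?n"
          by (simp add: power_mult_distrib)
        then show ?thesis using \<rho> by (simp add: w_def mult_ac)
      qed
      finally have "ennreal (w k * (LINT y:B (Suc k)|lebesgue. h y)) \<le> ennreal (2 ^ ?n * ?v / \<rho> * (\<alpha> (Suc k) / 2 ^ k))"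
        by (rule ennreal_leI)
      then show "ennreal (w k) * ennreal (LINT y:B (Suc k)|lebesgue. h y) \<le> ennreal (2 ^ ?n * ?v / \<rho> * (\<alpha> (Suc k) / 2 ^ k))"
        using w by (simp add: ennreal_mult')
    qed
    also have "\<dots> = ennreal (\<Sum>k. 2 ^ ?n * ?v / \<rho> * (\<alpha> (Suc k) / 2 ^ k))"
      using \<alpha> \<rho> summable_mult[OF sm, of "2 ^ ?n * ?v / \<rho>"]
      by (intro suminf_ennreal2) (auto intro!: mult_nonneg_nonneg divide_nonneg_nonneg)
    also have "(\<Sum>k. 2 ^ ?n * ?v / \<rho> * (\<alpha> (Suc k) / 2 ^ k)) = ?R"
      by (rule suminf_mult[OF sm])
    finally show ?thesis .
  qed
  have gi: "integrable lebesgue ?g"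
  proof (rule integrableI_nonneg[OF gm])
    show "(\<integral>\<^sup>+y. ennreal (?g y) \<partial>lebesgue) < \<infinity>"
      using nn by (rule order_le_less_trans) simp
  qed (use g0 in auto)
  then show "set_integrable lebesgue (- ball x \<rho>) (\<lambda>y. h y / norm (y - x) ^ (?n + 1))"
    by (simp only: set_integrable_def)
  have "(\<integral>\<^sup>+y. ennreal (?g y) \<partial>lebesgue) = ennreal (\<integral>y. ?g y \<partial>lebesgue)"
    by (rule nn_integral_eq_integral[OF gi]) (use g0 in auto)
  with nn R0 show "(LINT y:- ball x \<rho>|lebesgue. h y / norm (y - x) ^ (?n + 1)) \<le> ?R"
    by (simp only: set_lebesgue_integral_def ennreal_le_iff)
qed

section \<open>The critical radius\<close>

lemma critical_radius_pos: "critical_radius x > 0"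
  by (auto simp: critical_radius_def intro!: divide_pos_pos add_pos_nonneg)

lemma critical_radius_le_half: "critical_radius x \<le> 1/2"
  by (auto simp: critical_radius_def field_simps)

lemma critical_radius_lower: "1/2 \<le> critical_radius x * (1 + norm x)"
proof (cases "norm x \<ge> 1")
  case True
  then have "critical_radius x * (1 + norm x) = 1" by (simp add: critical_radius_def)
  then show ?thesis by simp
qed (simp add: critical_radius_def)

lemma critical_radius_upper: "critical_radius x * (1 + norm x) \<le> 1"
  by (auto simp: critical_radius_def field_simps)

text \<open>
  The critical radius varies slowly: a ball that reaches the critical ball of \<open>p\<close> and has at least
  the critical radius of its own centre is not much smaller than that of \<open>p\<close>.
\<close>

lemma critical_radius_le_near:
  fixes p z :: "real^'n"
  assumes r: "r \<ge> critical_radius z" and near: "dist p z < r + critical_radius p"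
  shows "critical_radius p \<le> 8 * r"
proof (cases "r \<ge> 1/2")
  case True
  then show ?thesis using critical_radius_le_half[of p] by simp
next
  case False
  have r0: "r > 0" using r critical_radius_pos[of z] by linarith
  have "norm z \<le> norm p + dist p z"
    using norm_triangle_ineq[of p "z - p"] by (simp add: dist_norm norm_minus_commute)
  also have "dist p z \<le> r + 1/2" using near critical_radius_le_half[of p] by simp
  finally have "norm z \<le> norm p + (r + 1/2)" by simp
  moreover have "0 \<le> norm p" by (rule norm_ge_zero)
  ultimately have z: "1 + norm z \<le> 2 * (1 + norm p) + r" unfolding distrib_left by linarith
  have "1/2 \<le> critical_radius z * (1 + norm z)" by (rule critical_radius_lower)
  also have "\<dots> \<le> r * (2 * (1 + norm p) + r)" using r r0 z by (intro mult_mono) auto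
  finally have "1/2 \<le> 2 * (r * (1 + norm p)) + r * r" by (simp add: algebra_simps)
  moreover have "r * r \<le> 1/2 * (1/2)" using False r0 by (intro mult_mono) auto
  ultimately have "1 \<le> 8 * r * (1 + norm p)" by simp
  then have "critical_radius p * (1 + norm p) \<le> 8 * r * (1 + norm p)"
    using critical_radius_upper[of p] by linarith
  then show ?thesis by (rule mult_right_le_imp_le) (simp add: add_pos_nonneg)
qed

text \<open>
  At distances beyond a radius that is at least critical, the exponent of the kernel bound grows
  at least linearly in \<open>t / r\<close>. Indeed \<open>r\<close> being at least critical means, up to constants, \<open>r * (1 + \<bar>x\<bar>) \<ge> 1\<close>;
  either \<open>r\<close> itself is bounded below, or \<open>r * \<bar>x\<bar>\<close> is.
\<close>

lemma hermite_exponent_lower: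
  fixes x x0 :: "real^'n"
  assumes r: "r \<ge> critical_radius x0" and x: "x \<in> ball x0 r" and t: "t \<ge> r"
  shows "t / (16 * r) \<le> norm x * t + t\<^sup>2"
proof -
  have r0: "r > 0" using r critical_radius_pos[of x0] by linarith
  have n: "norm x0 \<le> norm x + r"
    using x norm_triangle_ineq[of x "x0 - x"] by (simp add: dist_norm)
  have "1/2 \<le> critical_radius x0 * (1 + norm x0)" by (rule critical_radius_lower)
  also have "\<dots> \<le> r * (1 + (norm x + r))"
    using r r0 n by (intro mult_mono) auto
  finally have h: "1/2 \<le> r + (norm x * r + r\<^sup>2)" by (simp add: algebra_simps power2_eq_square)
  have key: "1/16 \<le> norm x * r + r\<^sup>2"
  proof (cases "r \<ge> 1/4")
    case True
    then have "(1/4)\<^sup>2 \<le> r\<^sup>2" by (intro power_mono) auto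
    then have "1/16 \<le> r\<^sup>2" by (simp add: power2_eq_square)
    then show ?thesis using r0 by (simp add: add_increasing)
  next
    case False
    then show ?thesis using h by simp
  qed
  have "t / (16 * r) = t / r * (1/16)" by simp
  also have "\<dots> \<le> t / r * (norm x * r + r\<^sup>2)"
    using t r0 by (intro mult_left_mono key) auto
  also have "\<dots> = norm x * t + t * r" using r0 by (simp add: field_simps power2_eq_square)
  also have "\<dots> \<le> norm x * t + t\<^sup>2" using t r0 by (simp add: power2_eq_square mult_left_mono)
  finally show ?thesis .
qed

section \<open>Kernel integrals over the complement of a ball\<close>

text \<open>
  The hypotheses on \<open>T\<close> and \<open>K\<close> with the constants made explicit.
\<close>

locale hermite_operator =
  fixes T :: "(real^'n \<Rightarrow> 'k::{real_normed_field, euclidean_space}) \<Rightarrow> real^'n \<Rightarrow> 'k"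
    and K :: "real^'n \<Rightarrow> real^'n \<Rightarrow> 'k" and C c M :: real
  assumes C: "C > 0" and c: "c > 0" and M: "M \<ge> 0"
    and kernel_size: "x \<noteq> y \<Longrightarrow>
      norm (K x y) \<le> C / norm (x - y) ^ CARD('n) * exp (- c * (norm x * norm (x - y) + (norm (x - y))\<^sup>2))"
    and kernel_smooth: "norm (x - y) > 2 * norm (y - z) \<Longrightarrow>
      norm (K x y - K x z) + norm (K y x - K z x) \<le> C * (norm (y - z) / norm (x - y) ^ (CARD('n) + 1))"
    and T_L2: "f \<in> L2 \<Longrightarrow> T f \<in> L2"
    and T_add: "f \<in> L2 \<Longrightarrow> g \<in> L2 \<Longrightarrow> AE x in lebesgue. T (\<lambda>y. f y + g y) x = T f x + T g x"
    and T_scale: "f \<in> L2 \<Longrightarrow> AE x in lebesgue. T (\<lambda>y. a * f y) x = a * T f x"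
    and T_bound: "f \<in> L2 \<Longrightarrow> L2norm (T f) \<le> M * L2norm f"
    and T_kernel: "f \<in> L2c \<Longrightarrow> AE x in lebesgue. x \<notin> ess_support f \<longrightarrow> T f x = (LINT y|lebesgue. K x y * f y)"
begin

text \<open>
  A lower bound on the exponent converts exponential decay into one more power of the distance, since
  \<open>exp (-u) \<le> 1 / u\<close>. This single form of decay serves both for absolute convergence and for the
  uniform bounds.
\<close>

lemma kernel_decay:
  assumes "x \<noteq> y" "\<tau> > 0" "norm (x - y) / \<tau> \<le> c * (norm x * norm (x - y) + (norm (x - y))\<^sup>2)"
  shows "norm (K x y) \<le> C * \<tau> / norm (x - y) ^ (CARD('n) + 1)"
proof -
  let ?t = "norm (x - y)" and ?u = "c * (norm x * norm (x - y) + (norm (x - y))\<^sup>2)"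
  have t: "?t > 0" using assms by simp
  then have u: "?u > 0" using assms(2,3) by (meson divide_pos_pos order_less_le_trans)
  have "exp (- v) \<le> 1 / v" if "v > 0" for v :: real
    using order_trans[OF _ exp_ge_add_one_self[of v], of v] that by (simp add: exp_minus field_simps)
  from this[OF u] have "exp (- ?u) \<le> 1 / ?u" .
  also have "\<dots> \<le> 1 / (?t / \<tau>)" 
    by (rule divide_left_mono[OF assms(3) zero_le_one mult_pos_pos[OF u divide_pos_pos[OF t assms(2)]]])
  finally have e: "exp (- ?u) \<le> \<tau> / ?t" by simp
  have "norm (K x y) \<le> C / ?t ^ CARD('n) * exp (- ?u)"
    using kernel_size[OF assms(1)] by simp
  also have "\<dots> \<le> C / ?t ^ CARD('n) * (\<tau> / ?t)"
    using C by (intro mult_left_mono e) auto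
  finally show ?thesis by (simp add: mult.commute)
qed

lemma isCont_kernel:
  assumes "x \<noteq> y"
  shows "isCont (K x) y"
proof -
  define d where "d = norm (x - y)"
  have d: "d > 0" using assms by (simp add: d_def)
  have "((\<lambda>z. K x z - K x y) \<longlongrightarrow> 0) (at y)"
  proof (rule Lim_null_comparison)
    show "\<forall>\<^sub>F z in at y. norm (K x z - K x y) \<le> C * (norm (y - z) / d ^ (CARD('n) + 1))"
      unfolding eventually_at
    proof (intro exI conjI ballI impI)
      show "d / 2 > 0" using d by simp
      fix z assume "z \<noteq> y \<and> dist z y < d / 2"
      then have "norm (x - y) > 2 * norm (y - z)" by (simp add: d_def dist_norm norm_minus_commute)
      from kernel_smooth[OF this]
      show "norm (K x z - K x y) \<le> C * (norm (y - z) / d ^ (CARD('n) + 1))"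
        unfolding d_def by (smt (verit) norm_ge_zero norm_minus_commute)
    qed
    have "((\<lambda>z. C * (norm (y - z) / d ^ (CARD('n) + 1))) \<longlongrightarrow> C * (norm (y - y) / d ^ (CARD('n) + 1))) (at y)"
      by (intro tendsto_intros) (use d in auto)
    then show "((\<lambda>z. C * (norm (y - z) / d ^ (CARD('n) + 1))) \<longlongrightarrow> 0) (at y)" by simp
  qed
  then show ?thesis unfolding isCont_def by (rule LIM_zero_cancel)
qed

lemma kernel_measurable: "K x \<in> borel_measurable lebesgue"
proof -
  have "continuous_on (- {x}) (K x)"
    by (rule continuous_at_imp_continuous_on) (use isCont_kernel in auto)
  then have "(\<lambda>y. indicator (- {x}) y *\<^sub>R K x y) \<in> borel_measurable borel"
    by (intro borel_measurable_continuous_on_indicator) auto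
  then have "(\<lambda>y. indicator (- {x}) y *\<^sub>R K x y + indicator {x} y *\<^sub>R K x x) \<in> borel_measurable borel"
    by (rule borel_measurable_add) (intro borel_measurable_scaleR borel_measurable_indicator, auto)
  also have "(\<lambda>y. indicator (- {x}) y *\<^sub>R K x y + indicator {x} y *\<^sub>R K x x) = K x"
    by (auto simp: indicator_def fun_eq_iff)
  finally have "K x \<in> borel_measurable lborel" by simp
  then show ?thesis by (rule measurable_completion)
qed

text \<open>
  Integrability of \<open>h\<close> at infinity against the weight \<open>\<bar>y - p\<bar> ^ -(n + 1)\<close>, which dominates both the kernel
  away from its singularity and the differences of the kernel.
\<close>

definition tail_integrable :: "real^'n \<Rightarrow> real \<Rightarrow> (real^'n \<Rightarrow> 'k) \<Rightarrow> bool" where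
  "tail_integrable p \<rho> h \<longleftrightarrow> h \<in> borel_measurable lebesgue \<and>
     set_integrable lebesgue (- ball p \<rho>) (\<lambda>y. norm (h y) / norm (y - p) ^ (CARD('n) + 1))"

definition tail_mass :: "real^'n \<Rightarrow> real \<Rightarrow> (real^'n \<Rightarrow> 'k) \<Rightarrow> real" where
  "tail_mass p \<rho> h = (LINT y:- ball p \<rho>|lebesgue. norm (h y) / norm (y - p) ^ (CARD('n) + 1))"

definition far_part :: "real^'n \<Rightarrow> real \<Rightarrow> (real^'n \<Rightarrow> 'k) \<Rightarrow> real^'n \<Rightarrow> 'k" where
  "far_part p \<rho> h x = (LINT y:- ball p \<rho>|lebesgue. K x y * h y)"

text \<open>
  For \<open>x\<close> in the open ball the distances to \<open>x\<close> and to the centre \<open>p\<close> are comparable outside the ball.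
\<close>

lemma tail_shift:
  assumes h: "tail_integrable p \<rho> h" and x: "x \<in> ball p \<rho>"
  shows "set_integrable lebesgue (- ball p \<rho>) (\<lambda>y. norm (h y) / norm (y - x) ^ (CARD('n) + 1))"
proof -
  let ?n = "CARD('n)"
  define \<delta> where "\<delta> = \<rho> - dist p x"
  have \<delta>: "\<delta> > 0" and \<rho>: "\<rho> > 0" using x dist_not_less_zero[of p x] by (auto simp: \<delta>_def simp del: dist_not_less_zero intro: order_le_less_trans[OF zero_le_dist])
  \<comment> \<open>outside the ball, the distance to p is at most 1 + \<rho> / \<delta> times the distance to x\<close>
  define q where "q = (1 + \<rho> / \<delta>) ^ (?n + 1)"
  have hm: "h \<in> borel_measurable lebesgue" using h by (simp add: tail_integrable_def)
  have "set_integrable lebesgue (- ball p \<rho>) (\<lambda>y. q * (norm (h y) / norm (y - p) ^ (?n + 1)))"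
    using h unfolding tail_integrable_def by (intro set_integrable_mult_right) auto
  then show ?thesis
  proof (rule set_integrable_bound)
    have nm: "(\<lambda>y. norm (y - x) ^ (?n + 1)) \<in> borel_measurable lebesgue"
      by (intro measurable_completion) simp
    show "set_borel_measurable lebesgue (- ball p \<rho>) (\<lambda>y. norm (h y) / norm (y - x) ^ (?n + 1))"
      unfolding set_borel_measurable_def
      using hm by (intro borel_measurable_scaleR borel_measurable_divide nm borel_measurable_indicator
          measurable_compose[OF hm borel_measurable_norm]) auto
    show "AE y in lebesgue. y \<in> - ball p \<rho> \<longrightarrow>
       norm (norm (h y) / norm (y - x) ^ (?n + 1)) \<le> norm (q * (norm (h y) / norm (y - p) ^ (?n + 1)))"
    proof (intro AE_I2 impI)
      fix y assume y: "y \<in> - ball p \<rho>"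
      have yx: "norm (y - x) \<ge> \<delta>"
        using y dist_triangle[of p y x] by (auto simp: \<delta>_def dist_norm norm_minus_commute)
      have yp: "norm (y - p) \<ge> \<rho>" using y by (auto simp: dist_norm norm_minus_commute)
      have "norm (y - p) \<le> norm (y - x) + norm (x - p)"
        using norm_triangle_ineq[of "y - x" "x - p"] by simp
      also have "norm (x - p) \<le> \<rho>" using x by (auto simp: dist_norm norm_minus_commute)
      also have "\<rho> \<le> \<rho> / \<delta> * norm (y - x)"
        using mult_left_mono[OF yx, of "\<rho> / \<delta>"] \<delta> \<rho> by simp
      finally have "norm (y - p) \<le> (1 + \<rho> / \<delta>) * norm (y - x)" by (simp add: algebra_simps)
      then have le: "norm (y - p) ^ (?n + 1) \<le> q * norm (y - x) ^ (?n + 1)"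
        unfolding q_def power_mult_distrib[symmetric] by (intro power_mono) auto
      have pos: "norm (y - x) ^ (?n + 1) > 0" "norm (y - p) ^ (?n + 1) > 0"
        using yx yp \<delta> \<rho> by (intro zero_less_power; linarith)+
      have "1 / norm (y - x) ^ (?n + 1) \<le> q / norm (y - p) ^ (?n + 1)"
        using le pos by (simp only: divide_le_eq le_divide_eq pos mult_1 times_divide_eq_left if_True)
      from mult_left_mono[OF this norm_ge_zero[of "h y"]]
      have "norm (h y) / norm (y - x) ^ (?n + 1) \<le> q * (norm (h y) / norm (y - p) ^ (?n + 1))"
        by (simp add: mult_ac)
      moreover have "q \<ge> 0" using \<delta> \<rho> by (simp add: q_def)
      ultimately show "norm (norm (h y) / norm (y - x) ^ (?n + 1)) \<le> norm (q * (norm (h y) / norm (y - p) ^ (?n + 1)))"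
        by (simp add: abs_mult)
    qed
  qed
qed

lemma far_part_bound:
  assumes h: "tail_integrable p \<rho> h" and x: "x \<in> ball p \<rho>" and b: "b \<ge> 0"
    and K: "\<And>y. y \<notin> ball p \<rho> \<Longrightarrow> norm (K x y) \<le> b / norm (y - x) ^ (CARD('n) + 1)"
  shows "set_integrable lebesgue (- ball p \<rho>) (\<lambda>y. K x y * h y)"
    and "norm (far_part p \<rho> h x)
      \<le> b * (LINT y:- ball p \<rho>|lebesgue. norm (h y) / norm (y - x) ^ (CARD('n) + 1))"
proof -
  have hm: "h \<in> borel_measurable lebesgue" using h by (simp add: tail_integrable_def)
  have i: "set_integrable lebesgue (- ball p \<rho>) (\<lambda>y. b * (norm (h y) / norm (y - x) ^ (CARD('n) + 1)))"
    by (intro set_integrable_mult_right tail_shift[OF h x])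
  have le: "norm (K x y * h y) \<le> b * (norm (h y) / norm (y - x) ^ (CARD('n) + 1))" if "y \<in> - ball p \<rho>" for y
    using mult_right_mono[OF K, of y "norm (h y)"] that by (simp add: norm_mult)
  show int: "set_integrable lebesgue (- ball p \<rho>) (\<lambda>y. K x y * h y)"
  proof (rule set_integrable_bound[OF i])
    show "set_borel_measurable lebesgue (- ball p \<rho>) (\<lambda>y. K x y * h y)"
      unfolding set_borel_measurable_def
      by (intro borel_measurable_scaleR borel_measurable_times kernel_measurable hm borel_measurable_indicator) auto
    show "AE y in lebesgue. y \<in> - ball p \<rho> \<longrightarrow> norm (K x y * h y) \<le> norm (b * (norm (h y) / norm (y - x) ^ (CARD('n) + 1)))"
      using le b by (auto simp: abs_mult)
  qed
  have "norm (far_part p \<rho> h x) \<le> (LINT y:- ball p \<rho>|lebesgue. norm (K x y * h y))"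
    unfolding far_part_def by (rule set_integral_norm_le)
  also have "\<dots> \<le> (LINT y:- ball p \<rho>|lebesgue. b * (norm (h y) / norm (y - x) ^ (CARD('n) + 1)))"
    by (rule set_integral_mono[OF set_integrable_norm[OF int] i le])
  finally show "norm (far_part p \<rho> h x)
      \<le> b * (LINT y:- ball p \<rho>|lebesgue. norm (h y) / norm (y - x) ^ (CARD('n) + 1))"
    by (simp only: set_integral_mult_right)
qed

lemma far_part_integrable:
  assumes h: "tail_integrable p \<rho> h" and x: "x \<in> ball p \<rho>"
  shows "set_integrable lebesgue (- ball p \<rho>) (\<lambda>y. K x y * h y)"
proof -
  define \<delta> where "\<delta> = \<rho> - dist p x"
  have \<delta>: "\<delta> > 0" using x by (auto simp: \<delta>_def)
  show ?thesis
  proof (rule far_part_bound(1)[OF h x])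
    show "0 \<le> C * (1 / (c * \<delta>))" using C c \<delta> by simp
    fix y assume y: "y \<notin> ball p \<rho>"
    have yx: "norm (x - y) \<ge> \<delta>"
      using y dist_triangle[of p y x] by (auto simp: \<delta>_def dist_norm norm_minus_commute)
    have "norm (x - y) / (1 / (c * \<delta>)) = c * (norm (x - y) * \<delta>)" by simp
    also have "\<dots> \<le> c * (norm (x - y) * norm (x - y))"
      using c yx by (intro mult_left_mono) auto
    also have "\<dots> \<le> c * (norm x * norm (x - y) + (norm (x - y))\<^sup>2)"
      using c by (intro mult_left_mono) (auto simp: power2_eq_square)
    finally have "norm (K x y) \<le> C * (1 / (c * \<delta>)) / norm (x - y) ^ (CARD('n) + 1)"
      using yx \<delta> c by (intro kernel_decay) auto
    then show "norm (K x y) \<le> C * (1 / (c * \<delta>)) / norm (y - x) ^ (CARD('n) + 1)"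
      by (simp add: norm_minus_commute)
  qed
qed

text \<open>
  The smoothness of the kernel in its first argument, integrated over the complement of the ball.
\<close>

lemma far_part_Lipschitz:
  assumes h: "tail_integrable p \<rho> h" and z: "z \<in> ball p \<rho>" and x: "2 * dist x z < \<rho> - dist p z"
  shows "norm (far_part p \<rho> h x - far_part p \<rho> h z)
    \<le> C * dist x z * (LINT y:- ball p \<rho>|lebesgue. norm (h y) / norm (y - z) ^ (CARD('n) + 1))"
proof -
  have xb: "x \<in> ball p \<rho>"
    using x dist_triangle[of p x z] zero_le_dist[of x z] unfolding mem_ball dist_commute[of z x] by linarith
  have i: "set_integrable lebesgue (- ball p \<rho>) (\<lambda>y. C * dist x z * (norm (h y) / norm (y - z) ^ (CARD('n) + 1)))"
    by (intro set_integrable_mult_right tail_shift[OF h z])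
  have ix: "set_integrable lebesgue (- ball p \<rho>) (\<lambda>y. K x y * h y)" and iz: "set_integrable lebesgue (- ball p \<rho>) (\<lambda>y. K z y * h y)"
    by (intro far_part_integrable h xb z)+
  have d: "far_part p \<rho> h x - far_part p \<rho> h z = (LINT y:- ball p \<rho>|lebesgue. K x y * h y - K z y * h y)"
    unfolding far_part_def by (rule set_integral_diff(2)[OF ix iz, symmetric])
  have "norm (far_part p \<rho> h x - far_part p \<rho> h z) \<le> (LINT y:- ball p \<rho>|lebesgue. norm (K x y * h y - K z y * h y))"
    unfolding d by (rule set_integral_norm_le)
  also have "\<dots> \<le> (LINT y:- ball p \<rho>|lebesgue. C * dist x z * (norm (h y) / norm (y - z) ^ (CARD('n) + 1)))"
  proof (rule set_integral_mono[OF set_integrable_norm[OF set_integral_diff(1)[OF ix iz]] i])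
    fix y assume "y \<in> - ball p \<rho>"
    then have "norm (y - z) > 2 * norm (z - x)"
      using x dist_triangle[of p y z] by (auto simp: dist_norm norm_minus_commute)
    from kernel_smooth[OF this] norm_ge_zero[of "K y z - K y x"]
      norm_minus_commute[of "K z y" "K x y"]
    have "norm (K x y - K z y) \<le> C * (norm (z - x) / norm (y - z) ^ (CARD('n) + 1))"
      by linarith
    from mult_right_mono[OF this norm_ge_zero[of "h y"]]
    show "norm (K x y * h y - K z y * h y) \<le> C * dist x z * (norm (h y) / norm (y - z) ^ (CARD('n) + 1))"
      unfolding left_diff_distrib[symmetric] norm_mult by (simp add: dist_norm norm_minus_commute mult_ac)
  qed
  finally show ?thesis by (simp only: set_integral_mult_right)
qed

lemma continuous_on_far_part:
  assumes h: "tail_integrable p \<rho> h"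
  shows "continuous_on (ball p \<rho>) (far_part p \<rho> h)"
proof (intro continuous_at_imp_continuous_on ballI)
  fix z assume z: "z \<in> ball p \<rho>"
  let ?I = "LINT y:- ball p \<rho>|lebesgue. norm (h y) / norm (y - z) ^ (CARD('n) + 1)"
  have "((\<lambda>x. far_part p \<rho> h x - far_part p \<rho> h z) \<longlongrightarrow> 0) (at z)"
  proof (rule Lim_null_comparison)
    show "\<forall>\<^sub>F x in at z. norm (far_part p \<rho> h x - far_part p \<rho> h z) \<le> C * dist x z * ?I"
      unfolding eventually_at
    proof (intro exI conjI ballI impI)
      show "(\<rho> - dist p z) / 2 > 0" using z by simp
      fix x assume "x \<noteq> z \<and> dist x z < (\<rho> - dist p z) / 2"
      then show "norm (far_part p \<rho> h x - far_part p \<rho> h z) \<le> C * dist x z * ?I"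
        by (intro far_part_Lipschitz h z) simp
    qed
    have "((\<lambda>x. C * dist x z * ?I) \<longlongrightarrow> C * dist z z * ?I) (at z)"
      by (intro tendsto_intros)
    then show "((\<lambda>x. C * dist x z * ?I) \<longlongrightarrow> 0) (at z)" by simp
  qed
  then show "isCont (far_part p \<rho> h) z" unfolding isCont_def by (rule LIM_zero_cancel)
qed

lemma far_part_smooth_bound:
  assumes h: "tail_integrable p (2 * r) h" and x: "x \<in> ball p r"
  shows "norm (far_part p (2 * r) h x - far_part p (2 * r) h p) \<le> C * r * tail_mass p (2 * r) h"
proof -
  have r: "r > 0" using x by (auto intro: order_le_less_trans[OF zero_le_dist])
  have I0: "0 \<le> tail_mass p (2 * r) h"
    unfolding tail_mass_def set_lebesgue_integral_def
    by (intro Bochner_Integration.integral_nonneg) (simp add: indicator_def)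
  have "norm (far_part p (2 * r) h x - far_part p (2 * r) h p) \<le> C * dist x p * tail_mass p (2 * r) h"
    unfolding tail_mass_def using x r by (intro far_part_Lipschitz h) (auto simp: dist_commute)
  also have "\<dots> \<le> C * r * tail_mass p (2 * r) h"
    using C x by (intro mult_right_mono mult_left_mono I0) (auto simp: dist_commute)
  finally show ?thesis .
qed

text \<open>
  For radii at least critical the exponential factor turns the size bound of the kernel into
  \<open>r / \<bar>x - y\<bar> ^ (n + 1)\<close> up to a constant, with the same scaling as the smoothness estimate.
\<close>

lemma far_part_critical_bound:
  assumes h: "tail_integrable p (2 * r) h" and r: "r \<ge> critical_radius p" and x: "x \<in> ball p r"
  shows "norm (far_part p (2 * r) h x) \<le> C * (16 * r / c) * 2 ^ (CARD('n) + 1) * tail_mass p (2 * r) h"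
proof -
  let ?n = "CARD('n)"
  have r0: "r > 0" using r critical_radius_pos[of p] by linarith
  have xb: "x \<in> ball p (2 * r)" using x r0 by simp
  have b: "C * (16 * r / c) \<ge> 0" using C c r0 by simp
  have yx: "norm (x - y) \<ge> r" and yp: "norm (y - p) \<le> 2 * norm (y - x)" and yp0: "norm (y - p) > 0"
    if "y \<notin> ball p (2 * r)" for y
    using that x r0 dist_triangle[of p y x] by (auto simp: dist_norm norm_minus_commute)
  have "norm (far_part p (2 * r) h x)
      \<le> C * (16 * r / c) * (LINT y:- ball p (2 * r)|lebesgue. norm (h y) / norm (y - x) ^ (?n + 1))"
  proof (rule far_part_bound(2)[OF h xb b])
    fix y assume y: "y \<notin> ball p (2 * r)"
    have "norm (x - y) / (16 * r / c) = c * (norm (x - y) / (16 * r))" by simp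
    also have "\<dots> \<le> c * (norm x * norm (x - y) + (norm (x - y))\<^sup>2)"
      using c by (intro mult_left_mono hermite_exponent_lower[OF r x] yx y) auto
    finally have "norm (K x y) \<le> C * (16 * r / c) / norm (x - y) ^ (?n + 1)"
      using yx[OF y] r0 c by (intro kernel_decay) auto
    then show "norm (K x y) \<le> C * (16 * r / c) / norm (y - x) ^ (?n + 1)"
      by (simp add: norm_minus_commute)
  qed
  also have "\<dots> \<le> C * (16 * r / c) * (2 ^ (?n + 1) * tail_mass p (2 * r) h)"
  proof (rule mult_left_mono[OF _ b])
    have "(LINT y:- ball p (2 * r)|lebesgue. norm (h y) / norm (y - x) ^ (?n + 1))
      \<le> (LINT y:- ball p (2 * r)|lebesgue. 2 ^ (?n + 1) * (norm (h y) / norm (y - p) ^ (?n + 1)))"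
    proof (rule set_integral_mono[OF tail_shift[OF h xb]])
      show "set_integrable lebesgue (- ball p (2 * r)) (\<lambda>y. 2 ^ (?n + 1) * (norm (h y) / norm (y - p) ^ (?n + 1)))"
        using h unfolding tail_integrable_def by (intro set_integrable_mult_right) auto
      fix y assume "y \<in> - ball p (2 * r)"
      then have y: "y \<notin> ball p (2 * r)" by simp
      have le: "norm (y - p) ^ (?n + 1) \<le> 2 ^ (?n + 1) * norm (y - x) ^ (?n + 1)"
        unfolding power_mult_distrib[symmetric] by (intro power_mono yp y) auto
      have pos: "norm (y - x) ^ (?n + 1) > 0" "norm (y - p) ^ (?n + 1) > 0"
        using yp0[OF y] yp[OF y] by (intro zero_less_power; linarith)+
      have "1 / norm (y - x) ^ (?n + 1) \<le> 2 ^ (?n + 1) / norm (y - p) ^ (?n + 1)"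
        using le pos by (simp only: divide_le_eq le_divide_eq pos mult_1 times_divide_eq_left if_True)
      from mult_left_mono[OF this norm_ge_zero[of "h y"]]
      show "norm (h y) / norm (y - x) ^ (?n + 1) \<le> 2 ^ (?n + 1) * (norm (h y) / norm (y - p) ^ (?n + 1))"
        by (simp add: mult_ac)
    qed
    then show "(LINT y:- ball p (2 * r)|lebesgue. norm (h y) / norm (y - x) ^ (?n + 1)) \<le> 2 ^ (?n + 1) * tail_mass p (2 * r) h"
      unfolding tail_mass_def by (simp only: set_integral_mult_right)
  qed
  finally show ?thesis by (simp only: mult.assoc)
qed

end

section \<open>Local square integrability and growth of functions in the space\<close>

definition cut :: "real^'n \<Rightarrow> real \<Rightarrow> (real^'n \<Rightarrow> 'k::real_normed_field) \<Rightarrow> real^'n \<Rightarrow> 'k" where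
  "cut p \<rho> h = (\<lambda>y. indicator (ball p \<rho>) y * h y)"

lemma indicator_mult_L2:
  fixes h :: "real^'n \<Rightarrow> 'k::{real_normed_field, euclidean_space}"
  assumes h: "h \<in> borel_measurable lebesgue" and B: "B \<in> sets lebesgue"
    and sq: "set_integrable lebesgue B (\<lambda>y. (norm (h y))\<^sup>2)"
  shows "(\<lambda>y. indicator B y * h y) \<in> L2"
    and "(LINT y|lebesgue. (norm (indicator B y * h y))\<^sup>2) = (LINT y:B|lebesgue. (norm (h y))\<^sup>2)"
proof -
  have e: "(\<lambda>y. indicator B y * h y) = (\<lambda>y. indicator B y *\<^sub>R h y)"
    by (auto simp: indicator_def fun_eq_iff)
  have n: "(\<lambda>y. (norm (indicator B y * h y))\<^sup>2) = (\<lambda>y. indicator B y *\<^sub>R (norm (h y))\<^sup>2)"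
    by (auto simp: indicator_def fun_eq_iff)
  have "(\<lambda>y. indicator B y *\<^sub>R h y) \<in> borel_measurable lebesgue"
    using B by (intro borel_measurable_scaleR borel_measurable_indicator h)
  then have "(\<lambda>y. indicator B y * h y) \<in> borel_measurable lebesgue" by (simp only: e)
  moreover have "integrable lebesgue (\<lambda>y. (norm (indicator B y * h y))\<^sup>2)"
    using sq by (simp only: n set_integrable_def)
  ultimately show "(\<lambda>y. indicator B y * h y) \<in> L2" by (simp add: L2_def)
  show "(LINT y|lebesgue. (norm (indicator B y * h y))\<^sup>2) = (LINT y:B|lebesgue. (norm (h y))\<^sup>2)"
    unfolding n set_lebesgue_integral_def ..
qed

text \<open>
  Working with a bound \<open>N > 0\<close> in place of the norm avoids division by a norm that may vanish.
\<close>

definition bmo_witness :: "(real^'n \<Rightarrow> 'k::{real_normed_field, euclidean_space}) \<Rightarrow> real \<Rightarrow> bool" where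
  "bmo_witness f N \<longleftrightarrow> locally_integrable f \<and> N > 0 \<and> BMOH_bound f N"

lemma bmo_witnessD:
  assumes "bmo_witness f N"
  shows "locally_integrable f" "N > 0" "f \<in> borel_measurable lebesgue"
    "r > 0 \<Longrightarrow> mean_on (ball x r) (\<lambda>y. norm (f y - mean_on (ball x r) f)) \<le> N"
    "r \<ge> critical_radius x \<Longrightarrow> mean_on (ball x r) (\<lambda>y. norm (f y)) \<le> N"
  using assms locally_integrable_measurable[of f] unfolding bmo_witness_def BMOH_bound_def by auto

text \<open>
  Since \<open>\<bar>f - d\<bar>\<^sup>2 \<le> 2 \<bar>f - f\<^sub>B\<bar>\<^sup>2 + 2 \<bar>f\<^sub>B - d\<bar>\<^sup>2\<close>, the John--Nirenberg estimate extends to any constant \<open>d\<close>.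
\<close>

lemma bmo_witness_square:
  fixes f :: "real^'n \<Rightarrow> 'k::{real_normed_field, euclidean_space}"
  assumes f: "bmo_witness f N" and r: "r > 0"
  shows "set_integrable lebesgue (ball x r) (\<lambda>y. (norm (f y - d))\<^sup>2)"
    and "mean_on (ball x r) (\<lambda>y. (norm (f y - d))\<^sup>2)
      \<le> 2 * JN_const TYPE('n) * N\<^sup>2 + 2 * (norm (mean_on (ball x r) f - d))\<^sup>2"
proof -
  let ?B = "ball x r" and ?m = "mean_on (ball x r) f"
  note D = bmo_witnessD[OF f]
  note JN = John_Nirenberg_square[OF D(1) D(2) D(4) r]
  have bd: "(norm (f y - d))\<^sup>2 \<le> 2 * (norm (f y - ?m))\<^sup>2 + 2 * (norm (?m - d))\<^sup>2" for y
  proof -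
    have "norm (f y - d) \<le> norm (f y - ?m) + norm (?m - d)"
      using norm_triangle_ineq[of "f y - ?m" "?m - d"] by simp
    then have "(norm (f y - d))\<^sup>2 \<le> (norm (f y - ?m) + norm (?m - d))\<^sup>2" by (intro power_mono) auto
    also have "\<dots> \<le> 2 * (norm (f y - ?m))\<^sup>2 + 2 * (norm (?m - d))\<^sup>2"
      using zero_le_power2[of "norm (f y - ?m) - norm (?m - d)"] by (simp add: power2_eq_square algebra_simps)
    finally show ?thesis .
  qed
  have i: "set_integrable lebesgue ?B (\<lambda>y. 2 * (norm (f y - ?m))\<^sup>2 + 2 * (norm (?m - d))\<^sup>2)"
    by (intro set_integral_add(1) set_integrable_mult_right JN(1) set_integrable_const_ball)
  have m: "(\<lambda>y. (norm (f y - d))\<^sup>2) \<in> borel_measurable lebesgue"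
    using D(3) by measurable
  show s: "set_integrable lebesgue ?B (\<lambda>y. (norm (f y - d))\<^sup>2)"
  proof (rule set_integrable_bound[OF i])
    show "set_borel_measurable lebesgue ?B (\<lambda>y. (norm (f y - d))\<^sup>2)"
      unfolding set_borel_measurable_def
      by (intro borel_measurable_scaleR borel_measurable_indicator m) auto
  qed (use bd in auto)
  have "mean_on ?B (\<lambda>y. (norm (f y - d))\<^sup>2) \<le> mean_on ?B (\<lambda>y. 2 * (norm (f y - ?m))\<^sup>2 + 2 * (norm (?m - d))\<^sup>2)"
    by (rule mean_on_mono[OF s i bd])
  also have "\<dots> = 2 * mean_on ?B (\<lambda>y. (norm (f y - ?m))\<^sup>2) + 2 * (norm (?m - d))\<^sup>2"
    by (subst mean_on_add) (auto intro!: set_integrable_mult_right JN(1) simp: mean_on_mult_left mean_on_const r)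
  also have "\<dots> \<le> 2 * (JN_const TYPE('n) * N\<^sup>2) + 2 * (norm (?m - d))\<^sup>2"
    using JN(2) by simp
  finally show "mean_on ?B (\<lambda>y. (norm (f y - d))\<^sup>2) \<le> 2 * JN_const TYPE('n) * N\<^sup>2 + 2 * (norm (?m - d))\<^sup>2"
    by simp
qed

lemma cut_L2:
  fixes f :: "real^'n \<Rightarrow> 'k::{real_normed_field, euclidean_space}"
  assumes f: "bmo_witness f N"
  shows "cut x r (\<lambda>y. f y - d) \<in> L2"
proof (cases "r > 0")
  case True
  have "(\<lambda>y. f y - d) \<in> borel_measurable lebesgue" using bmo_witnessD(3)[OF f] by measurable
  then show ?thesis unfolding cut_def
    by (intro indicator_mult_L2(1) bmo_witness_square(1)[OF f True]) auto
next
  case False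
  then have "cut x r (\<lambda>y. f y - d) = (\<lambda>_. 0)" by (simp add: cut_def ball_empty)
  then show ?thesis by (simp add: L2_def)
qed

text \<open>
  Double the radius until it passes the critical one, where the mean is bounded by \<open>N\<close>; this takes about
  \<open>log\<^sub>2 (\<gamma> / r)\<close> doublings.
\<close>

lemma bmo_mean_le:
  fixes f :: "real^'n \<Rightarrow> 'k::{real_normed_field, euclidean_space}"
  assumes f: "bmo_witness f N" and r: "0 < r" "r \<le> critical_radius x"
  shows "norm (mean_on (ball x r) f) \<le> (1 + 2 ^ CARD('n) * 2) * N * (1 + ln (critical_radius x / r))"
proof -
  let ?g = "critical_radius x"
  note D = bmo_witnessD[OF f]
  define k where "k = nat \<lceil>log 2 (?g / r)\<rceil>"
  have l0: "log 2 (?g / r) \<ge> 0" using r by simp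
  have kl: "log 2 (?g / r) \<le> real k" "real k \<le> 1 + log 2 (?g / r)"
    using l0 unfolding k_def by linarith+
  have "?g / r = 2 powr log 2 (?g / r)" using r critical_radius_pos[of x] by simp
  also have "\<dots> \<le> 2 powr real k" using kl by simp
  finally have kr: "?g \<le> 2 ^ k * r" using r by (simp add: powr_realpow field_simps)
  have "norm (mean_on (ball x (2 ^ k * r)) f) \<le> N"
    using norm_mean_on_le[of "ball x (2 ^ k * r)" f] D(5)[OF kr] by linarith
  moreover have "norm (mean_on (ball x (2 ^ k * r)) f - mean_on (ball x r) f) \<le> real k * (2 ^ CARD('n) * N)"
    by (rule mean_on_dyadic_ball_diff[OF D(1) r(1) D(4)])
  ultimately have 1: "norm (mean_on (ball x r) f) \<le> N + real k * (2 ^ CARD('n) * N)"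
    using norm_triangle_ineq2[of "mean_on (ball x r) f" "mean_on (ball x (2 ^ k * r)) f"]
    by (simp add: norm_minus_commute)
  have "real k \<le> 2 * (1 + ln (?g / r))"
  proof -
    have "ln 2 \<ge> (1/2::real)" using ln_le_minus_one[of "1/2"] by (simp add: ln_div)
    then have "log 2 (?g / r) \<le> 2 * ln (?g / r)"
      using r mult_right_mono[of "1/2" "ln 2" "ln (?g / r)"] unfolding log_def by (simp add: field_simps)
    then show ?thesis using kl by simp
  qed
  then have "real k * (2 ^ CARD('n) * N) \<le> 2 * (1 + ln (?g / r)) * (2 ^ CARD('n) * N)"
    using D(2) by (intro mult_right_mono) auto
  moreover have "N * 1 \<le> N * (1 + ln (?g / r))"
    using D(2) r by (intro mult_left_mono) auto
  ultimately show ?thesis using 1 by (simp add: algebra_simps)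
qed

lemma summable_linear_half: "summable (\<lambda>k. (1 + (real k + 2) * b) / 2 ^ k)"
proof (rule summable_comparison_test'[OF summable_mult[OF summable_square_half, of "1 + 2 * \<bar>b\<bar>"]])
  fix k :: nat
  have "\<bar>1 + (real k + 2) * b\<bar> \<le> 1 + (real k + 2) * \<bar>b\<bar>"
    by (rule order_trans[OF abs_triangle_ineq]) (simp add: abs_mult)
  also have "\<dots> \<le> (1 + 2 * \<bar>b\<bar>) * (real k + 1)\<^sup>2"
  proof -
    have "1 \<le> (real k + 1)\<^sup>2" "real k + 2 \<le> 2 * (real k + 1)\<^sup>2"
      by (auto simp: power2_eq_square algebra_simps)
    from this(1) mult_right_mono[OF this(2), of "\<bar>b\<bar>"] show ?thesis
      by (simp only: distrib_right mult_1 mult_ac) linarith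
  qed
  finally have "\<bar>1 + (real k + 2) * b\<bar> / 2 ^ k \<le> (1 + 2 * \<bar>b\<bar>) * (real k + 1)\<^sup>2 / 2 ^ k"
    by (intro divide_right_mono) auto
  then show "norm ((1 + (real k + 2) * b) / 2 ^ k) \<le> (1 + 2 * \<bar>b\<bar>) * ((real k + 1)\<^sup>2 * (1 / 2) ^ k)"
    by (simp add: power_one_over)
qed

text \<open>
  The constant of the shell estimate at radius \<open>2 * r\<close> for the linearly growing bounds
  \<open>\<alpha> k = (1 + (k + 1) * 2 ^ n) * N\<close> on the dyadic means.
\<close>

definition tail_const :: "'n::finite itself \<Rightarrow> real" where
  "tail_const _ = 2 ^ CARD('n) * unit_ball_vol (real CARD('n)) / 2 * (\<Sum>k. (1 + (real k + 2) * 2 ^ CARD('n)) / 2 ^ k)"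

context hermite_operator
begin

lemma tail_integrable_if_means:
  fixes f :: "real^'n \<Rightarrow> 'k"
  assumes f: "locally_integrable f" and r: "r > 0"
    and mean: "\<And>k. mean_on (ball p (2 ^ k * (2 * r))) (\<lambda>y. norm (f y - d)) \<le> (1 + (real k + 1) * 2 ^ CARD('n)) * N"
  shows "tail_integrable p (2 * r) (\<lambda>y. f y - d)"
    and "tail_mass p (2 * r) (\<lambda>y. f y - d) \<le> tail_const TYPE('n) * N / r"
proof -
  define h where "h y = norm (f y - d)" for y
  have hl: "locally_integrable h"
    unfolding h_def by (rule locally_integrable_norm_diff[OF f])
  define \<alpha> where "\<alpha> k = (1 + (real k + 1) * 2 ^ CARD('n)) * N" for k :: nat
  have \<alpha>': "\<alpha> (Suc k) / 2 ^ k = N * ((1 + (real k + 2) * 2 ^ CARD('n)) / 2 ^ k)" for k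
    by (simp add: \<alpha>_def add_ac)
  have sm: "summable (\<lambda>k. \<alpha> (Suc k) / 2 ^ k)"
    unfolding \<alpha>' by (intro summable_mult summable_linear_half)
  have r2: "2 * r > 0" using r by simp
  have m: "mean_on (ball p (2 ^ k * (2 * r))) h \<le> \<alpha> k" for k
    using mean[of k] unfolding h_def[abs_def] \<alpha>_def .
  have h0: "0 \<le> h y" for y by (simp add: h_def)
  have fm: "(\<lambda>y. f y - d) \<in> borel_measurable lebesgue" using locally_integrable_measurable[OF f] by measurable
  show "tail_integrable p (2 * r) (\<lambda>y. f y - d)"
    using tail_integral(1)[OF hl h0 r2 m sm] fm unfolding tail_integrable_def h_def by blast
  have "tail_mass p (2 * r) (\<lambda>y. f y - d) \<le> 2 ^ CARD('n) * unit_ball_vol (real CARD('n)) / (2 * r) * (\<Sum>k. \<alpha> (Suc k) / 2 ^ k)"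
    using tail_integral(2)[OF hl h0 r2 m sm] unfolding tail_mass_def h_def by blast
  also have "(\<Sum>k. \<alpha> (Suc k) / 2 ^ k) = N * (\<Sum>k. (1 + (real k + 2) * 2 ^ CARD('n)) / 2 ^ k)"
    unfolding \<alpha>' by (rule suminf_mult[OF summable_linear_half])
  finally show "tail_mass p (2 * r) (\<lambda>y. f y - d) \<le> tail_const TYPE('n) * N / r"
    by (simp add: tail_const_def mult_ac)
qed

lemma bmo_tail_mean:
  fixes f :: "real^'n \<Rightarrow> 'k"
  assumes f: "bmo_witness f N" and r: "r > 0"
  shows "tail_integrable p (2 * r) (\<lambda>y. f y - mean_on (ball p r) f)"
    and "tail_mass p (2 * r) (\<lambda>y. f y - mean_on (ball p r) f) \<le> tail_const TYPE('n) * N / r"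
proof -
  note D = bmo_witnessD[OF f]
  have m: "mean_on (ball p (2 ^ k * (2 * r))) (\<lambda>y. norm (f y - mean_on (ball p r) f)) \<le> (1 + (real k + 1) * 2 ^ CARD('n)) * N" for k
    using mean_on_dyadic_ball_osc[OF D(1) r D(4), of p "Suc k"] by (simp add: mult_ac add_ac)
  from tail_integrable_if_means[OF D(1) r m]
  show "tail_integrable p (2 * r) (\<lambda>y. f y - mean_on (ball p r) f)"
    and "tail_mass p (2 * r) (\<lambda>y. f y - mean_on (ball p r) f) \<le> tail_const TYPE('n) * N / r" .
qed

lemma bmo_tail_critical:
  fixes f :: "real^'n \<Rightarrow> 'k"
  assumes f: "bmo_witness f N" and r: "r \<ge> critical_radius p"
  shows "tail_integrable p (2 * r) f" and "tail_mass p (2 * r) f \<le> tail_const TYPE('n) * N / r"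
proof -
  note D = bmo_witnessD[OF f]
  have r0: "r > 0" using r critical_radius_pos[of p] by linarith
  have m: "mean_on (ball p (2 ^ k * (2 * r))) (\<lambda>y. norm (f y - 0)) \<le> (1 + (real k + 1) * 2 ^ CARD('n)) * N" for k
  proof -
    have "r * 1 \<le> r * 2 ^ Suc k" using r0 by (intro mult_left_mono one_le_power) auto
    then have "critical_radius p \<le> 2 ^ k * (2 * r)" using r by (simp add: mult_ac)
    from D(5)[OF this] have "mean_on (ball p (2 ^ k * (2 * r))) (\<lambda>y. norm (f y - 0)) \<le> 1 * N" by simp
    also have "\<dots> \<le> (1 + (real k + 1) * 2 ^ CARD('n)) * N" using D(2) by (intro mult_right_mono) auto
    finally show ?thesis .
  qed
  from tail_integrable_if_means[OF D(1) r0 m]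
  show "tail_integrable p (2 * r) f" and "tail_mass p (2 * r) f \<le> tail_const TYPE('n) * N / r" by simp_all
qed

lemma bmo_tail_integrable:
  fixes f :: "real^'n \<Rightarrow> 'k"
  assumes f: "bmo_witness f N" and \<rho>: "\<rho> > 0"
  shows "tail_integrable p \<rho> (\<lambda>y. f y - d)"
proof -
  note D = bmo_witnessD[OF f]
  define r where "r = \<rho> / 2"
  have r: "r > 0" and \<rho>r: "\<rho> = 2 * r" using \<rho> by (auto simp: r_def)
  let ?m = "mean_on (ball p r) f"
  have i: "set_integrable lebesgue (ball x s) (\<lambda>y. norm (f y - c))" for x s c
    by (rule locally_integrable_norm_diff_ball[OF D(1)])
  have "mean_on (ball p (2 ^ k * (2 * r))) (\<lambda>y. norm (f y - d)) \<le> (1 + (real k + 1) * 2 ^ CARD('n)) * (N + norm (?m - d))" for k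
  proof -
    let ?B = "ball p (2 ^ k * (2 * r))"
    have "mean_on ?B (\<lambda>y. norm (f y - d)) \<le> mean_on ?B (\<lambda>y. norm (f y - ?m) + norm (?m - d))"
    proof (rule mean_on_mono)
      show "norm (f y - d) \<le> norm (f y - ?m) + norm (?m - d)" for y
        using norm_triangle_ineq[of "f y - ?m" "?m - d"] by simp
    qed (auto intro!: i set_integral_add)
    also have "\<dots> = mean_on ?B (\<lambda>y. norm (f y - ?m)) + norm (?m - d)"
      by (subst mean_on_add) (auto simp: i mean_on_const r)
    also have "\<dots> \<le> (1 + (real k + 1) * 2 ^ CARD('n)) * N + 1 * norm (?m - d)"
      using mean_on_dyadic_ball_osc[OF D(1) r D(4), of p "Suc k"] by (simp add: mult_ac add_ac)
    also have "\<dots> \<le> (1 + (real k + 1) * 2 ^ CARD('n)) * N + (1 + (real k + 1) * 2 ^ CARD('n)) * norm (?m - d)"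
      by (intro add_left_mono mult_right_mono) auto
    finally show ?thesis by (simp only: distrib_left)
  qed
  from tail_integrable_if_means(1)[OF D(1) r this] show ?thesis by (simp only: \<rho>r)
qed

end

section \<open>The extension and its size on balls of critical radius\<close>

context hermite_operator
begin

lemma far_part_split:
  assumes h: "tail_integrable p \<rho> h" "tail_integrable q R h"
    and sub: "ball p \<rho> \<subseteq> ball q R" and x: "x \<in> ball p \<rho>"
  shows "far_part p \<rho> h x = (LINT y|lebesgue. K x y * (indicator (ball q R - ball p \<rho>) y * h y)) + far_part q R h x"
proof -
  have xq: "x \<in> ball q R" using x sub by auto
  have i: "set_integrable lebesgue (- ball p \<rho>) (\<lambda>y. K x y * h y)" "set_integrable lebesgue (- ball q R) (\<lambda>y. K x y * h y)"
    using far_part_integrable[OF h(1) x] far_part_integrable[OF h(2) xq] .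
  have u: "- ball p \<rho> = (ball q R - ball p \<rho>) \<union> (- ball q R)" using sub by auto
  have i': "set_integrable lebesgue (ball q R - ball p \<rho>) (\<lambda>y. K x y * h y)"
    by (rule set_integrable_subset[OF i(1)]) auto
  have "far_part p \<rho> h x = (LINT y:(ball q R - ball p \<rho>) \<union> (- ball q R)|lebesgue. K x y * h y)"
    unfolding far_part_def using u by simp
  also have "\<dots> = (LINT y:ball q R - ball p \<rho>|lebesgue. K x y * h y) + far_part q R h x"
    unfolding far_part_def by (rule set_integral_Un[OF _ i' i(2)]) auto
  also have "(LINT y:ball q R - ball p \<rho>|lebesgue. K x y * h y) = (LINT y|lebesgue. K x y * (indicator (ball q R - ball p \<rho>) y * h y))"
    unfolding set_lebesgue_integral_def by (intro Bochner_Integration.integral_cong) (auto simp: indicator_def)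
  finally show ?thesis .
qed

text \<open>
  A function supported in the shell \<open>ball q R - ball p \<rho>\<close> has essential support disjoint from the inner
  ball, so the kernel represents its image there.
\<close>

lemma T_cut_difference:
  assumes u: "u \<in> L2" and z: "\<And>y. y \<notin> ball q R - ball p \<rho> \<Longrightarrow> u y = 0"
  shows "AE x in lebesgue. x \<in> ball p \<rho> \<longrightarrow> T u x = (LINT y|lebesgue. K x y * u y)"
proof -
  have out: "x \<notin> ess_support u" if "open U" "\<And>y. y \<in> U \<Longrightarrow> u y = 0" "x \<in> U" for x U
    using that unfolding ess_support_def by auto
  have "ess_support u \<subseteq> cball q R"
  proof
    fix x assume x: "x \<in> ess_support u"
    show "x \<in> cball q R"
    proof (rule ccontr)
      assume "x \<notin> cball q R"
      moreover have "u y = 0" if "y \<in> - cball q R" for y using that by (intro z) auto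
      ultimately show False using out[of "- cball q R" x] x by (auto simp: open_Compl)
    qed
  qed
  moreover have "closed (ess_support u)" unfolding ess_support_def by (auto intro: open_Union)
  ultimately have "compact (ess_support u)"
    by (meson bounded_cball bounded_subset compact_eq_bounded_closed)
  then have "u \<in> L2c" using u by (simp add: L2c_def)
  from T_kernel[OF this] show ?thesis
  proof eventually_elim
    case (elim x)
    have "u y = 0" if "y \<in> ball p \<rho>" for y using that by (intro z) auto
    with elim show ?case using out[of "ball p \<rho>" x] by auto
  qed
qed

text \<open>
  The local formulas for the extension agree: enlarging the ball moves the contribution of the
  shell from the kernel integral into the operator.
\<close>

lemma cut_consistent:
  fixes h :: "real^'n \<Rightarrow> 'k"
  assumes h: "tail_integrable p \<rho> h" "tail_integrable q R h" and L: "cut p \<rho> h \<in> L2" "cut q R h \<in> L2"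
    and sub: "ball p \<rho> \<subseteq> ball q R"
  shows "AE x in lebesgue. x \<in> ball p \<rho> \<longrightarrow> T (cut q R h) x + far_part q R h x = T (cut p \<rho> h) x + far_part p \<rho> h x"
proof -
  define u where "u = (\<lambda>y. indicator (ball q R - ball p \<rho>) y * h y)"
  have e: "cut q R h = (\<lambda>y. cut p \<rho> h y + u y)"
    using sub by (auto simp: cut_def u_def fun_eq_iff indicator_def)
  have eu: "u = (\<lambda>y. indicator (ball q R - ball p \<rho>) y *\<^sub>R cut q R h y)"
    by (auto simp: u_def cut_def fun_eq_iff indicator_def)
  have uL: "u \<in> L2"
    unfolding L2_def
  proof (intro CollectI conjI)
    have m: "cut q R h \<in> borel_measurable lebesgue" using L(2) by (simp add: L2_def)
    show um: "u \<in> borel_measurable lebesgue"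
      unfolding eu by (intro borel_measurable_scaleR borel_measurable_indicator m) auto
    show "integrable lebesgue (\<lambda>x. (norm (u x))\<^sup>2)"
    proof (rule Bochner_Integration.integrable_bound)
      show "integrable lebesgue (\<lambda>x. (norm (cut q R h x))\<^sup>2)" using L(2) by (simp add: L2_def)
      show "(\<lambda>x. (norm (u x))\<^sup>2) \<in> borel_measurable lebesgue" using um by measurable
    qed (auto simp: eu indicator_def)
  qed
  have "AE x in lebesgue. T (cut q R h) x = T (cut p \<rho> h) x + T u x"
    unfolding e by (rule T_add[OF L(1) uL])
  moreover have "AE x in lebesgue. x \<in> ball p \<rho> \<longrightarrow> T u x = (LINT y|lebesgue. K x y * u y)"
    by (rule T_cut_difference[OF uL, of q R]) (auto simp: u_def)
  ultimately show ?thesis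
  proof eventually_elim
    case (elim x)
    then show ?case using far_part_split[OF h sub, of x] by (auto simp: u_def)
  qed
qed

text \<open>
  Glue the formulas for integer radii: at \<open>x\<close> use a radius exceeding \<open>\<bar>x\<bar>\<close>. Only countably many formulas are
  involved, so the exceptional sets still form a null set.
\<close>

lemma version_exists:
  fixes f :: "real^'n \<Rightarrow> 'k"
  assumes tail: "\<And>\<rho>. \<rho> > 0 \<Longrightarrow> tail_integrable 0 \<rho> f" and L: "\<And>\<rho>. cut 0 \<rho> f \<in> L2"
  shows "BMOH_ext_version T K f (BMOH_ext T K f)"
proof -
  define m where "m x = nat \<lceil>norm x\<rceil> + 2" for x :: "real^'n"
  define G where "G k x = T (cut 0 (real k) f) x + far_part 0 (real k) f x" for k x
  have "BMOH_ext_version T K f (\<lambda>x. G (m x) x)"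
    unfolding BMOH_ext_version_def
  proof (intro allI impI)
    fix R :: real assume R: "R > 1"
    have "AE x in lebesgue. x \<in> ball 0 (min R (real (k + 1))) \<longrightarrow> T (cut 0 R f) x + far_part 0 R f x = G (k + 1) x" for k
    proof -
      let ?s = "min R (real (k + 1))"
      have "AE x in lebesgue. x \<in> ball 0 ?s \<longrightarrow> T (cut 0 R f) x + far_part 0 R f x = T (cut 0 ?s f) x + far_part 0 ?s f x"
        using R by (intro cut_consistent tail L) auto
      moreover have "AE x in lebesgue. x \<in> ball 0 ?s \<longrightarrow> G (k + 1) x = T (cut 0 ?s f) x + far_part 0 ?s f x"
        unfolding G_def using R by (intro cut_consistent tail L) auto
      ultimately show ?thesis by eventually_elim auto
    qed
    then have "AE x in lebesgue. \<forall>k. x \<in> ball 0 (min R (real (k + 1))) \<longrightarrow> T (cut 0 R f) x + far_part 0 R f x = G (k + 1) x"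
      by (subst AE_all_countable) blast
    then show "AE x\<in>ball 0 R in lebesgue. G (m x) x = T (\<lambda>y. indicator (ball 0 R) y * f y) x + (LINT y:- ball 0 R|lebesgue. K x y * f y)"
    proof eventually_elim
      case (elim x)
      have "norm x < real (m x)" unfolding m_def by linarith
      then have "x \<in> ball 0 R \<Longrightarrow> x \<in> ball 0 (min R (real ((m x - 1) + 1)))" by (simp add: m_def)
      with elim have "x \<in> ball 0 R \<Longrightarrow> T (cut 0 R f) x + far_part 0 R f x = G ((m x - 1) + 1) x" by blast
      then show ?case by (auto simp: m_def cut_def far_part_def)
    qed
  qed
  then show ?thesis unfolding BMOH_ext_def by (rule someI[where P = "BMOH_ext_version T K f"])
qed

text \<open>
  The defining formula holds for balls with any centre and radius, not only for balls around the origin.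
\<close>

lemma version_local:
  fixes f g :: "real^'n \<Rightarrow> 'k"
  assumes v: "BMOH_ext_version T K f g"
    and tail: "\<And>p \<rho>. \<rho> > 0 \<Longrightarrow> tail_integrable p \<rho> f" and L: "\<And>p \<rho>. cut p \<rho> f \<in> L2" and \<rho>: "\<rho> > 0"
  shows "AE x in lebesgue. x \<in> ball p \<rho> \<longrightarrow> g x = T (cut p \<rho> f) x + far_part p \<rho> f x"
proof -
  define R where "R = norm p + \<rho> + 1"
  have R: "R > 1" "R > 0" using \<rho> norm_ge_zero[of p] unfolding R_def by linarith+
  have sub: "ball p \<rho> \<subseteq> ball 0 R"
  proof
    fix x assume "x \<in> ball p \<rho>"
    then show "x \<in> ball 0 R" using norm_triangle_ineq[of p "x - p"] by (simp add: R_def dist_norm norm_minus_commute)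
  qed
  have "AE x in lebesgue. x \<in> ball 0 R \<longrightarrow> g x = T (cut 0 R f) x + far_part 0 R f x"
    using v R unfolding BMOH_ext_version_def cut_def far_part_def by blast
  moreover have "AE x in lebesgue. x \<in> ball p \<rho> \<longrightarrow> T (cut 0 R f) x + far_part 0 R f x = T (cut p \<rho> f) x + far_part p \<rho> f x"
    by (intro cut_consistent tail L sub \<rho> R)
  ultimately show ?thesis by eventually_elim (use sub in auto)
qed

lemma T_square_bound:
  assumes "u \<in> L2"
  shows "(LINT x|lebesgue. (norm (T u x))\<^sup>2) \<le> M\<^sup>2 * (LINT x|lebesgue. (norm (u x))\<^sup>2)"
proof -
  have n: "0 \<le> (LINT x|lebesgue. (norm (f x))\<^sup>2)" for f :: "real^'n \<Rightarrow> 'k"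
    by (intro Bochner_Integration.integral_nonneg) simp
  have "(L2norm (T u))\<^sup>2 \<le> (M * L2norm u)\<^sup>2"
    using T_bound[OF assms] n[of "T u"] by (intro power_mono) (auto simp: L2norm_def)
  then show ?thesis using n by (simp add: L2norm_def power_mult_distrib)
qed

text \<open>
  The mean of \<open>\<bar>T u\<bar>\<close> is controlled by the \<open>L\<^sup>2\<close> bound through \<open>t \<le> N / 2 + t\<^sup>2 / (2 N)\<close>, which has the right
  homogeneity in \<open>N\<close>.
\<close>

lemma T_mean_bound:
  assumes u: "u \<in> L2" and N: "N > 0" and r: "r > 0"
    and A: "(LINT x|lebesgue. (norm (u x))\<^sup>2) \<le> A * N\<^sup>2 * measure lebesgue (ball p r)"
  shows "set_integrable lebesgue (ball p r) (T u)"
    and "mean_on (ball p r) (\<lambda>x. norm (T u x)) \<le> (1 + M\<^sup>2 * A) / 2 * N"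
proof -
  let ?B = "ball p r"
  have TL: "T u \<in> L2" by (rule T_L2[OF u])
  have Tm: "T u \<in> borel_measurable lebesgue" and Ti: "integrable lebesgue (\<lambda>x. (norm (T u x))\<^sup>2)"
    using TL by (auto simp: L2_def)
  have sq: "set_integrable lebesgue ?B (\<lambda>x. (norm (T u x))\<^sup>2)"
    unfolding set_integrable_def using Ti by (intro integrable_mult_indicator) auto
  have i: "set_integrable lebesgue ?B (\<lambda>x. N / 2 + 1 / (2 * N) * (norm (T u x))\<^sup>2)"
    by (intro set_integral_add(1) set_integrable_mult_right sq set_integrable_const_ball)
  have bd: "norm (T u x) \<le> N / 2 + 1 / (2 * N) * (norm (T u x))\<^sup>2" for x
  proof -
    have "0 \<le> (norm (T u x) - N)\<^sup>2 / (2 * N)" using N by simp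
    also have "\<dots> = N / 2 + 1 / (2 * N) * (norm (T u x))\<^sup>2 - norm (T u x)"
      using N by (simp add: power2_eq_square field_simps)
    finally show ?thesis by simp
  qed
  show s: "set_integrable lebesgue ?B (T u)"
  proof (rule set_integrable_bound[OF i])
    show "set_borel_measurable lebesgue ?B (T u)"
      unfolding set_borel_measurable_def
      by (intro borel_measurable_scaleR borel_measurable_indicator Tm) auto
    show "AE x in lebesgue. x \<in> ?B \<longrightarrow> norm (T u x) \<le> norm (N / 2 + 1 / (2 * N) * (norm (T u x))\<^sup>2)"
      using bd by (intro AE_I2 impI) (metis abs_ge_self order_trans real_norm_def)
  qed
  have "(LINT x:?B|lebesgue. (norm (T u x))\<^sup>2) \<le> (LINT x|lebesgue. (norm (T u x))\<^sup>2)"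
    unfolding set_lebesgue_integral_def using sq Ti
    by (intro integral_mono) (auto simp: set_integrable_def indicator_def)
  also have "\<dots> \<le> M\<^sup>2 * (LINT x|lebesgue. (norm (u x))\<^sup>2)" by (rule T_square_bound[OF u])
  also have "\<dots> \<le> M\<^sup>2 * (A * N\<^sup>2 * measure lebesgue ?B)" by (intro mult_left_mono A) simp
  finally have "mean_on ?B (\<lambda>x. (norm (T u x))\<^sup>2) \<le> M\<^sup>2 * A * N\<^sup>2"
    using measure_ball_pos[OF r, of p] by (simp add: mean_on_def field_simps)
  then have 1: "1 / (2 * N) * mean_on ?B (\<lambda>x. (norm (T u x))\<^sup>2) \<le> 1 / (2 * N) * (M\<^sup>2 * A * N\<^sup>2)"
    using N by (intro mult_left_mono) auto
  have "mean_on ?B (\<lambda>x. norm (T u x)) \<le> mean_on ?B (\<lambda>x. N / 2 + 1 / (2 * N) * (norm (T u x))\<^sup>2)"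
    by (rule mean_on_mono[OF set_integrable_norm[OF s] i bd])
  also have "\<dots> = N / 2 + 1 / (2 * N) * mean_on ?B (\<lambda>x. (norm (T u x))\<^sup>2)"
    by (subst mean_on_add[OF set_integrable_const_ball set_integrable_mult_right[OF sq]])
       (simp only: mean_on_mult_left mean_on_const[OF r])
  also have "\<dots> \<le> N / 2 + 1 / (2 * N) * (M\<^sup>2 * A * N\<^sup>2)" using 1 by simp
  also have "\<dots> = (1 + M\<^sup>2 * A) / 2 * N" using N by (simp add: power2_eq_square field_simps)
  finally show "mean_on ?B (\<lambda>x. norm (T u x)) \<le> (1 + M\<^sup>2 * A) / 2 * N" .
qed

lemma bmo_tail_integrable0:
  assumes "bmo_witness f N" "\<rho> > 0"
  shows "tail_integrable p \<rho> f"
  using bmo_tail_integrable[OF assms, of p 0] by simp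

lemma bmo_cut_L2:
  assumes "bmo_witness f N"
  shows "cut p \<rho> f \<in> L2"
  using cut_L2[OF assms, of p \<rho> 0] by simp

lemma bmo_version:
  assumes "bmo_witness f N"
  shows "BMOH_ext_version T K f (BMOH_ext T K f)"
  by (intro version_exists bmo_tail_integrable0[OF assms] bmo_cut_L2[OF assms])

lemma bmo_version_local:
  assumes "bmo_witness f N" "\<rho> > 0"
  shows "AE x in lebesgue. x \<in> ball p \<rho> \<longrightarrow> BMOH_ext T K f x = T (cut p \<rho> f) x + far_part p \<rho> f x"
  by (intro version_local bmo_version[OF assms(1)] bmo_tail_integrable0[OF assms(1)] bmo_cut_L2[OF assms(1)] assms(2))

lemma L2_set_integrable_bounded:
  assumes u: "u \<in> L2" and S: "S \<in> sets lebesgue" "bounded S"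
  shows "set_integrable lebesgue S (u :: real^'n \<Rightarrow> 'k)"
proof -
  obtain p r where pr: "S \<subseteq> ball p r" "r > 0"
    using bounded_subset_ballD[OF S(2), of 0] by blast
  have um: "u \<in> borel_measurable lebesgue" and ui: "integrable lebesgue (\<lambda>x. (norm (u x))\<^sup>2)"
    using u by (auto simp: L2_def)
  have i: "set_integrable lebesgue (ball p r) (\<lambda>x. 1 + (norm (u x))\<^sup>2)"
    unfolding set_integrable_def[of _ _ "\<lambda>x. (norm (u x))\<^sup>2"]
    by (intro set_integral_add(1) set_integrable_const_ball)
       (auto simp: set_integrable_def intro!: integrable_mult_indicator[where 'b = real, simplified] ui)
  have "set_integrable lebesgue (ball p r) u"
  proof (rule set_integrable_bound[OF i])
    show "set_borel_measurable lebesgue (ball p r) u"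
      unfolding set_borel_measurable_def
      by (intro borel_measurable_scaleR borel_measurable_indicator um) auto
    have "t \<le> 1 + t\<^sup>2" for t :: real
      using zero_le_power2[of "t - 1/2"] by (simp add: power2_eq_square algebra_simps)
    then show "AE x in lebesgue. x \<in> ball p r \<longrightarrow> norm (u x) \<le> norm (1 + (norm (u x))\<^sup>2)"
      by (intro AE_I2 impI) (metis abs_ge_self order_trans real_norm_def)
  qed
  then show ?thesis by (rule set_integrable_subset[OF _ S(1) pr(1)])
qed

lemma BMOH_ext_locally_integrable:
  assumes f: "bmo_witness f N"
  shows "locally_integrable (BMOH_ext T K f)"
  unfolding locally_integrable_def
proof (intro allI impI)
  fix S :: "(real^'n) set" assume S: "compact S"
  obtain r where r: "S \<subseteq> ball 0 r" "r > 0"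
    using bounded_subset_ballD[OF compact_imp_bounded[OF S], of 0] by blast
  let ?a = "T (cut 0 r f)" and ?b = "far_part 0 r f"
  have bS: "set_integrable lebesgue S ?b"
  proof -
    have "continuous_on S ?b"
      by (rule continuous_on_subset[OF continuous_on_far_part[OF bmo_tail_integrable0[OF f r(2)]] r(1)])
    then have i: "integrable lborel (\<lambda>x. indicator S x *\<^sub>R ?b x)"
      by (rule borel_integrable_compact[OF S])
    then show ?thesis
      using borel_measurable_integrable[OF i] by (simp add: set_integrable_def integrable_completion)
  qed
  have aS: "set_integrable lebesgue S ?a"
    by (intro L2_set_integrable_bounded T_L2 bmo_cut_L2[OF f] compact_imp_bounded S) (use S in \<open>auto simp: compact_imp_closed\<close>)
  have ab: "set_integrable lebesgue S (\<lambda>x. ?a x + ?b x)" by (rule set_integral_add(1)[OF aS bS])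
  have "AE x in lebesgue. indicator S x *\<^sub>R (?a x + ?b x) = indicator S x *\<^sub>R BMOH_ext T K f x"
    using bmo_version_local[OF f r(2), of 0] by eventually_elim (use r(1) in \<open>auto simp: indicator_def\<close>)
  then show "set_integrable lebesgue S (BMOH_ext T K f)"
    using ab unfolding set_integrable_def
    by (subst integrable_cong_AE[symmetric])
       (auto intro: borel_measurable_AE[of "\<lambda>x. indicator S x *\<^sub>R (?a x + ?b x)"])
qed

text \<open>
  The first summand stems from the \<open>L\<^sup>2\<close> bound applied to \<open>f\<close> cut off at the doubled ball, the second from the kernel
  integral over its complement.
\<close>

definition critical_const :: real where
  "critical_const = (1 + M\<^sup>2 * (2 ^ CARD('n) * (2 * JN_const TYPE('n) + 2))) / 2 + C * (16 / c) * 2 ^ (CARD('n) + 1) * tail_const TYPE('n)"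

text \<open>
  Split \<open>f\<close> at the doubled ball. On a ball of at least critical radius the mean of \<open>\<bar>f\<bar>\<close> is bounded, hence so is the
  mean of \<open>\<bar>f\<bar>\<^sup>2\<close> and the first part is handled by \<open>L\<^sup>2\<close> boundedness; the second part is handled by the
  exponential decay of the kernel.
\<close>

lemma BMOH_ext_mean_critical:
  assumes f: "bmo_witness f N" and r: "r \<ge> critical_radius p"
  shows "mean_on (ball p r) (\<lambda>x. norm (BMOH_ext T K f x)) \<le> critical_const * N"
proof -
  note D = bmo_witnessD[OF f]
  let ?B = "ball p r" and ?n = "CARD('n)"
  have r0: "r > 0" using r critical_radius_pos[of p] by linarith
  have r2: "2 * r > 0" using r0 by simp
  let ?u = "cut p (2 * r) f"
  let ?b = "C * (16 / c) * 2 ^ (?n + 1) * tail_const TYPE('n) * N"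
  have u: "?u \<in> L2" by (rule bmo_cut_L2[OF f])
  have "(LINT x|lebesgue. (norm (?u x))\<^sup>2) = (LINT x:ball p (2 * r)|lebesgue. (norm (f x))\<^sup>2)"
    unfolding cut_def using bmo_witness_square(1)[OF f r2, of p 0] by (intro indicator_mult_L2(2) D(3)) auto
  also have "\<dots> = measure lebesgue (ball p (2 * r)) * mean_on (ball p (2 * r)) (\<lambda>x. (norm (f x))\<^sup>2)"
    using set_integral_ball_eq_mean[OF r2, of p "\<lambda>x. (norm (f x))\<^sup>2"] by simp
  also have "\<dots> \<le> measure lebesgue (ball p (2 * r)) * (2 * JN_const TYPE('n) * N\<^sup>2 + 2 * N\<^sup>2)"
  proof (rule mult_left_mono)
    have cr2: "2 * r \<ge> critical_radius p" using r r0 by simp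
    have "norm (mean_on (ball p (2 * r)) f) \<le> N"
      using norm_mean_on_le[of "ball p (2 * r)" f] D(5)[OF cr2] by linarith
    then have "(norm (mean_on (ball p (2 * r)) f))\<^sup>2 \<le> N\<^sup>2" by (intro power_mono) auto
    then show "mean_on (ball p (2 * r)) (\<lambda>x. (norm (f x))\<^sup>2) \<le> 2 * JN_const TYPE('n) * N\<^sup>2 + 2 * N\<^sup>2"
      using bmo_witness_square(2)[OF f r2, of p 0] by simp
  qed simp
  also have "measure lebesgue (ball p (2 * r)) = 2 ^ ?n * measure lebesgue ?B"
    by (rule measure_ball_scale) (use r0 in auto)
  finally have A: "(LINT x|lebesgue. (norm (?u x))\<^sup>2) \<le> (2 ^ ?n * (2 * JN_const TYPE('n) + 2)) * N\<^sup>2 * measure lebesgue ?B"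
    by (simp add: algebra_simps)
  note TB = T_mean_bound[OF u D(2) r0 A]
  have far: "norm (far_part p (2 * r) f x) \<le> ?b" if "x \<in> ?B" for x
  proof -
    note t = bmo_tail_critical[OF f r]
    have "norm (far_part p (2 * r) f x) \<le> C * (16 * r / c) * 2 ^ (?n + 1) * tail_mass p (2 * r) f"
      by (rule far_part_critical_bound[OF t(1) r that])
    also have "\<dots> \<le> C * (16 * r / c) * 2 ^ (?n + 1) * (tail_const TYPE('n) * N / r)"
      using C c r0 by (intro mult_left_mono t(2)) auto
    also have "\<dots> = ?b" using r0 c by (simp add: field_simps)
    finally show ?thesis .
  qed
  have gl: "set_integrable lebesgue ?B (\<lambda>x. norm (BMOH_ext T K f x))"
    by (intro set_integrable_norm locally_integrable_ball BMOH_ext_locally_integrable[OF f])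
  have i: "set_integrable lebesgue ?B (\<lambda>x. norm (T ?u x) + ?b)"
    by (intro set_integral_add(1) set_integrable_norm TB(1) set_integrable_const_ball)
  have "AE x in lebesgue. x \<in> ?B \<longrightarrow> norm (BMOH_ext T K f x) \<le> norm (T ?u x) + ?b"
    using bmo_version_local[OF f r2, of p]
  proof eventually_elim
    case (elim x)
    show ?case
    proof
      assume x: "x \<in> ?B"
      then have "x \<in> ball p (2 * r)" using r0 by auto
      with elim have "norm (BMOH_ext T K f x) \<le> norm (T ?u x) + norm (far_part p (2 * r) f x)"
        by (simp add: norm_triangle_ineq)
      then show "norm (BMOH_ext T K f x) \<le> norm (T ?u x) + ?b" using far[OF x] by linarith
    qed
  qed
  then have "mean_on ?B (\<lambda>x. norm (BMOH_ext T K f x)) \<le> mean_on ?B (\<lambda>x. norm (T ?u x) + ?b)"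
    unfolding mean_on_def using set_integral_mono_AE[OF gl i] by (auto intro!: divide_right_mono)
  also have "\<dots> = mean_on ?B (\<lambda>x. norm (T ?u x)) + ?b"
    by (subst mean_on_add[OF set_integrable_norm[OF TB(1)] set_integrable_const_ball]) (simp only: mean_on_const[OF r0])
  also have "\<dots> \<le> critical_const * N"
    using TB(2) unfolding critical_const_def by (simp only: distrib_right mult.assoc)
  finally show ?thesis .
qed

end

section \<open>Oscillation of the extension\<close>

text \<open>
  If \<open>u = e + d t\<close> with \<open>e\<close> close to a constant on average, the oscillations of \<open>u\<close> and of \<open>d t\<close> control each other.
  The two estimates feed the two directions of the criterion.
\<close>

lemma oscillation_linear_combination:
  fixes u e t :: "real^'n \<Rightarrow> 'k::{real_normed_field, euclidean_space}"
  assumes r: "r > 0" and u: "set_integrable lebesgue (ball p r) u" and e: "set_integrable lebesgue (ball p r) e"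
    and t: "set_integrable lebesgue (ball p r) t"
    and ae: "AE x in lebesgue. x \<in> ball p r \<longrightarrow> u x = e x + d * t x"
    and E: "mean_on (ball p r) (\<lambda>x. norm (e x - e0)) \<le> E"
  shows "mean_on (ball p r) (\<lambda>x. norm (u x - mean_on (ball p r) u))
      \<le> 2 * (E + norm d * mean_on (ball p r) (\<lambda>x. norm (t x - mean_on (ball p r) t)))"
    and "norm d * mean_on (ball p r) (\<lambda>x. norm (t x - mean_on (ball p r) t))
      \<le> 2 * (E + mean_on (ball p r) (\<lambda>x. norm (u x - mean_on (ball p r) u)))"
proof -
  let ?B = "ball p r"
  define tB uB where "tB = mean_on ?B t" and "uB = mean_on ?B u"
  have id: "set_integrable lebesgue ?B (\<lambda>x. norm (h x - k))" if "set_integrable lebesgue ?B h" for h :: "real^'n \<Rightarrow> 'k" and k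
    by (intro set_integrable_norm set_integral_diff(1) that set_integrable_const_ball)
  have dt: "set_integrable lebesgue ?B (\<lambda>x. d * t x)" using t by (rule set_integrable_mult_right)
  have mt: "mean_on ?B (\<lambda>x. norm (d * (t x - tB))) = norm d * mean_on ?B (\<lambda>x. norm (t x - tB))"
    by (simp add: norm_mult mean_on_mult_left)
  have idt: "set_integrable lebesgue ?B (\<lambda>x. norm (d * (t x - tB)))"
    by (intro set_integrable_norm set_integrable_mult_right set_integral_diff(1) t set_integrable_const_ball)
  have mono: "mean_on ?B f \<le> mean_on ?B g" if "set_integrable lebesgue ?B f" "set_integrable lebesgue ?B g"
    "AE x in lebesgue. x \<in> ?B \<longrightarrow> f x \<le> g x" for f g :: "real^'n \<Rightarrow> real"
    unfolding mean_on_def using set_integral_mono_AE[OF that] by (auto intro!: divide_right_mono)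
  have "mean_on ?B (\<lambda>x. norm (u x - uB)) \<le> 2 * mean_on ?B (\<lambda>x. norm (u x - (e0 + d * tB)))"
    unfolding uB_def by (rule oscillation_le_twice[OF u r])
  also have "mean_on ?B (\<lambda>x. norm (u x - (e0 + d * tB))) \<le> mean_on ?B (\<lambda>x. norm (e x - e0) + norm (d * (t x - tB)))"
  proof (rule mono)
    show "AE x in lebesgue. x \<in> ?B \<longrightarrow> norm (u x - (e0 + d * tB)) \<le> norm (e x - e0) + norm (d * (t x - tB))"
      using ae
    proof eventually_elim
      case (elim x)
      then show ?case using norm_triangle_ineq[of "e x - e0" "d * (t x - tB)"] by (auto simp: algebra_simps)
    qed
  qed (intro id u set_integral_add(1) e idt)+
  also have "\<dots> = mean_on ?B (\<lambda>x. norm (e x - e0)) + norm d * mean_on ?B (\<lambda>x. norm (t x - tB))"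
    by (subst mean_on_add[OF id[OF e] idt]) (simp only: mt)
  finally show "mean_on ?B (\<lambda>x. norm (u x - mean_on ?B u)) \<le> 2 * (E + norm d * mean_on ?B (\<lambda>x. norm (t x - mean_on ?B t)))"
    using E by (simp add: tB_def uB_def)
  have "norm d * mean_on ?B (\<lambda>x. norm (t x - tB)) = mean_on ?B (\<lambda>x. norm (d * t x - mean_on ?B (\<lambda>x. d * t x)))"
    by (simp only: tB_def mean_on_mult_left right_diff_distrib[symmetric] norm_mult)
  also have "\<dots> \<le> 2 * mean_on ?B (\<lambda>x. norm (d * t x - (uB - e0)))"
    by (rule oscillation_le_twice[OF dt r])
  also have "mean_on ?B (\<lambda>x. norm (d * t x - (uB - e0))) \<le> mean_on ?B (\<lambda>x. norm (e x - e0) + norm (u x - uB))"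
  proof (rule mono)
    show "AE x in lebesgue. x \<in> ?B \<longrightarrow> norm (d * t x - (uB - e0)) \<le> norm (e x - e0) + norm (u x - uB)"
      using ae
    proof eventually_elim
      case (elim x)
      then show ?case using norm_triangle_ineq4[of "u x - uB" "e x - e0"] by (auto simp: algebra_simps)
    qed
  qed (intro id u set_integral_add(1) e dt)+
  also have "\<dots> = mean_on ?B (\<lambda>x. norm (e x - e0)) + mean_on ?B (\<lambda>x. norm (u x - uB))"
    by (rule mean_on_add[OF id[OF e] id[OF u]])
  finally show "norm d * mean_on ?B (\<lambda>x. norm (t x - mean_on ?B t)) \<le> 2 * (E + mean_on ?B (\<lambda>x. norm (u x - mean_on ?B u)))"
    using E by (simp add: tB_def uB_def)
qed

lemma bmo_witness_one: "bmo_witness (\<lambda>_ :: real^'n. 1 :: 'k::{real_normed_field, euclidean_space}) 1"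
  unfolding bmo_witness_def
proof (intro conjI)
  show "locally_integrable (\<lambda>_ :: real^'n. 1 :: 'k)"
    by (intro locally_integrable_continuous continuous_intros)
  show "BMOH_bound (\<lambda>_ :: real^'n. 1 :: 'k) 1"
    unfolding BMOH_bound_def
    by (auto simp: mean_on_const order.strict_trans2[OF critical_radius_pos])
qed simp

context hermite_operator
begin

text \<open>
  The first summand stems from the \<open>L\<^sup>2\<close> bound applied to \<open>f - f\<^sub>B\<close> cut off at the doubled ball, the second from the
  variation of the kernel integral over its complement.
\<close>

definition local_const :: real where
  "local_const = (1 + M\<^sup>2 * (2 ^ CARD('n) * (2 * JN_const TYPE('n) + 2 * (2 ^ CARD('n))\<^sup>2))) / 2 + C * tail_const TYPE('n)"

text \<open>
  Write \<open>f = (f - f\<^sub>B) + f\<^sub>B\<close> on the ball \<open>B\<close>. The extension maps the constant \<open>f\<^sub>B\<close> to \<open>f\<^sub>B\<close> times its value at \<open>1\<close>. The image of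
  \<open>f - f\<^sub>B\<close> is, up to an error of size \<open>N\<close> on average, constant on \<open>B\<close>: the part inside the doubled
  ball is small by \<open>L\<^sup>2\<close> boundedness and the John--Nirenberg estimate, and the part outside differs from its value at the
  centre by a bounded amount, by smoothness of the kernel.
\<close>

lemma BMOH_ext_decomposition:
  assumes f: "bmo_witness f N" and r: "r > 0"
  obtains e e0 where "set_integrable lebesgue (ball p r) e"
    "mean_on (ball p r) (\<lambda>x. norm (e x - e0)) \<le> local_const * N"
    "AE x in lebesgue. x \<in> ball p r \<longrightarrow>
       BMOH_ext T K f x = e x + mean_on (ball p r) f * BMOH_ext T K (\<lambda>_. 1) x"
proof
  note D = bmo_witnessD[OF f]
  let ?B = "ball p r" and ?n = "CARD('n)"
  define d where "d = mean_on ?B f"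
  define h where "h = (\<lambda>y. f y - d)"
  let ?u = "cut p (2 * r) h"
  let ?F = "far_part p (2 * r) h"
  have r2: "2 * r > 0" using r by simp
  have hm: "h \<in> borel_measurable lebesgue" unfolding h_def using D(3) by measurable
  have u: "?u \<in> L2" unfolding h_def by (rule cut_L2[OF f])
  have t: "tail_integrable p (2 * r) h" "tail_mass p (2 * r) h \<le> tail_const TYPE('n) * N / r"
    unfolding h_def d_def by (rule bmo_tail_mean[OF f r])+
  have "(LINT x|lebesgue. (norm (?u x))\<^sup>2) = (LINT x:ball p (2 * r)|lebesgue. (norm (h x))\<^sup>2)"
    unfolding cut_def using bmo_witness_square(1)[OF f r2, of p d] by (intro indicator_mult_L2(2) hm) (auto simp: h_def)
  also have "\<dots> = measure lebesgue (ball p (2 * r)) * mean_on (ball p (2 * r)) (\<lambda>x. (norm (h x))\<^sup>2)"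
    using set_integral_ball_eq_mean[OF r2, of p "\<lambda>x. (norm (h x))\<^sup>2"] by simp
  also have "\<dots> \<le> measure lebesgue (ball p (2 * r)) * (2 * JN_const TYPE('n) * N\<^sup>2 + 2 * (2 ^ ?n * N)\<^sup>2)"
  proof (rule mult_left_mono)
    have "norm (mean_on (ball p (2 * r)) f - d) \<le> 2 ^ ?n * N"
      unfolding d_def by (rule mean_on_double_ball_diff[OF D(1) r D(4)[OF r2]])
    then have "(norm (mean_on (ball p (2 * r)) f - d))\<^sup>2 \<le> (2 ^ ?n * N)\<^sup>2" by (intro power_mono) auto
    then show "mean_on (ball p (2 * r)) (\<lambda>x. (norm (h x))\<^sup>2) \<le> 2 * JN_const TYPE('n) * N\<^sup>2 + 2 * (2 ^ ?n * N)\<^sup>2"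
      using bmo_witness_square(2)[OF f r2, of p d] unfolding h_def by linarith
  qed simp
  also have "measure lebesgue (ball p (2 * r)) = 2 ^ ?n * measure lebesgue ?B"
    by (rule measure_ball_scale) (use r in auto)
  finally have A: "(LINT x|lebesgue. (norm (?u x))\<^sup>2) \<le> (2 ^ ?n * (2 * JN_const TYPE('n) + 2 * (2 ^ ?n)\<^sup>2)) * N\<^sup>2 * measure lebesgue ?B"
    by (simp add: algebra_simps power_mult_distrib)
  note TB = T_mean_bound[OF u D(2) r A]
  have FB: "set_integrable lebesgue ?B ?F"
  proof -
    have "continuous_on (cball p r) ?F"
      by (rule continuous_on_subset[OF continuous_on_far_part[OF t(1)]]) (use r in auto)
    then have i: "integrable lborel (\<lambda>x. indicator (cball p r) x *\<^sub>R ?F x)"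
      by (rule borel_integrable_compact[OF compact_cball])
    then have "set_integrable lebesgue (cball p r) ?F"
      using borel_measurable_integrable[OF i] by (simp add: set_integrable_def integrable_completion)
    then show ?thesis by (rule set_integrable_subset) (auto simp: ball_subset_cball)
  qed
  let ?e = "\<lambda>x. T ?u x + ?F x" and ?k = "?F p"
  show ei: "set_integrable lebesgue ?B ?e" by (rule set_integral_add(1)[OF TB(1) FB])
  let ?b = "C * tail_const TYPE('n) * N"
  have Fb: "norm (?F x - ?F p) \<le> ?b" if "x \<in> ?B" for x
  proof -
    have "norm (?F x - ?F p) \<le> C * r * tail_mass p (2 * r) h"
      by (rule far_part_smooth_bound[OF t(1) that])
    also have "\<dots> \<le> C * r * (tail_const TYPE('n) * N / r)"
      using C r by (intro mult_left_mono t(2)) auto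
    finally show ?thesis using r by simp
  qed
  have "mean_on ?B (\<lambda>x. norm (?e x - ?k)) \<le> mean_on ?B (\<lambda>x. norm (T ?u x) + ?b)"
  proof (rule mean_on_mono)
    show "norm (?e x - ?k) \<le> norm (T ?u x) + ?b" if "x \<in> ?B" for x
      using Fb[OF that] norm_triangle_ineq[of "T ?u x" "?F x - ?F p"] by (simp add: algebra_simps)
  qed (intro set_integrable_norm set_integral_diff(1) set_integral_add(1) ei TB(1) set_integrable_const_ball)+
  also have "\<dots> = mean_on ?B (\<lambda>x. norm (T ?u x)) + ?b"
    by (subst mean_on_add[OF set_integrable_norm[OF TB(1)] set_integrable_const_ball]) (simp only: mean_on_const[OF r])
  also have "\<dots> \<le> local_const * N"
    using TB(2) unfolding local_const_def by (simp only: distrib_right mult.assoc)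
  finally show "mean_on ?B (\<lambda>x. norm (?e x - ?k)) \<le> local_const * N" .
  let ?one = "\<lambda>_ :: real^'n. 1 :: 'k"
  let ?cu = "cut p (2 * r) ?one"
  have c1: "?cu \<in> L2" by (rule bmo_cut_L2[OF bmo_witness_one])
  have dc1: "(\<lambda>y. d * ?cu y) \<in> L2"
    using c1 unfolding L2_def by (auto simp: norm_mult power_mult_distrib)
  have cf: "cut p (2 * r) f = (\<lambda>y. ?u y + d * ?cu y)"
    by (auto simp: cut_def h_def fun_eq_iff indicator_def)
  have "AE x in lebesgue. T (cut p (2 * r) f) x = T ?u x + T (\<lambda>y. d * ?cu y) x"
    unfolding cf by (rule T_add[OF u dc1])
  moreover have "AE x in lebesgue. T (\<lambda>y. d * ?cu y) x = d * T ?cu x" by (rule T_scale[OF c1])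
  moreover note bmo_version_local[OF f r2, of p] bmo_version_local[OF bmo_witness_one r2, of p]
  ultimately show "AE x in lebesgue. x \<in> ?B \<longrightarrow> BMOH_ext T K f x = ?e x + mean_on ?B f * BMOH_ext T K ?one x"
  proof eventually_elim
    case (elim x)
    show ?case
    proof
      assume "x \<in> ?B"
      then have x: "x \<in> ball p (2 * r)" using r by auto
      have i: "set_integrable lebesgue (- ball p (2 * r)) (\<lambda>y. K x y * h y)"
        "set_integrable lebesgue (- ball p (2 * r)) (\<lambda>y. K x y * 1)"
        by (rule far_part_integrable[OF t(1) x], rule far_part_integrable[OF bmo_tail_integrable0[OF bmo_witness_one r2] x])
      have "far_part p (2 * r) f x = (LINT y:- ball p (2 * r)|lebesgue. K x y * h y + d * (K x y * 1))"
        unfolding far_part_def h_def by (simp add: algebra_simps)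
      also have "\<dots> = ?F x + d * far_part p (2 * r) ?one x"
        unfolding far_part_def by (subst set_integral_add(2)[OF i(1) set_integrable_mult_right[OF i(2)]]) (simp only: set_integral_mult_right)
      finally have F: "far_part p (2 * r) f x = ?F x + d * far_part p (2 * r) ?one x" .
      have "BMOH_ext T K f x = (T ?u x + d * T ?cu x) + far_part p (2 * r) f x"
        using elim x by simp
      also have "\<dots> = ?e x + d * (T ?cu x + far_part p (2 * r) ?one x)"
        unfolding F by (simp add: algebra_simps)
      also have "T ?cu x + far_part p (2 * r) ?one x = BMOH_ext T K ?one x"
        using elim x by simp
      finally show "BMOH_ext T K f x = ?e x + mean_on ?B f * BMOH_ext T K ?one x"
        by (simp add: d_def)
    qed
  qed
qed

lemma BMOH_ext_oscillation:
  assumes f: "bmo_witness f N" and r: "r > 0"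
  shows "mean_on (ball p r) (\<lambda>x. norm (BMOH_ext T K f x - mean_on (ball p r) (BMOH_ext T K f)))
      \<le> 2 * (local_const * N + norm (mean_on (ball p r) f) *
        mean_on (ball p r) (\<lambda>x. norm (BMOH_ext T K (\<lambda>_. 1) x - mean_on (ball p r) (BMOH_ext T K (\<lambda>_. 1)))))"
    and "norm (mean_on (ball p r) f) *
        mean_on (ball p r) (\<lambda>x. norm (BMOH_ext T K (\<lambda>_. 1) x - mean_on (ball p r) (BMOH_ext T K (\<lambda>_. 1))))
      \<le> 2 * (local_const * N +
        mean_on (ball p r) (\<lambda>x. norm (BMOH_ext T K f x - mean_on (ball p r) (BMOH_ext T K f))))"
proof -
  obtain e e0 where e: "set_integrable lebesgue (ball p r) e"
    "mean_on (ball p r) (\<lambda>x. norm (e x - e0)) \<le> local_const * N"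
    "AE x in lebesgue. x \<in> ball p r \<longrightarrow>
       BMOH_ext T K f x = e x + mean_on (ball p r) f * BMOH_ext T K (\<lambda>_. 1) x"
    by (rule BMOH_ext_decomposition[OF f r])
  note i = locally_integrable_ball[OF BMOH_ext_locally_integrable[OF f]]
    and i1 = locally_integrable_ball[OF BMOH_ext_locally_integrable[OF bmo_witness_one]]
  from oscillation_linear_combination[OF r i e(1) i1 e(3) e(2)] show
    "mean_on (ball p r) (\<lambda>x. norm (BMOH_ext T K f x - mean_on (ball p r) (BMOH_ext T K f)))
      \<le> 2 * (local_const * N + norm (mean_on (ball p r) f) *
        mean_on (ball p r) (\<lambda>x. norm (BMOH_ext T K (\<lambda>_. 1) x - mean_on (ball p r) (BMOH_ext T K (\<lambda>_. 1)))))"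
    and "norm (mean_on (ball p r) f) *
        mean_on (ball p r) (\<lambda>x. norm (BMOH_ext T K (\<lambda>_. 1) x - mean_on (ball p r) (BMOH_ext T K (\<lambda>_. 1))))
      \<le> 2 * (local_const * N +
        mean_on (ball p r) (\<lambda>x. norm (BMOH_ext T K f x - mean_on (ball p r) (BMOH_ext T K f))))" .
qed

end

section \<open>Logarithmic test functions\<close>

text \<open>
  The test function of the criterion is \<open>truncated_log s \<gamma> \<bar>y - p\<bar>\<close> with \<open>\<gamma>\<close> the critical radius of \<open>p\<close>. It equals the full
  logarithm \<open>ln (\<gamma> / s)\<close> on the ball of radius \<open>s\<close> and vanishes outside the critical ball.
\<close>

definition truncated_log :: "real \<Rightarrow> real \<Rightarrow> real \<Rightarrow> real" where
  "truncated_log s \<gamma> t = ln (\<gamma> / max s (min \<gamma> t))"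

context
  fixes s \<gamma> :: real
  assumes s: "0 < s" "s \<le> \<gamma>"
begin

lemma truncated_log_antimono: "t \<le> t' \<Longrightarrow> truncated_log s \<gamma> t' \<le> truncated_log s \<gamma> t"
  unfolding truncated_log_def using s
  by (intro ln_mono divide_left_mono max.mono min.mono mult_pos_pos divide_pos_pos) (auto simp: less_max_iff_disj)

lemma truncated_log_inner: "t \<le> s \<Longrightarrow> truncated_log s \<gamma> t = ln (\<gamma> / s)"
  unfolding truncated_log_def using s by (simp add: max_def min_def)

lemma truncated_log_outer: "t \<ge> \<gamma> \<Longrightarrow> truncated_log s \<gamma> t = 0"
  unfolding truncated_log_def using s by (simp add: max_def min_def)

lemma truncated_log_double:
  assumes t: "t \<ge> 0"
  shows "truncated_log s \<gamma> t \<le> truncated_log s \<gamma> (2 * t) + ln 2"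
proof -
  let ?a = "max s (min \<gamma> t)" and ?b = "max s (min \<gamma> (2 * t))"
  have pos: "?a > 0" "?b > 0" "\<gamma> > 0" using s by (auto simp: less_max_iff_disj)
  have "?b \<le> 2 * ?a" using s t by (auto simp: max_def min_def)
  then have "\<gamma> / ?a \<le> (\<gamma> / ?b) * 2" using pos by (simp add: divide_simps)
  then have "ln (\<gamma> / ?a) \<le> ln ((\<gamma> / ?b) * 2)" using pos by (intro ln_mono) auto
  also have "\<dots> = ln (\<gamma> / ?b) + ln 2" using pos by (intro ln_mult_pos divide_pos_pos) auto
  finally show ?thesis by (simp add: truncated_log_def)
qed

lemma continuous_on_truncated_log: "continuous_on A (\<lambda>y. truncated_log s \<gamma> (dist p y))"
  unfolding truncated_log_def using s
  by (intro continuous_intros) (auto simp: max_def min_def)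

lemma truncated_log_integrable:
  fixes p x :: "real^'n"
  shows "set_integrable lebesgue (ball x r) (\<lambda>y. truncated_log s \<gamma> (dist p y))"
  by (rule locally_integrable_ball[OF locally_integrable_continuous[OF continuous_on_truncated_log]])

text \<open>
  Halve the radius until it drops below \<open>s\<close>, where the function is constant. Each halving costs \<open>ln 2\<close> on the
  whole ball, and the remaining error is weighted by the volume ratio \<open>2 ^ -n \<le> 1 / 2\<close>, so the costs sum to at most \<open>2 ln 2\<close>,
  independently of \<open>s\<close>.
\<close>

lemma truncated_log_mean_centred:
  fixes p :: "real^'n"
  assumes \<rho>: "\<rho> > 0"
  shows "mean_on (ball p \<rho>) (\<lambda>y. truncated_log s \<gamma> (dist p y) - truncated_log s \<gamma> \<rho>) \<le> 2 * ln 2"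
proof -
  let ?f = "\<lambda>y. truncated_log s \<gamma> (dist p y)"
  obtain k :: nat where "\<rho> / s < 2 ^ k"
    using real_arch_pow[of 2 "\<rho> / s"] by auto
  then have "\<rho> \<le> 2 ^ k * s" using s by (simp add: field_simps)
  then show ?thesis using \<rho>
  proof (induction k arbitrary: \<rho>)
    case 0
    have "mean_on (ball p \<rho>) (\<lambda>y. ?f y - truncated_log s \<gamma> \<rho>) = mean_on (ball p \<rho>) (\<lambda>y. 0)"
      by (rule mean_on_cong) (use 0 in \<open>auto simp: truncated_log_inner\<close>)
    also have "\<dots> = 0" by (rule mean_on_const[OF 0(2)])
    finally show ?case by simp
  next
    case (Suc k)
    let ?h = "\<lambda>y. ?f y - truncated_log s \<gamma> (\<rho> / 2)"
    have IH: "mean_on (ball p (\<rho> / 2)) ?h \<le> 2 * ln 2" using Suc by (intro Suc.IH) auto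
    have r2: "\<rho> / 2 > 0" using Suc by simp
    have V: "measure lebesgue (ball p \<rho>) > 0" by (rule measure_ball_pos[OF Suc.prems(2)])
    have i: "set_integrable lebesgue (ball x r) (\<lambda>y. ?f y - c)" for x r c
      by (intro set_integral_diff(1) truncated_log_integrable set_integrable_const_ball)
    have ind: "set_integrable lebesgue (ball p \<rho>) (\<lambda>y. indicator (ball p (\<rho> / 2)) y * ?h y)"
    proof -
      have "(\<lambda>y. indicator (ball p \<rho>) y *\<^sub>R (indicator (ball p (\<rho> / 2)) y * ?h y)) = (\<lambda>y. indicator (ball p (\<rho> / 2)) y *\<^sub>R ?h y)"
        using Suc.prems by (auto simp: indicator_def fun_eq_iff)
      then show ?thesis using i[of p "\<rho> / 2"] by (simp add: set_integrable_def)
    qed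
    have "(LINT y:ball p \<rho>|lebesgue. ?f y - truncated_log s \<gamma> \<rho>)
        \<le> (LINT y:ball p \<rho>|lebesgue. ln 2 + indicator (ball p (\<rho> / 2)) y * ?h y)"
    proof (rule set_integral_mono[OF i])
      show "set_integrable lebesgue (ball p \<rho>) (\<lambda>y. ln 2 + indicator (ball p (\<rho> / 2)) y * ?h y)"
        by (intro set_integral_add(1) ind set_integrable_const_ball)
      fix y assume "y \<in> ball p \<rho>"
      have "truncated_log s \<gamma> (\<rho> / 2) \<le> truncated_log s \<gamma> \<rho> + ln 2"
        using truncated_log_double[of "\<rho> / 2"] Suc.prems by simp
      moreover have "y \<notin> ball p (\<rho> / 2) \<Longrightarrow> ?f y \<le> truncated_log s \<gamma> (\<rho> / 2)"
        by (intro truncated_log_antimono) auto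
      ultimately show "?f y - truncated_log s \<gamma> \<rho> \<le> ln 2 + indicator (ball p (\<rho> / 2)) y * ?h y"
        by (auto simp: indicator_def)
    qed
    also have "\<dots> = (LINT y:ball p \<rho>|lebesgue. ln 2) + (LINT y:ball p \<rho>|lebesgue. indicator (ball p (\<rho> / 2)) y * ?h y)"
      by (rule set_integral_add(2)[OF set_integrable_const_ball ind])
    also have "(LINT y:ball p \<rho>|lebesgue. ln 2) = measure lebesgue (ball p \<rho>) * ln 2"
      using set_integral_ball_eq_mean[OF Suc.prems(2), of p "\<lambda>_. ln 2 :: real"] mean_on_const[OF Suc.prems(2), of p "ln 2 :: real"] by simp
    also have "(LINT y:ball p \<rho>|lebesgue. indicator (ball p (\<rho> / 2)) y * ?h y) = (LINT y:ball p (\<rho> / 2)|lebesgue. ?h y)"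
      unfolding set_lebesgue_integral_def using Suc.prems
      by (intro Bochner_Integration.integral_cong) (auto simp: indicator_def)
    also have "\<dots> = measure lebesgue (ball p (\<rho> / 2)) * mean_on (ball p (\<rho> / 2)) ?h"
      using set_integral_ball_eq_mean[OF r2, of p ?h] by simp
    also have "\<dots> \<le> measure lebesgue (ball p (\<rho> / 2)) * (2 * ln 2)" by (intro mult_left_mono IH) simp
    also have "\<dots> \<le> measure lebesgue (ball p \<rho>) * ln 2"
    proof -
      have "measure lebesgue (ball p \<rho>) = 2 ^ CARD('n) * measure lebesgue (ball p (\<rho> / 2))"
        using measure_ball_scale[of "\<rho> / 2" 2 p p] Suc.prems by simp
      moreover have "(2::real) ^ 1 \<le> 2 ^ CARD('n)" by (intro power_increasing) (auto simp: Suc_le_eq)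
      ultimately show ?thesis
        using mult_right_mono[of 2 "2 ^ CARD('n)" "measure lebesgue (ball p (\<rho> / 2)) * ln 2"] by (simp add: mult_ac)
    qed
    finally show ?case using V by (simp add: mean_on_def field_simps)
  qed
qed

lemma truncated_log_mean_ball:
  fixes p :: "real^'n"
  assumes r: "r > 0" and c: "c > 0" and sub: "ball z r \<subseteq> ball p (c * r)"
  shows "mean_on (ball z r) (\<lambda>y. \<bar>truncated_log s \<gamma> (dist p y) - truncated_log s \<gamma> (c * r)\<bar>) \<le> c ^ CARD('n) * (2 * ln 2)"
proof -
  let ?h = "\<lambda>y. truncated_log s \<gamma> (dist p y) - truncated_log s \<gamma> (c * r)"
  have h0: "?h y \<ge> 0" if "y \<in> ball p (c * r)" for y
    using truncated_log_antimono[of "dist p y" "c * r"] that by simp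
  have "mean_on (ball z r) (\<lambda>y. \<bar>?h y\<bar>) = mean_on (ball z r) ?h"
    by (rule mean_on_cong) (use h0 sub in auto)
  also have "\<dots> \<le> c ^ CARD('n) * mean_on (ball p (c * r)) ?h"
    by (rule mean_on_ball_le_scale[OF _ h0 r c sub])
       (auto intro!: set_integral_diff(1) truncated_log_integrable)
  also have "\<dots> \<le> c ^ CARD('n) * (2 * ln 2)"
    using r c by (intro mult_left_mono truncated_log_mean_centred) auto
  finally show ?thesis .
qed

end

text \<open>
  The power of 10 is the volume ratio of a ball to the ball of ten times its radius, which is the largest
  enlargement needed to place a ball inside one centred at \<open>p\<close>.
\<close>

definition test_const :: "'n::finite itself \<Rightarrow> real" where
  "test_const _ = 10 ^ CARD('n) * (4 * ln 2)"

text \<open>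
  The norms of the test functions are bounded independently of \<open>s\<close> and \<open>p\<close>. On a ball far from
  \<open>p\<close> relative to its radius the distance to \<open>p\<close> varies at most by a factor 2 around its value at
  the centre, so the function varies by at most \<open>ln 2\<close> from that value. A ball near \<open>p\<close> lies in a
  comparable ball around \<open>p\<close>, where the centred estimate applies. For the size condition, a ball
  of at least critical radius that meets the critical ball of \<open>p\<close> also lies in a comparable ball around \<open>p\<close>,
  beyond whose radius the function vanishes.
\<close>

lemma bmo_witness_truncated_log:
  fixes p :: "real^'n"
  assumes s: "0 < s" "s \<le> critical_radius p"
  shows "bmo_witness (\<lambda>y. of_real (truncated_log s (critical_radius p) (dist p y)) :: 'k::{real_normed_field, euclidean_space}) (test_const TYPE('n))"
proof -
  let ?n = "CARD('n)"
  define \<gamma> where "\<gamma> = critical_radius p"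
  have s': "0 < s" "s \<le> \<gamma>" using s by (auto simp: \<gamma>_def)
  let ?\<phi> = "truncated_log s \<gamma>"
  let ?f = "\<lambda>y. of_real (?\<phi> (dist p y)) :: 'k"
  have fl: "locally_integrable ?f"
    by (intro locally_integrable_continuous continuous_on_of_real continuous_on_truncated_log[OF s'])
  have nd: "norm (?f y - of_real c) = \<bar>?\<phi> (dist p y) - c\<bar>" for y c
    by (simp flip: of_real_diff)
  have one: "(1::real) \<le> 10 ^ ?n" by simp
  have three: "(3::real) ^ ?n \<le> 10 ^ ?n" by (intro power_mono) auto
  have l2: "ln 2 > (0::real)" by simp
  have osc: "mean_on (ball z r) (\<lambda>y. norm (?f y - mean_on (ball z r) ?f)) \<le> test_const TYPE('n)" if r: "r > 0" for z r
  proof -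
    have twice: "mean_on (ball z r) (\<lambda>y. norm (?f y - mean_on (ball z r) ?f)) \<le> 2 * mean_on (ball z r) (\<lambda>y. \<bar>?\<phi> (dist p y) - c\<bar>)" for c
      using oscillation_le_twice[OF locally_integrable_ball[OF fl] r, of z "of_real c"] by (simp only: nd)
    show ?thesis
    proof (cases "dist p z > 2 * r")
      case True
      let ?d = "dist p z"
      have "mean_on (ball z r) (\<lambda>y. \<bar>?\<phi> (dist p y) - ?\<phi> ?d\<bar>) \<le> mean_on (ball z r) (\<lambda>y. ln 2)"
      proof (rule mean_on_mono)
        show "set_integrable lebesgue (ball z r) (\<lambda>y. \<bar>?\<phi> (dist p y) - ?\<phi> ?d\<bar>)"
          by (intro set_integrable_abs set_integral_diff(1) truncated_log_integrable[OF s'] set_integrable_const_ball)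
        fix y assume y: "y \<in> ball z r"
        have a: "?d / 2 \<le> dist p y" "dist p y \<le> 2 * ?d"
          using y True dist_triangle[of p z y] dist_triangle[of p y z] by (auto simp: dist_commute)
        have "?\<phi> (dist p y) \<le> ?\<phi> (?d / 2)" "?\<phi> (2 * ?d) \<le> ?\<phi> (dist p y)"
          using a by (auto intro!: truncated_log_antimono[OF s'])
        moreover have "?\<phi> (?d / 2) \<le> ?\<phi> ?d + ln 2" "?\<phi> ?d \<le> ?\<phi> (2 * ?d) + ln 2"
          using truncated_log_double[OF s', of "?d / 2"] truncated_log_double[OF s', of ?d] by auto
        ultimately show "\<bar>?\<phi> (dist p y) - ?\<phi> ?d\<bar> \<le> ln 2" by linarith
      qed simp
      then have "mean_on (ball z r) (\<lambda>y. \<bar>?\<phi> (dist p y) - ?\<phi> ?d\<bar>) \<le> ln 2"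
        by (simp only: mean_on_const[OF r])
      then have "2 * mean_on (ball z r) (\<lambda>y. \<bar>?\<phi> (dist p y) - ?\<phi> ?d\<bar>) \<le> 1 * (4 * ln 2)"
        using l2 by linarith
      also have "\<dots> \<le> test_const TYPE('n)"
        unfolding test_const_def by (intro mult_right_mono one) simp
      finally show ?thesis using twice[of "?\<phi> ?d"] by linarith
    next
      case False
      have "ball z r \<subseteq> ball p (3 * r)"
      proof
        fix y assume "y \<in> ball z r"
        then show "y \<in> ball p (3 * r)" using False dist_triangle[of p y z] by simp
      qed
      then have "2 * mean_on (ball z r) (\<lambda>y. \<bar>?\<phi> (dist p y) - ?\<phi> (3 * r)\<bar>) \<le> 2 * (3 ^ ?n * (2 * ln 2))"
        by (intro mult_left_mono truncated_log_mean_ball[OF s' r]) auto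
      also have "\<dots> = 3 ^ ?n * (4 * ln 2)" by simp
      also have "\<dots> \<le> test_const TYPE('n)"
        unfolding test_const_def by (intro mult_right_mono three) simp
      finally show ?thesis using twice[of "?\<phi> (3 * r)"] by linarith
    qed
  qed
  have size: "mean_on (ball z r) (\<lambda>y. norm (?f y)) \<le> test_const TYPE('n)" if r: "r \<ge> critical_radius z" for z r
  proof -
    have r0: "r > 0" using r critical_radius_pos[of z] by linarith
    have t0: "test_const TYPE('n) \<ge> 0" by (simp add: test_const_def)
    have nf: "norm (?f y) = \<bar>?\<phi> (dist p y)\<bar>" for y by simp
    show ?thesis
    proof (cases "dist p z < r + \<gamma>")
      case True
      then have \<gamma>8: "\<gamma> \<le> 8 * r" unfolding \<gamma>_def by (intro critical_radius_le_near[OF r]) (simp add: \<gamma>_def)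
      have sub: "ball z r \<subseteq> ball p (10 * r)"
      proof
        fix y assume "y \<in> ball z r"
        then show "y \<in> ball p (10 * r)" using True \<gamma>8 dist_triangle[of p y z] by simp
      qed
      have "?\<phi> (10 * r) = 0" using \<gamma>8 r0 by (intro truncated_log_outer[OF s']) simp
      then have "mean_on (ball z r) (\<lambda>y. norm (?f y)) \<le> 10 ^ ?n * (2 * ln 2)"
        using truncated_log_mean_ball[OF s' r0 _ sub] by simp
      also have "\<dots> \<le> test_const TYPE('n)"
        unfolding test_const_def by (intro mult_left_mono) auto
      finally show ?thesis .
    next
      case False
      have "mean_on (ball z r) (\<lambda>y. norm (?f y)) = mean_on (ball z r) (\<lambda>y. 0)"
      proof (rule mean_on_cong)
        fix y assume "y \<in> ball z r"
        then have "\<gamma> \<le> dist p y" using False dist_triangle[of p z y] by (simp add: dist_commute)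
        then show "norm (?f y) = 0" by (simp add: truncated_log_outer[OF s'])
      qed simp
      also have "\<dots> = 0" by (rule mean_on_const[OF r0])
      finally show ?thesis using t0 by (simp only:)
    qed
  qed
  have "test_const TYPE('n) > 0" by (simp add: test_const_def)
  with fl osc size have "bmo_witness ?f (test_const TYPE('n))"
    unfolding bmo_witness_def BMOH_bound_def by blast
  then show ?thesis by (simp only: \<gamma>_def)
qed

section \<open>The criterion\<close>

lemma BMOH_bound_mono:
  "BMOH_bound f c \<Longrightarrow> c \<le> d \<Longrightarrow> BMOH_bound f d"
  unfolding BMOH_bound_def by (meson order_trans)

lemma BMOH_norm_le:
  "BMOH_bound f c \<Longrightarrow> 0 \<le> c \<Longrightarrow> BMOH_norm f \<le> c"
  unfolding BMOH_norm_def by (rule cInf_lower) (auto intro: bdd_belowI[of _ 0])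

lemma BMOH_norm_nonneg:
  assumes "f \<in> BMOH"
  shows "0 \<le> BMOH_norm f"
  unfolding BMOH_norm_def
proof (rule cInf_greatest)
  show "{C. C \<ge> 0 \<and> BMOH_bound f C} \<noteq> {}"
    using assms unfolding BMOH_def by (auto intro: less_imp_le)
qed auto

lemma BMOH_bound_of_norm_less:
  assumes "f \<in> BMOH" "BMOH_norm f < c"
  shows "BMOH_bound f c"
proof -
  have "{C. C \<ge> 0 \<and> BMOH_bound f C} \<noteq> {}"
    using assms(1) unfolding BMOH_def by (auto intro: less_imp_le)
  from cInf_lessD[OF this] assms(2) obtain d where "BMOH_bound f d" "d < c"
    unfolding BMOH_norm_def by blast
  then show ?thesis by (auto intro: BMOH_bound_mono)
qed

lemma BMOH_eq_bmo_witness: "f \<in> BMOH \<longleftrightarrow> (\<exists>N. bmo_witness f N)"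
  by (auto simp: BMOH_def bmo_witness_def)

context hermite_operator
begin

text \<open>
  The mean of the test function over the ball of radius \<open>s\<close> is exactly \<open>ln (\<gamma> / s)\<close>, and the
  oscillation of its image is bounded. So the second estimate of the oscillation lemma bounds \<open>ln (\<gamma> / s)\<close> times the
  oscillation of \<open>T1\<close>; the oscillation itself is bounded because the constant \<open>1\<close> is in the space.
  The size condition on \<open>T1\<close> is the one in the definition of the space, at the critical radius.
\<close>

lemma T1_conditions_if_bounded:
  assumes "bounded_on_BMOH (BMOH_ext T K)"
  defines "T1 \<equiv> BMOH_ext T K (\<lambda>_. 1)"
  shows "\<exists>C>0.
      (\<forall>x. mean_on (ball x (critical_radius x)) (\<lambda>y. norm (T1 y)) \<le> C) \<and>
      (\<forall>x s. 0 < s \<and> s \<le> critical_radius x \<longrightarrow>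
         (1 + ln (critical_radius x / s)) *
           mean_on (ball x s) (\<lambda>y. norm (T1 y - mean_on (ball x s) T1)) \<le> C)"
proof -
  obtain A where A: "\<And>f. f \<in> BMOH \<Longrightarrow> BMOH_ext T K f \<in> BMOH \<and> BMOH_norm (BMOH_ext T K f) \<le> A * BMOH_norm f"
    using assms(1) unfolding bounded_on_BMOH_def by blast
  define a where "a = \<bar>A\<bar> + 1"
  have a0: "a > 0" by (simp add: a_def)
  have bd: "BMOH_bound (BMOH_ext T K f) (a * N)" if f: "bmo_witness f N" for f N
  proof -
    have fB: "f \<in> BMOH" using f BMOH_eq_bmo_witness by blast
    have N: "N > 0" "BMOH_bound f N" using f by (auto simp: bmo_witness_def)
    have "BMOH_norm (BMOH_ext T K f) \<le> A * BMOH_norm f" using A[OF fB] by simp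
    also have "\<dots> \<le> \<bar>A\<bar> * BMOH_norm f" using BMOH_norm_nonneg[OF fB] by (intro mult_right_mono) auto
    also have "\<dots> \<le> \<bar>A\<bar> * N" using BMOH_norm_le[OF N(2)] N(1) by (intro mult_left_mono) auto
    also have "\<dots> < a * N" using N by (simp add: a_def)
    finally show ?thesis using A[OF fB] by (intro BMOH_bound_of_norm_less) auto
  qed
  define osc where "osc x s = mean_on (ball x s) (\<lambda>y. norm (T1 y - mean_on (ball x s) T1))" for x s
  have T1: "BMOH_bound T1 a" using bd[OF bmo_witness_one] by (simp add: T1_def)
  define t where "t = test_const TYPE('n)"
  define C1 where "C1 = a + \<bar>2 * (local_const * t + a * t)\<bar>"
  have C1: "a \<le> C1" "C1 > 0" using a0 by (auto simp: C1_def)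
  have "(1 + ln (critical_radius x / s)) * osc x s \<le> C1" if s: "0 < s" "s \<le> critical_radius x" for x s
  proof -
    let ?L = "ln (critical_radius x / s)"
    let ?f = "\<lambda>y. of_real (truncated_log s (critical_radius x) (dist x y)) :: 'k"
    have f: "bmo_witness ?f t" unfolding t_def by (rule bmo_witness_truncated_log[OF s])
    have L: "?L \<ge> 0" using s by simp
    have "mean_on (ball x s) ?f = mean_on (ball x s) (\<lambda>y. of_real ?L)"
      by (rule mean_on_cong) (auto simp: truncated_log_inner[OF s])
    also have "\<dots> = of_real ?L" by (rule mean_on_const[OF s(1)])
    finally have m: "norm (mean_on (ball x s) ?f) = ?L" using L by simp
    have "?L * osc x s \<le> 2 * (local_const * t +
        mean_on (ball x s) (\<lambda>y. norm (BMOH_ext T K ?f y - mean_on (ball x s) (BMOH_ext T K ?f))))"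
      using BMOH_ext_oscillation(2)[OF f s(1), of x] unfolding m osc_def T1_def .
    also have "\<dots> \<le> 2 * (local_const * t + a * t)"
      using bd[OF f] s(1) unfolding BMOH_bound_def by simp
    finally have "?L * osc x s \<le> C1 - a" by (simp add: C1_def)
    moreover have "osc x s \<le> a" using T1 s(1) unfolding BMOH_bound_def osc_def by simp
    ultimately show ?thesis by (simp only: distrib_right mult_1)
  qed
  moreover have "mean_on (ball x (critical_radius x)) (\<lambda>y. norm (T1 y)) \<le> C1" for x
    using T1 C1 unfolding BMOH_bound_def by (meson order_refl order_trans)
  ultimately show ?thesis using C1 unfolding osc_def by blast
qed

text \<open>
  For radii at least critical both conditions follow from the mean estimate. For smaller radii the
  oscillation of \<open>T1\<close> is multiplied by \<open>\<bar>f\<^sub>B\<bar>\<close>, which is of the order of \<open>1 + ln (\<gamma> / r)\<close>, precisely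
  the growth that the hypothesis compensates.
\<close>

lemma bounded_if_T1_oscillation:
  fixes B :: real
  defines "T1 \<equiv> BMOH_ext T K (\<lambda>_. 1)"
  assumes T1: "\<And>x s. 0 < s \<Longrightarrow> s \<le> critical_radius x \<Longrightarrow> (1 + ln (critical_radius x / s)) *
           mean_on (ball x s) (\<lambda>y. norm (T1 y - mean_on (ball x s) T1)) \<le> B"
  shows "bounded_on_BMOH (BMOH_ext T K)"
proof -
  define k :: real where "k = 1 + 2 ^ CARD('n) * 2"
  define a where "a = 2 * \<bar>critical_const\<bar> + 2 * \<bar>local_const\<bar> + 2 * k * \<bar>B\<bar> + 1"
  have k0: "k \<ge> 0" by (simp add: k_def)
  have a0: "a > 0" unfolding a_def using k0 by (intro add_nonneg_pos add_nonneg_nonneg mult_nonneg_nonneg) auto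
  have bd: "bmo_witness (BMOH_ext T K f) (a * N)" if f: "bmo_witness f N" for f N
  proof -
    let ?g = "BMOH_ext T K f"
    note D = bmo_witnessD[OF f]
    have gl: "locally_integrable ?g" by (rule BMOH_ext_locally_integrable[OF f])
    have kB: "k * \<bar>B\<bar> \<ge> 0" using k0 by simp
    have size: "mean_on (ball x r) (\<lambda>y. norm (?g y)) \<le> \<bar>critical_const\<bar> * N" if r: "r \<ge> critical_radius x" for x r
    proof -
      have "mean_on (ball x r) (\<lambda>y. norm (?g y)) \<le> critical_const * N"
        by (rule BMOH_ext_mean_critical[OF f r])
      also have "\<dots> \<le> \<bar>critical_const\<bar> * N" using D(2) by (intro mult_right_mono) auto
      finally show ?thesis .
    qed
    have osc: "mean_on (ball x r) (\<lambda>y. norm (?g y - mean_on (ball x r) ?g)) \<le> a * N" if r: "r > 0" for x r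
    proof (cases "r \<ge> critical_radius x")
      case True
      have "mean_on (ball x r) (\<lambda>y. norm (?g y - mean_on (ball x r) ?g)) \<le> 2 * mean_on (ball x r) (\<lambda>y. norm (?g y))"
        using oscillation_le_twice[OF locally_integrable_ball[OF gl] r, of x 0] by simp
      also have "\<dots> \<le> 2 * \<bar>critical_const\<bar> * N" using size[OF True] by simp
      also have "\<dots> \<le> a * N" using kB D(2) by (intro mult_right_mono) (auto simp: a_def)
      finally show ?thesis .
    next
      case False
      then have r': "r \<le> critical_radius x" by simp
      let ?o = "mean_on (ball x r) (\<lambda>y. norm (T1 y - mean_on (ball x r) T1))"
      have o0: "?o \<ge> 0" by (intro mean_on_nonneg) simp
      have "norm (mean_on (ball x r) f) * ?o \<le> (k * N * (1 + ln (critical_radius x / r))) * ?o"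
        unfolding k_def by (intro mult_right_mono bmo_mean_le[OF f r r'] o0)
      also have "\<dots> = k * N * ((1 + ln (critical_radius x / r)) * ?o)" by simp
      also have "\<dots> \<le> k * N * \<bar>B\<bar>"
        using T1[OF r r'] k0 D(2) by (intro mult_left_mono) auto
      finally have m: "norm (mean_on (ball x r) f) * ?o \<le> k * N * \<bar>B\<bar>" .
      have "mean_on (ball x r) (\<lambda>y. norm (?g y - mean_on (ball x r) ?g)) \<le> 2 * (local_const * N + norm (mean_on (ball x r) f) * ?o)"
        using BMOH_ext_oscillation(1)[OF f r, of x] by (simp only: T1_def)
      also have "\<dots> \<le> 2 * (\<bar>local_const\<bar> * N + k * N * \<bar>B\<bar>)"
        using m D(2) by (intro mult_left_mono add_mono mult_right_mono) auto
      also have "\<dots> = (2 * \<bar>local_const\<bar> + 2 * k * \<bar>B\<bar>) * N" by (simp add: algebra_simps)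
      also have "\<dots> \<le> a * N" using D(2) by (intro mult_right_mono) (auto simp: a_def)
      finally show ?thesis .
    qed
    have "mean_on (ball x r) (\<lambda>y. norm (?g y)) \<le> a * N" if r: "r \<ge> critical_radius x" for x r
    proof -
      have "\<bar>critical_const\<bar> * N \<le> a * N"
        using kB D(2) by (intro mult_right_mono) (auto simp: a_def)
      then show ?thesis using size[OF r] by (rule order_trans[rotated])
    qed
    then show ?thesis using osc gl a0 D(2) unfolding bmo_witness_def BMOH_bound_def by simp
  qed
  have "BMOH_ext T K f \<in> BMOH \<and> BMOH_norm (BMOH_ext T K f) \<le> a * BMOH_norm f" if f: "f \<in> BMOH" for f
  proof
    show gB: "BMOH_ext T K f \<in> BMOH" using f bd BMOH_eq_bmo_witness by blast
    have "BMOH_norm (BMOH_ext T K f) / a \<le> BMOH_norm f"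
    \<comment> \<open>every N above the norm is an admissible bound, so the estimate passes to the infimum\<close>
    proof (rule dense_ge)
      fix N assume N: "BMOH_norm f < N"
      then have "N > 0" using BMOH_norm_nonneg[OF f] by linarith
      moreover have "BMOH_bound f N" by (rule BMOH_bound_of_norm_less[OF f N])
      ultimately have "bmo_witness f N" using f by (simp add: bmo_witness_def BMOH_def)
      from bd[OF this] have "BMOH_bound (BMOH_ext T K f) (a * N)" "a * N > 0" by (auto simp: bmo_witness_def)
      then have "BMOH_norm (BMOH_ext T K f) \<le> a * N" by (intro BMOH_norm_le) auto
      then show "BMOH_norm (BMOH_ext T K f) / a \<le> N" using a0 by (simp add: field_simps)
    qed
    then show "BMOH_norm (BMOH_ext T K f) \<le> a * BMOH_norm f" using a0 by (simp add: field_simps)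
  qed
  then show ?thesis unfolding bounded_on_BMOH_def by blast
qed

end

text \<open>
  The bound of the operator may be taken nonnegative, as required for squaring it.
\<close>

lemma hermite_CZ_imp_hermite_operator:
  assumes "hermite_CZ T K"
  obtains C c M where "hermite_operator T K C c M"
proof -
  from assms obtain C c where Cc: "C > 0" "c > 0"
    and K: "\<And>x y. x \<noteq> y \<Longrightarrow> norm (K x y) \<le> C / norm (x - y) ^ CARD('a) * exp (- c * (norm x * norm (x - y) + (norm (x - y))\<^sup>2))"
      "\<And>x y z. norm (x - y) > 2 * norm (y - z) \<Longrightarrow> norm (K x y - K x z) + norm (K y x - K z x) \<le> C * (norm (y - z) / norm (x - y) ^ (CARD('a) + 1))"
    unfolding hermite_CZ_def hermite_kernel_def by blast
  from assms obtain M where M: "\<And>f. f \<in> L2 \<Longrightarrow> L2norm (T f) \<le> M * L2norm f"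
    unfolding hermite_CZ_def bounded_linear_L2_def by blast
  have M': "L2norm (T f) \<le> max M 0 * L2norm f" if "f \<in> L2" for f
  proof -
    have "0 \<le> L2norm f" unfolding L2norm_def by simp
    then have "M * L2norm f \<le> max M 0 * L2norm f" by (intro mult_right_mono) auto
    then show ?thesis using M[OF that] by linarith
  qed
  have "hermite_operator T K C c (max M 0)"
    using assms Cc K M' unfolding hermite_CZ_def bounded_linear_L2_def
    by unfold_locales auto
  then show ?thesis by (rule that)
qed

theorem theorem1p1:
  fixes T :: "(real^'n \<Rightarrow> 'k::{real_normed_field, euclidean_space}) \<Rightarrow> real^'n \<Rightarrow> 'k"
    and K :: "real^'n \<Rightarrow> real^'n \<Rightarrow> 'k"
    and T1 :: "real^'n \<Rightarrow> 'k"
  defines "T1 \<equiv> BMOH_ext T K (\<lambda>_. 1)"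
  assumes "hermite_CZ T K"
  shows "bounded_on_BMOH (BMOH_ext T K) \<longleftrightarrow>
    (\<exists>C>0.
      (\<forall>x. mean_on (ball x (critical_radius x)) (\<lambda>y. norm (T1 y)) \<le> C) \<and>
      (\<forall>x s. 0 < s \<and> s \<le> critical_radius x \<longrightarrow>
         (1 + ln (critical_radius x / s)) *
           mean_on (ball x s) (\<lambda>y. norm (T1 y - mean_on (ball x s) T1)) \<le> C))"
proof -
  obtain C c M where "hermite_operator T K C c M"
    by (rule hermite_CZ_imp_hermite_operator[OF assms(2)])
  then interpret hermite_operator T K C c M .
  show ?thesis
    unfolding T1_def using T1_conditions_if_bounded bounded_if_T1_oscillation by blast
qed

end
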